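(* There exists a continuous function $\varphi:[0,\infty)\to(0,1]$ (depending only on the dimension $n$), with $\varphi(t)=1$ if and only if $t=0$, such that for every convex body $K\subseteq\mathbb{R}^n$ which is not an ellipsoid, $$|C_\delta K|_n\le |C_\delta B_K|_n\quad\text{for every }\delta\in(0,1)\text{ with }\delta>\varphi\big(d_{\mathrm{BM}}(K,\mathbb{B})\big).$$
   Context: A convex body in $\mathbb{R}^n$ is a compact convex set with non-empty interior. $|\cdot|_n$ denotes $n$-dimensional Lebesgue measure. For a convex body $K$ and $\delta\in(0,1)$, $C_\delta K=\{x\in\mathbb{R}^n : |K\cap(K+x)|_n\ge \delta |K|_n\}$. $B_K$ is the Euclidean ball centered at the origin with the same volume as $K$, and $\mathbb{B}$ is the closed unit Euclidean ball of $\mathbb{R}^n$. An ellipsoid is an (invertible) affine image of the Euclidean ball. The Banach-Mazur distance between convex bodies $K,L\subseteq\mathbb{R}^n$ is $$d_{\mathrm{BM}}(K,L)=\min\{\lambda\ge 0 : K-x\subseteq\Phi(L-y)\subseteq e^\lambda(K-x)\text{ for some }\Phi\in GL(n),\ x,y\in\mathbb{R}^n\},$$ where $GL(n)$ is the set of invertible linear transformations of $\mathbb{R}^n$. *)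

theory Defs
  imports "HOL-Analysis.Analysis"
begin

definition convex_body :: "(real ^ 'n) set \<Rightarrow> bool" where
  "convex_body K \<longleftrightarrow> compact K \<and> convex K \<and> interior K \<noteq> {}"

abbreviation vol :: "(real ^ 'n) set \<Rightarrow> real" where
  "vol A \<equiv> measure lebesgue A"

definition C_body :: "real \<Rightarrow> (real ^ 'n) set \<Rightarrow> (real ^ 'n) set" where
  "C_body \<delta> K = {x. vol (K \<inter> (\<lambda>z. z + x) ` K) \<ge> \<delta> * vol K}"

text \<open>The radius is unique as soon as \<open>K\<close> has positive finite volume,
  in particular for every convex body.\<close>

definition vol_ball :: "(real ^ 'n) set \<Rightarrow> (real ^ 'n) set" where
  "vol_ball K = cball 0 (THE r. r \<ge> 0 \<and> vol (cball (0 :: real ^ 'n) r) = vol K)"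

definition GL :: "(real ^ 'n \<Rightarrow> real ^ 'n) set" where
  "GL = {\<Phi>. linear \<Phi> \<and> bij \<Phi>}"

definition ellipsoid :: "(real ^ 'n) set \<Rightarrow> bool" where
  "ellipsoid E \<longleftrightarrow> (\<exists>\<Phi>\<in>GL. \<exists>c. E = (\<lambda>z. \<Phi> z + c) ` cball 0 1)"

text \<open>For convex bodies the minimum in the definition of the Banach-Mazur distance is attained
  (the admissible \<open>\<Phi>\<close>, \<open>x\<close>, \<open>y\<close> can be confined to a compact set), so it
  coincides with the infimum used here.\<close>

definition d_BM :: "(real ^ 'n) set \<Rightarrow> (real ^ 'n) set \<Rightarrow> real" where
  "d_BM K L = Inf {l. l \<ge> 0 \<and> (\<exists>\<Phi>\<in>GL. \<exists>x y.
      (\<lambda>z. z - x) ` K \<subseteq> \<Phi> ` (\<lambda>z. z - y) ` L \<and>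
      \<Phi> ` (\<lambda>z. z - y) ` L \<subseteq> (\<lambda>z. exp l *\<^sub>R z) ` (\<lambda>z. z - x) ` K)}"

end

theory Submission
  imports Defs "HOL-Complex_Analysis.Great_Picard"
begin

text \<open>
  Write \<open>f\<^sub>K x\<close> for the volume of \<open>K - (K + x)\<close> and \<open>h\<^sub>K x\<close> for \<open>norm x\<close> times the volume of the
  projection of \<open>K\<close> along \<open>x\<close>. Then \<open>C_body \<delta> K\<close> is the set where \<open>f\<^sub>K x \<le> (1 - \<delta>) * vol K\<close>, the
  function \<open>h\<^sub>K\<close> is a norm, and \<open>f\<^sub>K \<le> h\<^sub>K\<close>. Conversely, if \<open>K\<close> has a chord equal to \<open>N *\<^sub>R x\<close>,
  then \<open>f\<^sub>K x \<ge> (1 - 1 / N) ^ (n - 1) * h\<^sub>K x\<close>; and a point \<open>x\<close> of \<open>C_body \<delta> K\<close> has such a chord as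
  soon as \<open>N * (1 - \<delta>) < 1\<close>. Hence, as \<open>\<delta>\<close> tends to 1, the body \<open>C_body \<delta> K\<close> equals
  \<open>(1 - \<delta>) * vol K\<close> times the unit ball of \<open>h\<^sub>K\<close> (the polar projection body) up to a factor that
  tends to 1 and that is the same for all \<open>K\<close> (\<open>vol_C_body_le\<close>, \<open>vol_C_body_ge\<close>). The claim is thereby
  reduced to a gap in Petty's projection inequality: the affine invariant
  \<open>petty K = vol K ^ (n - 1) * vol (polar_projection_body K)\<close> must satisfy
  \<open>petty K \<le> (1 - \<eta>) * petty B\<close> for the unit ball \<open>B\<close>, with \<open>\<eta> > 0\<close> depending only on a positive lower
  bound for the Banach-Mazur distance of \<open>K\<close> to \<open>B\<close> (\<open>petty_gap\<close>).

  Convex bodies modulo affine maps form a compact space on which \<open>petty\<close> is continuous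
  (\<open>affine_compactness\<close>), so \<open>petty\<close> has a maximizer, and the gap follows once every maximizer is known
  to be an ellipsoid (\<open>petty_max_ellipsoid\<close>): a sequence violating the gap would converge to a
  maximizer that is not an ellipsoid.

  Let \<open>K\<close> be a maximizer and \<open>u\<close> a direction. Steiner symmetrization \<open>S\<close> along \<open>u\<close> keeps the volume and
  satisfies \<open>S (polar_projection_body K) \<subseteq> polar_projection_body (S K)\<close> (\<open>steiner_polar_projection_body_subset\<close>).
  By maximality both sides have the same volume and therefore coincide. On a plane spanned by \<open>u\<close>
  and some \<open>\<theta>\<close> orthogonal to \<open>u\<close>, \<open>h\<^sub>K\<close> is the integral of the widths of the parallel sections of \<open>K\<close>. The equality first
  shows that \<open>p \<mapsto> h\<^sub>K (\<theta> + p *\<^sub>R u)\<close> is symmetric about some \<open>c / 2\<close> (\<open>petty_max_symmetric\<close>).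
  These symmetries, used in all directions, exclude segments in the boundary of the polar projection body
  (\<open>no_boundary_segment\<close>). Then the equality holds for all \<open>p\<close> in almost every parallel section, and
  it says that the chord of the section that
  realizes the supporting line of slope \<open>p\<close> from above also realizes the one of slope \<open>c - p\<close> from below. Two
  convex functions with a common choice of subgradients differ by a constant; so the midpoints of the
  chords parallel to \<open>u\<close> lie on a line of slope \<open>c / 2\<close> in every section. Letting \<open>\<theta>\<close> vary, all these midpoints lie
  in a hyperplane (\<open>petty_max_affine_reflection\<close>), for every \<open>u\<close>. A body with this property is an
  ellipsoid, because its affine reflections preserve the inertia form
  (\<open>ellipsoid_of_affine_reflections\<close>).
\<close>

section \<open>Integration over a slab\<close>

lemma nn_integral_lborel_shift:
  fixes f :: "'a::euclidean_space \<Rightarrow> ennreal"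
  assumes [measurable]: "f \<in> borel_measurable borel"
  shows "(\<integral>\<^sup>+y. f (y + c) \<partial>lborel) = (\<integral>\<^sup>+y. f y \<partial>lborel)"
proof -
  have "(\<integral>\<^sup>+y. f y \<partial>lborel) = (\<integral>\<^sup>+y. f y \<partial>distr lborel borel ((+) c))"
    by (simp add: lborel_distr_plus)
  also have "\<dots> = (\<integral>\<^sup>+y. f (c + y) \<partial>lborel)"
    by (subst nn_integral_distr) auto
  finally show ?thesis by (simp add: add.commute)
qed

text \<open>A form of Fubini's theorem along lines parallel to \<open>u\<close> that avoids choosing a complement of \<open>u\<close>: the lines
  are parametrized by the slab \<open>0 \<le> y \<bullet> v < 1\<close>, which meets each of them in a segment of
  parameter length 1. The proof exchanges the two integrals twice and uses translation invariance in between.\<close>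

lemma nn_integral_slab_fibration:
  fixes F :: "'a::euclidean_space \<Rightarrow> ennreal"
  assumes [measurable]: "F \<in> borel_measurable borel" and vu: "v \<bullet> u = 1"
  shows "(\<integral>\<^sup>+y. F y \<partial>lborel) =
    (\<integral>\<^sup>+y. indicator {y. 0 \<le> y \<bullet> v \<and> y \<bullet> v < 1} y * (\<integral>\<^sup>+t. F (y + t *\<^sub>R u) \<partial>lborel) \<partial>lborel)"
proof -
  let ?S = "{y. 0 \<le> y \<bullet> v \<and> y \<bullet> v < 1}"
  have [measurable]: "?S \<in> sets borel" by measurable
  have "(\<integral>\<^sup>+y. indicator ?S y * (\<integral>\<^sup>+t. F (y + t *\<^sub>R u) \<partial>(lborel::real measure)) \<partial>lborel)
     = (\<integral>\<^sup>+y. (\<integral>\<^sup>+t. indicator ?S y * F (y + t *\<^sub>R u) \<partial>lborel) \<partial>lborel)"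
    by (subst nn_integral_cmult) auto
  also have "\<dots> = (\<integral>\<^sup>+t. (\<integral>\<^sup>+y. indicator ?S y * F (y + t *\<^sub>R u) \<partial>lborel) \<partial>lborel)"
    by (rule lborel_pair.Fubini') measurable
  also have "\<dots> = (\<integral>\<^sup>+t. (\<integral>\<^sup>+y. indicator ?S (y - t *\<^sub>R u) * F y \<partial>lborel) \<partial>lborel)"
  proof (rule nn_integral_cong)
    fix t :: real
    have "(\<integral>\<^sup>+y. indicator ?S (y + t *\<^sub>R u - t *\<^sub>R u) * F (y + t *\<^sub>R u) \<partial>lborel)
       = (\<integral>\<^sup>+y. indicator ?S (y - t *\<^sub>R u) * F y \<partial>lborel)"
      by (rule nn_integral_lborel_shift) measurable
    then show "(\<integral>\<^sup>+y. indicator ?S y * F (y + t *\<^sub>R u) \<partial>lborel)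
       = (\<integral>\<^sup>+y. indicator ?S (y - t *\<^sub>R u) * F y \<partial>lborel)" by simp
  qed
  also have "\<dots> = (\<integral>\<^sup>+y. (\<integral>\<^sup>+t. indicator ?S (y - t *\<^sub>R u) * F y \<partial>(lborel::real measure)) \<partial>lborel)"
    by (rule lborel_pair.Fubini'[symmetric]) measurable
  also have "\<dots> = (\<integral>\<^sup>+y. F y \<partial>lborel)"
  proof (rule nn_integral_cong)
    fix y :: 'a
    have "(\<integral>\<^sup>+t. indicator ?S (y - t *\<^sub>R u) * F y \<partial>(lborel::real measure))
       = (\<integral>\<^sup>+t. indicator {y \<bullet> v - 1 <.. y \<bullet> v} t * F y \<partial>(lborel::real measure))"
      using vu by (intro nn_integral_cong) (auto simp: indicator_def inner_diff_left inner_diff_right inner_commute)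
    also have "\<dots> = F y"
      by (subst nn_integral_multc) auto
    finally show "(\<integral>\<^sup>+t. indicator ?S (y - t *\<^sub>R u) * F y \<partial>(lborel::real measure)) = F y" .
  qed
  finally show ?thesis by (rule sym)
qed

section \<open>Volumes of linear images\<close>

text \<open>Uniqueness of the translation invariant measure, proved by
  evaluating the integral of \<open>indicator A (f x) * indicator B (y + f x)\<close> over pairs \<open>(x, y)\<close> in two ways.\<close>

lemma lborel_linear_proportional:
  fixes f :: "'a::euclidean_space \<Rightarrow> 'a"
  assumes f: "linear f" and sf: "surj f" and [measurable]: "A \<in> sets borel" "B \<in> sets borel"
  shows "emeasure lborel (f -` A) * emeasure lborel B = emeasure lborel (f -` B) * emeasure lborel A"
proof -
  have [measurable]: "f \<in> borel_measurable borel"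
    using f by (intro borel_measurable_continuous_onI linear_continuous_on) (simp add: linear_conv_bounded_linear)
  have pre: "emeasure lborel (f -` C) = (\<integral>\<^sup>+x. indicator C (f x) \<partial>lborel)" if [measurable]: "C \<in> sets borel" for C
  proof -
    have "f -` C \<in> sets lborel" using measurable_sets[of f borel borel C] by simp
    then have "emeasure lborel (f -` C) = (\<integral>\<^sup>+x. indicator (f -` C) x \<partial>lborel)" by simp
    also have "\<dots> = (\<integral>\<^sup>+x. indicator C (f x) \<partial>lborel)" by (intro nn_integral_cong) (auto simp: indicator_def)
    finally show ?thesis .
  qed
  have [measurable]: "(\<lambda>z. z - y) -` A \<in> sets borel" for y
    using measurable_sets[of "\<lambda>z. z - y" borel borel A] by simp
  have "emeasure lborel (f -` A) * emeasure lborel B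
      = (\<integral>\<^sup>+x. indicator A (f x) * (\<integral>\<^sup>+y. indicator B (y + f x) \<partial>lborel) \<partial>lborel)"
    by (subst nn_integral_lborel_shift) (auto simp: pre nn_integral_multc)
  also have "\<dots> = (\<integral>\<^sup>+x. (\<integral>\<^sup>+y. indicator A (f x) * indicator B (y + f x) \<partial>lborel) \<partial>lborel)"
    by (subst nn_integral_cmult) auto
  also have "\<dots> = (\<integral>\<^sup>+y. (\<integral>\<^sup>+x. indicator A (f x) * indicator B (y + f x) \<partial>lborel) \<partial>lborel)"
    by (rule lborel_pair.Fubini'[symmetric]) measurable
  also have "\<dots> = (\<integral>\<^sup>+y. (\<integral>\<^sup>+x. indicator A (f x - y) * indicator B (f x) \<partial>lborel) \<partial>lborel)"
  proof (rule nn_integral_cong)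
    fix y :: 'a
    obtain z where z: "y = f z" using sf by (metis surjD)
    have "(\<integral>\<^sup>+x. indicator A (f (x + z) - y) * indicator B (f (x + z)) \<partial>lborel)
        = (\<integral>\<^sup>+x. indicator A (f x - y) * indicator B (f x) \<partial>lborel)"
      by (rule nn_integral_lborel_shift) measurable
    then show "(\<integral>\<^sup>+x. indicator A (f x) * indicator B (y + f x) \<partial>lborel)
        = (\<integral>\<^sup>+x. indicator A (f x - y) * indicator B (f x) \<partial>lborel)"
      using f by (simp add: linear_add z add.commute)
  qed
  also have "\<dots> = (\<integral>\<^sup>+x. (\<integral>\<^sup>+y. indicator A (f x - y) * indicator B (f x) \<partial>lborel) \<partial>lborel)"
    by (rule lborel_pair.Fubini') measurable
  also have "\<dots> = (\<integral>\<^sup>+x. indicator B (f x) * emeasure lborel A \<partial>lborel)"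
  proof (rule nn_integral_cong)
    fix x :: 'a
    have "(\<integral>\<^sup>+y. indicator A (f x - y) \<partial>lborel) = (\<integral>\<^sup>+y. indicator A (- y) \<partial>lborel)"
      using nn_integral_lborel_shift[of "\<lambda>y. indicator A (f x - y)" "f x"] by simp
    also have "\<dots> = (\<integral>\<^sup>+y. indicator A y \<partial>distr lborel borel uminus)"
      by (subst nn_integral_distr) auto
    also have "\<dots> = emeasure lborel A"
      using lborel_affine[of "-1::real" "0::'a"] by (simp add: density_1 uminus_add_conv_diff)
    finally show "(\<integral>\<^sup>+y. indicator A (f x - y) * indicator B (f x) \<partial>lborel) = indicator B (f x) * emeasure lborel A"
      by (subst nn_integral_multc) (auto simp: mult.commute)
  qed
  also have "\<dots> = emeasure lborel (f -` B) * emeasure lborel A"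
    by (subst nn_integral_multc) (auto simp: pre)
  finally show ?thesis .
qed

definition volume_factor :: "('a::euclidean_space \<Rightarrow> 'a) \<Rightarrow> real" where
  "volume_factor f = measure lborel (f ` cball 0 1) / measure lborel (cball (0::'a) 1)"

lemma linear_bij_inv:
  fixes f :: "'a::euclidean_space \<Rightarrow> 'a"
  assumes f: "linear f" "bij f"
  shows "linear (inv f)" "bij (inv f)" "f (inv f x) = x" "inv f (f x) = x" "f ` A = inv f -` A"
proof -
  have inv: "f (inv f x) = x" "inv f (f x) = x" for x
    using f(2) by (simp_all add: bij_is_surj surj_f_inv_f bij_is_inj)
  show "f (inv f x) = x" "inv f (f x) = x" by (fact inv)+
  show "bij (inv f)" using f(2) by (rule bij_imp_bij_inv)
  show "linear (inv f)"
  proof (rule linearI)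
    fix x y :: 'a and c :: real
    have "inv f (x + y) = inv f (f (inv f x + inv f y))"
      using f(1) by (simp add: linear_add inv(1))
    then show "inv f (x + y) = inv f x + inv f y" by (simp add: inv(2))
    have "inv f (c *\<^sub>R x) = inv f (f (c *\<^sub>R inv f x))"
      using f(1) by (simp add: linear_scale inv(1))
    then show "inv f (c *\<^sub>R x) = c *\<^sub>R inv f x" by (simp add: inv(2))
  qed
  show "f ` A = inv f -` A" 
    by (simp add: bij_vimage_eq_inv_image[OF bij_imp_bij_inv[OF f(2)]] inv_inv_eq[OF f(2)])
qed

lemma borel_linear_image:
  fixes f :: "'a::euclidean_space \<Rightarrow> 'a"
  assumes f: "linear f" "bij f" and A: "A \<in> sets borel"
  shows "f ` A \<in> sets borel"
proof -
  have "inv f \<in> borel_measurable borel"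
    using linear_bij_inv(1)[OF f] by (intro borel_measurable_continuous_onI linear_continuous_on) (simp add: linear_conv_bounded_linear)
  then show ?thesis using A linear_bij_inv(5)[OF f, of A] measurable_sets[of "inv f" borel borel A] by simp
qed

lemma volume_factor_pos:
  fixes f :: "'a::euclidean_space \<Rightarrow> 'a"
  assumes f: "linear f" "bij f"
  shows "volume_factor f > 0"
proof -
  have "compact (f ` cball 0 1)"
    using f by (intro compact_continuous_image linear_continuous_on) (auto simp: linear_conv_bounded_linear)
  then have fin: "f ` cball 0 1 \<in> lmeasurable" by (rule lmeasurable_compact)
  have "interior (f ` cball 0 1) = f ` interior (cball 0 1)"
    using f by (intro interior_bijective_linear_image)
  then have "interior (f ` cball 0 1) \<noteq> {}" by auto
  then have "\<not> negligible (f ` cball 0 1)"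
    by (metis interior_subset negligible_subset open_interior open_not_negligible)
  then have "measure lebesgue (f ` cball 0 1) > 0"
    using fin by (simp add: negligible_iff_measure zero_less_measure_iff)
  moreover have "measure lborel (cball (0::'a) 1) > 0"
    using content_cball_pos[of 1 "0::'a"] by simp
  moreover have "f ` cball 0 1 \<in> sets borel" using f by (intro borel_linear_image) auto
  ultimately show ?thesis by (simp add: volume_factor_def)
qed

lemma emeasure_compact_real:
  fixes A :: "'a::euclidean_space set"
  assumes "compact A"
  shows "emeasure lborel A = ennreal (measure lborel A)"
  using emeasure_compact_finite[OF assms] by (intro emeasure_eq_ennreal_measure) (metis infinity_ennreal_def less_irrefl)

lemma emeasure_linear_image:
  fixes f :: "'a::euclidean_space \<Rightarrow> 'a"
  assumes f: "linear f" "bij f" and A: "A \<in> sets borel"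
  shows "emeasure lborel (f ` A) = ennreal (volume_factor f) * emeasure lborel A"
proof -
  let ?B = "cball (0::'a) 1"
  have B: "f ` ?B \<in> sets borel" using f by (intro borel_linear_image) auto
  have pos: "measure lborel ?B > 0" using content_cball_pos[of 1 "0::'a"] by simp
  have "compact (f ` ?B)"
    using f by (intro compact_continuous_image linear_continuous_on) (auto simp: linear_conv_bounded_linear)
  then have "emeasure lborel (f ` ?B) = ennreal (measure lborel (f ` ?B))"
    by (rule emeasure_compact_real)
  moreover have "emeasure lborel ?B = ennreal (measure lborel ?B)"
    by (intro emeasure_compact_real) simp
  moreover have "emeasure lborel (f ` A) * emeasure lborel ?B = emeasure lborel (f ` ?B) * emeasure lborel A"
    using lborel_linear_proportional[OF linear_bij_inv(1)[OF f] bij_is_surj[OF linear_bij_inv(2)[OF f]] A, of ?B]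
    by (simp add: linear_bij_inv(5)[OF f])
  ultimately have eq: "emeasure lborel (f ` A) * ennreal (measure lborel ?B) = ennreal (measure lborel (f ` ?B)) * emeasure lborel A"
    by simp
  have "ennreal (measure lborel (f ` ?B)) = ennreal (volume_factor f) * ennreal (measure lborel ?B)"
    using pos by (simp add: volume_factor_def ennreal_mult[symmetric])
  with eq have "emeasure lborel (f ` A) * ennreal (measure lborel ?B) = (ennreal (volume_factor f) * emeasure lborel A) * ennreal (measure lborel ?B)"
    by (simp add: mult_ac)
  with pos show ?thesis
    by (auto simp: mult.commute[of _ "ennreal (measure lborel ?B)"] ennreal_mult_cancel_left)
qed

lemma vol_linear_image:
  fixes f :: "real^'n \<Rightarrow> real^'n"
  assumes f: "linear f" "bij f" and A: "A \<in> sets borel"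
  shows "vol (f ` A) = volume_factor f * vol A"
  using emeasure_linear_image[OF assms] borel_linear_image[OF assms] A volume_factor_pos[OF f]
  by (simp add: measure_def enn2real_mult)

lemma vol_scaleR:
  fixes A :: "(real^'n) set"
  assumes "c > 0"
  shows "vol ((*\<^sub>R) c ` A) = c ^ CARD('n) * vol A"
  using measure_lebesgue_affine[of c 0 A] assms by simp

section \<open>Volumes of projections\<close>

definition sweep :: "'a::euclidean_space set \<Rightarrow> 'a \<Rightarrow> 'a set" where
  "sweep K x = {y. \<exists>t. y + t *\<^sub>R x \<in> K}"

text \<open>The volume of the projection of \<open>K\<close> onto the hyperplane orthogonal to \<open>x\<close>, times \<open>norm x\<close>; as a
  function of \<open>x\<close> it is the support function of the projection body of \<open>K\<close>. Measuring a slab of the cylinder avoids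
  volumes on hyperplanes.\<close>

definition projection_volume :: "(real^'n) set \<Rightarrow> real^'n \<Rightarrow> real" where
  "projection_volume K x = vol (sweep K x \<inter> {y. 0 \<le> y \<bullet> x \<and> y \<bullet> x < x \<bullet> x})"

definition translate_defect :: "(real^'n) set \<Rightarrow> real^'n \<Rightarrow> real" where
  "translate_defect K x = vol (K - (\<lambda>z. z + x) ` K)"

lemma emeasure_slab_fibration:
  fixes D :: "'a::euclidean_space set"
  assumes D[measurable]: "D \<in> sets borel" and vx: "v \<bullet> x > 0"
  shows "emeasure lborel D =
    (\<integral>\<^sup>+y. indicator {y. 0 \<le> y \<bullet> v \<and> y \<bullet> v < v \<bullet> x} y * emeasure lborel {t::real. y + t *\<^sub>R x \<in> D} \<partial>lborel)"
proof -
  let ?v = "v /\<^sub>R (v \<bullet> x)"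
  have m[measurable]: "{t::real. y + t *\<^sub>R x \<in> D} \<in> sets borel" for y
    using measurable_sets[of "\<lambda>t::real. y + t *\<^sub>R x" borel borel D] by (simp add: vimage_def)
  have "emeasure lborel D = (\<integral>\<^sup>+y. indicator D y \<partial>lborel)" by simp
  also have "\<dots> = (\<integral>\<^sup>+y. indicator {y. 0 \<le> y \<bullet> ?v \<and> y \<bullet> ?v < 1} y * (\<integral>\<^sup>+t. indicator D (y + t *\<^sub>R x) \<partial>lborel) \<partial>lborel)"
    by (rule nn_integral_slab_fibration) (use vx in auto)
  also have "{y. 0 \<le> y \<bullet> ?v \<and> y \<bullet> ?v < 1} = {y. 0 \<le> y \<bullet> v \<and> y \<bullet> v < v \<bullet> x}"
    using vx by (auto simp: field_simps zero_le_divide_iff)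
  also have "(\<integral>\<^sup>+y. indicator {y. 0 \<le> y \<bullet> v \<and> y \<bullet> v < v \<bullet> x} y * (\<integral>\<^sup>+t. indicator D (y + t *\<^sub>R x) \<partial>lborel) \<partial>lborel)
     = (\<integral>\<^sup>+y. indicator {y. 0 \<le> y \<bullet> v \<and> y \<bullet> v < v \<bullet> x} y * emeasure lborel {t::real. y + t *\<^sub>R x \<in> D} \<partial>lborel)"
  proof (rule nn_integral_cong)
    fix y
    have "(\<integral>\<^sup>+t. indicator D (y + t *\<^sub>R x) \<partial>(lborel::real measure)) = (\<integral>\<^sup>+t. indicator {t::real. y + t *\<^sub>R x \<in> D} t \<partial>lborel)"
      by (intro nn_integral_cong) (auto simp: indicator_def)
    then show "indicator {y. 0 \<le> y \<bullet> v \<and> y \<bullet> v < v \<bullet> x} y * (\<integral>\<^sup>+t. indicator D (y + t *\<^sub>R x) \<partial>lborel)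
      = indicator {y. 0 \<le> y \<bullet> v \<and> y \<bullet> v < v \<bullet> x} y * emeasure lborel {t::real. y + t *\<^sub>R x \<in> D}"
      by simp
  qed
  finally show ?thesis .
qed

text \<open>All slabs transversal to \<open>x\<close> cut a cylinder in direction \<open>x\<close> in pieces whose volumes are
  proportional to their thickness along \<open>x\<close>. This makes the projection volume homogeneous, covariant under
  linear maps, and computable from any convenient slab.\<close>

lemma emeasure_slab_exchange:
  fixes C :: "'a::euclidean_space set"
  assumes C[measurable]: "C \<in> sets borel" and inv: "\<And>y t. y + t *\<^sub>R x \<in> C \<longleftrightarrow> y \<in> C"
    and vx: "v \<bullet> x > 0" and wx: "w \<bullet> x \<noteq> 0" and c: "c \<ge> 0"
  shows "emeasure lborel (C \<inter> {y. a \<le> y \<bullet> w \<and> y \<bullet> w < a + c}) =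
     ennreal (c / \<bar>w \<bullet> x\<bar>) * emeasure lborel (C \<inter> {y. 0 \<le> y \<bullet> v \<and> y \<bullet> v < v \<bullet> x})"
proof -
  let ?S = "{y. 0 \<le> y \<bullet> v \<and> y \<bullet> v < v \<bullet> x}" and ?T = "{y. a \<le> y \<bullet> w \<and> y \<bullet> w < a + c}"
  have m: "?S \<in> sets borel" "?T \<in> sets borel" by measurable
  have len: "emeasure lborel {t::real. y + t *\<^sub>R x \<in> C \<inter> ?T} = ennreal (c / \<bar>w \<bullet> x\<bar>) * indicator C y" for y
  proof (cases "y \<in> C")
    case True
    have "{t::real. y + t *\<^sub>R x \<in> C \<inter> ?T} =
       (if w \<bullet> x > 0 then {(a - y \<bullet> w) / (w \<bullet> x) ..< (a + c - y \<bullet> w) / (w \<bullet> x)}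
        else {(a + c - y \<bullet> w) / (w \<bullet> x) <.. (a - y \<bullet> w) / (w \<bullet> x)})"
      using wx True by (auto simp: inv field_simps inner_add_left inner_add_right inner_commute split: if_splits)
    also have "emeasure lborel \<dots> = ennreal (c / \<bar>w \<bullet> x\<bar>)"
      using wx c by (auto simp: divide_right_mono divide_right_mono_neg diff_divide_distrib[symmetric])
    finally show ?thesis using True by simp
  qed (simp add: inv)
  have "emeasure lborel (C \<inter> ?T) = (\<integral>\<^sup>+y. indicator ?S y * (ennreal (c / \<bar>w \<bullet> x\<bar>) * indicator C y) \<partial>lborel)"
    using m by (subst emeasure_slab_fibration[OF _ vx]) (auto simp: len[simplified])
  also have "\<dots> = (\<integral>\<^sup>+y. ennreal (c / \<bar>w \<bullet> x\<bar>) * indicator (C \<inter> ?S) y \<partial>lborel)"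
    by (intro nn_integral_cong) (auto simp: indicator_def)
  also have "\<dots> = ennreal (c / \<bar>w \<bullet> x\<bar>) * emeasure lborel (C \<inter> ?S)"
    using m by (subst nn_integral_cmult_indicator) auto
  finally show ?thesis .
qed

lemma closed_sweep:
  assumes "compact K" shows "closed (sweep K x)"
proof -
  have "sweep K x = (\<Union>a\<in>span {x}. \<Union>b\<in>K. {a + b})"
  proof (intro set_eqI iffI)
    fix y assume "y \<in> sweep K x"
    then obtain t where "y + t *\<^sub>R x \<in> K" by (auto simp: sweep_def)
    moreover have "(- t) *\<^sub>R x \<in> span {x}" by (intro span_mul span_base) simp
    moreover have "y = (- t) *\<^sub>R x + (y + t *\<^sub>R x)" by simp
    ultimately show "y \<in> (\<Union>a\<in>span {x}. \<Union>b\<in>K. {a + b})" by blast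
  next
    fix y assume "y \<in> (\<Union>a\<in>span {x}. \<Union>b\<in>K. {a + b})"
    then obtain k b where "y = k *\<^sub>R x + b" "b \<in> K" by (auto simp: span_singleton)
    then have "y + (- k) *\<^sub>R x \<in> K" by simp
    then show "y \<in> sweep K x" unfolding sweep_def by blast
  qed
  with assms show ?thesis by (simp add: closed_compact_sums)
qed

lemma sweep_borel: "compact K \<Longrightarrow> sweep K x \<in> sets borel"
  by (intro borel_closed closed_sweep)

lemma sweep_shift: "y + t *\<^sub>R x \<in> sweep K x \<longleftrightarrow> y \<in> sweep K x"
proof
  assume "y + t *\<^sub>R x \<in> sweep K x"
  then obtain s where "y + t *\<^sub>R x + s *\<^sub>R x \<in> K" by (auto simp: sweep_def)
  then have "y + (t + s) *\<^sub>R x \<in> K" by (simp add: algebra_simps)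
  then show "y \<in> sweep K x" unfolding sweep_def by blast
next
  assume "y \<in> sweep K x"
  then obtain s where "y + s *\<^sub>R x \<in> K" by (auto simp: sweep_def)
  then have "y + t *\<^sub>R x + (s - t) *\<^sub>R x \<in> K" by (simp add: algebra_simps)
  then show "y + t *\<^sub>R x \<in> sweep K x" unfolding sweep_def by blast
qed

lemma sweep_mono: "K \<subseteq> L \<Longrightarrow> sweep K x \<subseteq> sweep L x"
  and sweep_superset: "K \<subseteq> sweep K x"
  by (auto simp: sweep_def) (metis add.right_neutral scaleR_zero_left)

lemma bounded_sweep_slab:
  assumes K: "compact K"
  shows "bounded (sweep K x \<inter> {y. 0 \<le> y \<bullet> x \<and> y \<bullet> x < x \<bullet> x})"
proof (cases "x = 0")
  case False
  obtain R where R: "\<And>k. k \<in> K \<Longrightarrow> norm k \<le> R" using compact_imp_bounded[OF K] by (auto simp: bounded_iff)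
  have "norm y \<le> 2 * R + norm x" if y: "y \<in> sweep K x" "0 \<le> y \<bullet> x" "y \<bullet> x < x \<bullet> x" for y
  proof -
    obtain t where t: "y + t *\<^sub>R x \<in> K" using y(1) by (auto simp: sweep_def)
    have nx: "norm x > 0" using False by simp
    have "t * (x \<bullet> x) = (y + t *\<^sub>R x) \<bullet> x - y \<bullet> x" by (simp add: inner_add_left)
    moreover have "\<bar>(y + t *\<^sub>R x) \<bullet> x\<bar> \<le> R * norm x"
      using Cauchy_Schwarz_ineq2[of "y + t *\<^sub>R x" x] R[OF t] mult_right_mono[of "norm (y + t *\<^sub>R x)" R "norm x"] by simp
    ultimately have "\<bar>t\<bar> * (norm x * norm x) \<le> R * norm x + norm x * norm x"
      using y(2,3) by (simp add: abs_mult dot_square_norm power2_eq_square)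
    then have "(\<bar>t\<bar> * norm x) * norm x \<le> (R + norm x) * norm x" by (simp add: algebra_simps)
    then have 1: "\<bar>t\<bar> * norm x \<le> R + norm x" using nx by simp
    have "norm y \<le> norm (y + t *\<^sub>R x) + norm (t *\<^sub>R x)" using norm_triangle_ineq4[of "y + t *\<^sub>R x" "t *\<^sub>R x"] by simp
    then show ?thesis using R[OF t] 1 by simp
  qed
  then show ?thesis by (auto simp: bounded_iff)
qed simp

lemma emeasure_bounded_borel:
  fixes A :: "(real^'n) set"
  assumes "A \<in> sets borel" "bounded A"
  shows "emeasure lborel A = ennreal (vol A)"
proof -
  have "emeasure lborel A < \<infinity>" using assms(2) by (rule emeasure_bounded_finite)
  then show ?thesis using assms(1) by (simp add: emeasure_eq_ennreal_measure less_top[symmetric])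
qed

lemma vol_eqI:
  fixes A :: "(real^'n) set"
  assumes "A \<in> sets borel" "emeasure lborel A = ennreal r" "r \<ge> 0"
  shows "vol A = r"
  using assms by (simp add: measure_def)

lemma projection_volume_nonneg: "projection_volume K x \<ge> 0" by (simp add: projection_volume_def)

lemma projection_volume_0 [simp]: "projection_volume K 0 = 0"
  by (simp add: projection_volume_def not_less[symmetric] cong: conj_cong)

lemma emeasure_projection_volume:
  assumes "compact K"
  shows "emeasure lborel (sweep K x \<inter> {y. 0 \<le> y \<bullet> x \<and> y \<bullet> x < x \<bullet> x}) = ennreal (projection_volume K x)"
proof -
  have "{y. 0 \<le> y \<bullet> x \<and> y \<bullet> x < x \<bullet> x} \<in> sets borel" by measurable
  then show ?thesis
    unfolding projection_volume_def using bounded_sweep_slab[OF assms] sweep_borel[OF assms]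
    by (intro emeasure_bounded_borel) auto
qed

lemma emeasure_sweep_slab:
  assumes "compact K" "w \<bullet> x \<noteq> 0" "c \<ge> 0"
  shows "emeasure lborel (sweep K x \<inter> {y. a \<le> y \<bullet> w \<and> y \<bullet> w < a + c}) = ennreal (c / \<bar>w \<bullet> x\<bar> * projection_volume K x)"
proof -
  have "x \<bullet> x > 0" using assms(2) by auto
  then show ?thesis
    by (subst emeasure_slab_exchange[OF sweep_borel[OF assms(1)] sweep_shift _ assms(2,3), of x])
       (use assms(3) in \<open>simp_all add: emeasure_projection_volume[OF assms(1)] ennreal_mult[symmetric] projection_volume_nonneg\<close>)
qed

lemma vol_sweep_slab:
  assumes "compact K" "w \<bullet> x \<noteq> 0" "c \<ge> 0"
  shows "vol (sweep K x \<inter> {y. a \<le> y \<bullet> w \<and> y \<bullet> w < a + c}) = c / \<bar>w \<bullet> x\<bar> * projection_volume K x"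
proof (rule vol_eqI)
  have "{y. a \<le> y \<bullet> w \<and> y \<bullet> w < a + c} \<in> sets borel" by measurable
  then show "sweep K x \<inter> {y. a \<le> y \<bullet> w \<and> y \<bullet> w < a + c} \<in> sets borel"
    using sweep_borel[OF assms(1)] by auto
  show "emeasure lborel (sweep K x \<inter> {y. a \<le> y \<bullet> w \<and> y \<bullet> w < a + c}) = ennreal (c / \<bar>w \<bullet> x\<bar> * projection_volume K x)"
    by (rule emeasure_sweep_slab[OF assms])
  show "0 \<le> c / \<bar>w \<bullet> x\<bar> * projection_volume K x" using assms(3) projection_volume_nonneg[of K x] by simp
qed

lemma sweep_scale: "s \<noteq> 0 \<Longrightarrow> sweep K (s *\<^sub>R x) = sweep K x"
proof -
  assume s: "s \<noteq> 0"
  have "(\<exists>t. y + t *\<^sub>R s *\<^sub>R x \<in> K) \<longleftrightarrow> (\<exists>t. y + t *\<^sub>R x \<in> K)" for y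
    using s by (metis divide_cancel_right eq_divide_eq scaleR_scaleR)
  then show ?thesis by (simp add: sweep_def)
qed

lemma projection_volume_scale:
  assumes K: "compact K"
  shows "projection_volume K (s *\<^sub>R x) = \<bar>s\<bar> * projection_volume K x"
proof (cases "s = 0 \<or> x = 0")
  case False
  then have sx: "(s *\<^sub>R x) \<bullet> x \<noteq> 0" by simp
  have "projection_volume K (s *\<^sub>R x) = vol (sweep K x \<inter> {y. 0 \<le> y \<bullet> (s *\<^sub>R x) \<and> y \<bullet> (s *\<^sub>R x) < 0 + (s *\<^sub>R x) \<bullet> (s *\<^sub>R x)})"
    using False by (simp add: projection_volume_def sweep_scale)
  also have "\<dots> = (s *\<^sub>R x) \<bullet> (s *\<^sub>R x) / \<bar>(s *\<^sub>R x) \<bullet> x\<bar> * projection_volume K x"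
    by (rule vol_sweep_slab[OF K sx]) (rule inner_ge_zero)
  also have "(s *\<^sub>R x) \<bullet> (s *\<^sub>R x) / \<bar>(s *\<^sub>R x) \<bullet> x\<bar> = \<bar>s\<bar>"
    using False by (simp add: abs_mult field_simps)
  finally show ?thesis .
qed auto

lemma projection_volume_linear_image:
  fixes f :: "real^'n \<Rightarrow> real^'n"
  assumes K: "compact K" and f: "linear f" "bij f"
  shows "projection_volume (f ` K) (f x) = volume_factor f * projection_volume K x"
proof (cases "x = 0")
  case False
  then have fx: "f x \<noteq> 0" using f by (metis bij_is_inj linear_injective_0)
  let ?w = "adjoint f (f x)"
  have ad: "y \<bullet> ?w = f y \<bullet> f x" for y using adjoint_works[OF f(1)] by simp
  have wx: "?w \<bullet> x = f x \<bullet> f x" by (metis ad inner_commute)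
  let ?A = "sweep K x \<inter> {y. 0 \<le> y \<bullet> ?w \<and> y \<bullet> ?w < 0 + f x \<bullet> f x}"
  have "sweep (f ` K) (f x) = f ` sweep K x"
  proof (intro set_eqI iffI)
    fix z assume "z \<in> sweep (f ` K) (f x)"
    then obtain t k where t: "z + t *\<^sub>R f x = f k" "k \<in> K" by (auto simp: sweep_def)
    then have "z = f (k - t *\<^sub>R x)" using f(1) by (simp add: linear_diff linear_scale algebra_simps)
    moreover have "k - t *\<^sub>R x + t *\<^sub>R x \<in> K" using t by simp
    ultimately show "z \<in> f ` sweep K x" unfolding sweep_def by blast
  next
    fix z assume "z \<in> f ` sweep K x"
    then obtain y t where "z = f y" "y + t *\<^sub>R x \<in> K" by (auto simp: sweep_def)
    moreover have "f y + t *\<^sub>R f x = f (y + t *\<^sub>R x)" using f(1) by (simp add: linear_add linear_scale)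
    ultimately show "z \<in> sweep (f ` K) (f x)" unfolding sweep_def by auto
  qed
  then have "sweep (f ` K) (f x) \<inter> {y. 0 \<le> y \<bullet> f x \<and> y \<bullet> f x < f x \<bullet> f x} = f ` ?A"
    using ad by (auto simp: image_iff)
  then have "projection_volume (f ` K) (f x) = vol (f ` ?A)" by (simp add: projection_volume_def)
  also have "\<dots> = volume_factor f * vol ?A"
  proof (rule vol_linear_image[OF f])
    have "{y. 0 \<le> y \<bullet> ?w \<and> y \<bullet> ?w < 0 + f x \<bullet> f x} \<in> sets borel" by measurable
    then show "?A \<in> sets borel" using sweep_borel[OF K, of x] by auto
  qed
  also have "vol ?A = projection_volume K x"
    using vol_sweep_slab[OF K, of ?w x "f x \<bullet> f x" 0] fx wx by simp
  finally show ?thesis .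
qed (use f in \<open>simp add: linear_0\<close>)

lemma projection_volume_translation:
  assumes K: "compact K"
  shows "projection_volume ((\<lambda>z. z + c) ` K) x = projection_volume K x"
proof (cases "x = 0")
  case False
  let ?A = "sweep K x \<inter> {y. - (c \<bullet> x) \<le> y \<bullet> x \<and> y \<bullet> x < - (c \<bullet> x) + x \<bullet> x}"
  have "sweep ((\<lambda>z. z + c) ` K) x \<inter> {y. 0 \<le> y \<bullet> x \<and> y \<bullet> x < x \<bullet> x} = (+) c ` ?A" (is "?L = _")
  proof (intro set_eqI iffI)
    fix z assume z: "z \<in> ?L"
    then obtain t k where t: "z + t *\<^sub>R x = k + c" "k \<in> K" by (auto simp: sweep_def)
    then have "z - c + t *\<^sub>R x \<in> K" by (simp add: algebra_simps)
    then have "z - c \<in> ?A" using z by (auto simp: sweep_def inner_diff_left)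
    moreover have "z = c + (z - c)" by simp
    ultimately show "z \<in> (+) c ` ?A" by (rule rev_image_eqI)
  next
    fix z assume "z \<in> (+) c ` ?A"
    then obtain y where y: "z = c + y" "y \<in> ?A" by auto
    then obtain t where "y + t *\<^sub>R x \<in> K" by (auto simp: sweep_def)
    then have "z + t *\<^sub>R x \<in> (\<lambda>z. z + c) ` K" using y(1) by (intro image_eqI[of _ _ "y + t *\<^sub>R x"]) auto
    then show "z \<in> ?L" using y by (auto simp: sweep_def inner_add_left)
  qed
  then have "projection_volume ((\<lambda>z. z + c) ` K) x = vol ?A" by (simp add: projection_volume_def measure_translation)
  also have "\<dots> = projection_volume K x" using vol_sweep_slab[OF K, of x x "x \<bullet> x" "- (c \<bullet> x)"] False by simp
  finally show ?thesis .
qed simp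

lemma linear_scaleR_bij: "c \<noteq> 0 \<Longrightarrow> linear ((*\<^sub>R) c) \<and> bij ((*\<^sub>R) c :: 'a::euclidean_space \<Rightarrow> 'a)"
  by (auto intro!: bijI' linearI simp: algebra_simps intro: exI[of _ "_ /\<^sub>R c"])

lemma volume_factor_scaleR:
  assumes "c > 0"
  shows "volume_factor ((*\<^sub>R) c :: real^'n \<Rightarrow> real^'n) = c ^ CARD('n)"
proof -
  have 1: "compact ((*\<^sub>R) c ` cball (0::real^'n) 1)" by (intro compact_scaling) simp
  have "vol (cball (0::real^'n) 1) > 0" using content_cball_pos[of 1 "0::real^'n"] by simp
  then show ?thesis
    using vol_scaleR[OF assms, of "cball (0::real^'n) 1"] compact_imp_closed[OF 1] by (simp add: volume_factor_def)
qed

lemma projection_volume_dilation: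
  fixes K :: "(real^'n) set"
  assumes K: "compact K" and s: "s > 0"
  shows "projection_volume ((*\<^sub>R) s ` K) x = s ^ (CARD('n) - 1) * projection_volume K x"
proof -
  have "s * projection_volume ((*\<^sub>R) s ` K) x = projection_volume ((*\<^sub>R) s ` K) (s *\<^sub>R x)"
    using s by (subst projection_volume_scale) (auto intro: compact_scaling K)
  also have "\<dots> = s ^ CARD('n) * projection_volume K x"
    using projection_volume_linear_image[OF K, of "(*\<^sub>R) s" x] linear_scaleR_bij[of s] s by (simp add: volume_factor_scaleR)
  also have "s ^ CARD('n) = s * s ^ (CARD('n) - 1)"
    by (metis One_nat_def Suc_pred power_Suc zero_less_card_finite)
  finally show ?thesis using s by simp
qed

lemma projection_volume_mono:
  assumes "compact K" "compact L" "K \<subseteq> L"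
  shows "projection_volume K x \<le> projection_volume L x"
proof -
  have "emeasure lborel (sweep K x \<inter> {y. 0 \<le> y \<bullet> x \<and> y \<bullet> x < x \<bullet> x}) \<le>
    emeasure lborel (sweep L x \<inter> {y. 0 \<le> y \<bullet> x \<and> y \<bullet> x < x \<bullet> x})"
  proof (rule emeasure_mono)
    have "{y. 0 \<le> y \<bullet> x \<and> y \<bullet> x < x \<bullet> x} \<in> sets borel" by measurable
    then show "sweep L x \<inter> {y. 0 \<le> y \<bullet> x \<and> y \<bullet> x < x \<bullet> x} \<in> sets lborel"
      using sweep_borel[OF assms(2), of x] by auto
  qed (use sweep_mono[OF assms(3)] in auto)
  then show ?thesis by (simp add: emeasure_projection_volume assms ennreal_le_iff projection_volume_nonneg)
qed

text \<open>A body of radius \<open>R\<close> fits in a slab of thickness comparable to \<open>R\<close> of its own cylinder.\<close>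

lemma projection_volume_lower_bound:
  assumes K: "compact K" "K \<subseteq> cball 0 R" and R: "R > 0"
  shows "vol K * norm x \<le> 3 * R * projection_volume K x"
proof (cases "x = 0")
  case False
  let ?A = "sweep K x \<inter> {y. - (R * norm x) \<le> y \<bullet> x \<and> y \<bullet> x < - (R * norm x) + 3 * R * norm x}"
  have sub: "K \<subseteq> ?A"
  proof
    fix k assume k: "k \<in> K"
    have "\<bar>k \<bullet> x\<bar> \<le> R * norm x"
      using Cauchy_Schwarz_ineq2[of k x] K(2) k mult_right_mono[of "norm k" R "norm x"] by auto
    moreover have "R * norm x > 0" using R False by simp
    ultimately show "k \<in> ?A" using sweep_superset[of K x] k by auto
  qed
  have "emeasure lborel K \<le> emeasure lborel ?A"
  proof (rule emeasure_mono[OF sub])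
    have "{y. - (R * norm x) \<le> y \<bullet> x \<and> y \<bullet> x < - (R * norm x) + 3 * R * norm x} \<in> sets borel" by measurable
    then show "?A \<in> sets lborel" using sweep_borel[OF K(1), of x] by auto
  qed
  also have "\<dots> = ennreal (3 * R * norm x / \<bar>x \<bullet> x\<bar> * projection_volume K x)"
    using R False by (intro emeasure_sweep_slab K) auto
  also have "emeasure lborel K = ennreal (vol K)"
    using K by (intro emeasure_bounded_borel) (auto simp: compact_imp_bounded compact_imp_closed)
  finally have "vol K \<le> 3 * R * norm x / (norm x * norm x) * projection_volume K x"
    using R projection_volume_nonneg[of K x] by (subst (asm) ennreal_le_iff) (auto simp: dot_square_norm power2_eq_square)
  then show ?thesis using False by (simp add: field_simps)
qed simp

section \<open>Small translations of a convex body\<close>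

lemma borel_diff_translate:
  fixes K :: "(real^'n) set"
  assumes "compact K"
  shows "K - (\<lambda>z. z + x) ` K \<in> sets borel" "bounded (K - (\<lambda>z. z + x) ` K)"
proof -
  have "compact ((\<lambda>z. z + x) ` K)" using compact_translation[OF assms, of x] by (simp add: add.commute)
  then show "K - (\<lambda>z. z + x) ` K \<in> sets borel" using assms by (intro sets.Diff borel_closed compact_imp_closed)
  show "bounded (K - (\<lambda>z. z + x) ` K)" using assms by (meson Diff_subset bounded_subset compact_imp_bounded)
qed

lemma in_translate: "y \<in> (\<lambda>z. z + x) ` K \<longleftrightarrow> y - (x::'a::ab_group_add) \<in> K"
  by (auto simp: image_iff intro: bexI[of _ "y - x"])

lemma line_comb: "(1 - u) *\<^sub>R (y + a *\<^sub>R x) + u *\<^sub>R (y + b *\<^sub>R x) = y + (a + u * (b - a)) *\<^sub>R (x::'a::real_vector)"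
  by (simp add: algebra_simps)

lemma translate_defect_nonneg: "translate_defect K x \<ge> 0" by (simp add: translate_defect_def)

lemma emeasure_translate_defect_fibration:
  fixes K :: "(real^'n) set"
  assumes "compact K" "x \<noteq> 0"
  shows "ennreal (translate_defect K x) = (\<integral>\<^sup>+y. indicator {y. 0 \<le> y \<bullet> x \<and> y \<bullet> x < x \<bullet> x} y *
     emeasure lborel {t::real. y + t *\<^sub>R x \<in> K \<and> y + (t - 1) *\<^sub>R x \<notin> K} \<partial>lborel)"
proof -
  have "ennreal (translate_defect K x) = emeasure lborel (K - (\<lambda>z. z + x) ` K)"
    unfolding translate_defect_def using borel_diff_translate[OF assms(1)] by (rule emeasure_bounded_borel[symmetric])
  also have "\<dots> = (\<integral>\<^sup>+y. indicator {y. 0 \<le> y \<bullet> x \<and> y \<bullet> x < x \<bullet> x} y *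
     emeasure lborel {t::real. y + t *\<^sub>R x \<in> K - (\<lambda>z. z + x) ` K} \<partial>lborel)"
    using assms(2) borel_diff_translate(1)[OF assms(1)] by (intro emeasure_slab_fibration) auto
  finally show ?thesis by (simp add: in_translate algebra_simps)
qed

lemma emeasure_le_one_of_gaps:
  fixes T :: "real set"
  assumes "\<And>s t. s \<in> T \<Longrightarrow> t \<in> T \<Longrightarrow> s < t \<Longrightarrow> t - s < 1"
  shows "emeasure lborel T \<le> 1"
proof (cases "T = {}")
  case False
  then obtain t0 where t0: "t0 \<in> T" by blast
  have bdd: "bdd_below T"
    by (rule bdd_belowI[of _ "t0 - 1"]) (use assms t0 in \<open>force\<close>)
  have "T \<subseteq> {Inf T..Inf T + 1}"
  proof
    fix t assume t: "t \<in> T"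
    have "t - 1 \<le> Inf T"
      by (rule cInf_greatest[OF False]) (use assms t in \<open>force\<close>)
    then show "t \<in> {Inf T..Inf T + 1}" using cInf_lower[OF t bdd] by simp
  qed
  then have "emeasure lborel T \<le> emeasure lborel {Inf T..Inf T + 1}" by (intro emeasure_mono) auto
  then show ?thesis by simp
qed simp

text \<open>On a line parallel to \<open>x\<close>, parametrized by multiples of \<open>x\<close>, the points of \<open>K\<close> outside \<open>K + x\<close> form an interval of length at most 1:
  two points at distance 1 or more would put the predecessor of the second one into \<open>K\<close> by convexity.\<close>

lemma translate_defect_le_projection_volume:
  fixes K :: "(real^'n) set"
  assumes K: "compact K" "convex K"
  shows "translate_defect K x \<le> projection_volume K x"
proof (cases "x = 0")
  case True
  then show ?thesis by (simp add: translate_defect_def)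
next
  case False
  let ?S = "{y. 0 \<le> y \<bullet> x \<and> y \<bullet> x < x \<bullet> x}"
  have m: "sweep K x \<inter> ?S \<in> sets borel"
  proof -
    have "?S \<in> sets borel" by measurable
    then show ?thesis using sweep_borel[OF K(1), of x] by auto
  qed
  have "ennreal (translate_defect K x) \<le> (\<integral>\<^sup>+y. indicator (sweep K x \<inter> ?S) y \<partial>lborel)"
    unfolding emeasure_translate_defect_fibration[OF K(1) False]
  proof (rule nn_integral_mono)
    fix y
    let ?T = "{t::real. y + t *\<^sub>R x \<in> K \<and> y + (t - 1) *\<^sub>R x \<notin> K}"
    have "emeasure lborel ?T \<le> 1"
    proof (rule emeasure_le_one_of_gaps, rule ccontr)
      fix s t assume s: "s \<in> ?T" and t: "t \<in> ?T" and st: "s < t" "\<not> t - s < 1"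
      let ?u = "1 / (t - s)"
      have "?u * (t - s) = 1" using st by simp
      then have "t + ?u * (s - t) = t - 1" by (metis minus_diff_eq mult_minus_right uminus_add_conv_diff add.commute)
      then have "?u *\<^sub>R (y + s *\<^sub>R x) + (1 - ?u) *\<^sub>R (y + t *\<^sub>R x) = y + (t - 1) *\<^sub>R x"
        using line_comb[of ?u y t x s] by (simp add: add.commute)
      moreover have "?u *\<^sub>R (y + s *\<^sub>R x) + (1 - ?u) *\<^sub>R (y + t *\<^sub>R x) \<in> K"
        using s t st by (intro convexD[OF K(2)]) auto
      ultimately show False using t by auto
    qed
    moreover have "emeasure lborel ?T = 0" if "y \<notin> sweep K x"
    proof -
      have "?T = {}" using that by (auto simp: sweep_def)
      then show ?thesis by (simp only: emeasure_empty)
    qed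
    ultimately show "indicator ?S y * emeasure lborel ?T \<le> indicator (sweep K x \<inter> ?S) y"
      by (cases "y \<in> sweep K x") (auto simp: indicator_def)
  qed
  also have "\<dots> = ennreal (projection_volume K x)" using m by (simp add: emeasure_projection_volume[OF K(1)])
  finally show ?thesis by (simp add: projection_volume_nonneg)
qed

lemma closed_line_section:
  fixes K :: "'a::euclidean_space set"
  assumes "closed K" shows "closed {t::real. y + t *\<^sub>R x \<in> K}"
proof -
  have "closed ((\<lambda>t::real. y + t *\<^sub>R x) -` K)" using assms
    by (intro continuous_closed_vimage) (auto intro!: continuous_intros)
  then show ?thesis by (simp add: vimage_def)
qed

lemma bounded_line_section:
  fixes K :: "'a::euclidean_space set"
  assumes "bounded K" "x \<noteq> 0" shows "bounded {t::real. y + t *\<^sub>R x \<in> K}"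
proof -
  obtain R where R: "\<And>k. k \<in> K \<Longrightarrow> norm k \<le> R" using assms(1) by (auto simp: bounded_iff)
  have "\<bar>t\<bar> \<le> (R + norm y) / norm x" if "y + t *\<^sub>R x \<in> K" for t
  proof -
    have "norm (t *\<^sub>R x) \<le> norm (y + t *\<^sub>R x) + norm y" by (metis add.commute add_diff_cancel_left' norm_triangle_ineq4)
    also have "\<dots> \<le> R + norm y" using R[OF that] by simp
    finally show ?thesis using assms(2) by (simp add: field_simps)
  qed
  then show ?thesis by (auto simp: bounded_iff)
qed

text \<open>Every line parallel to \<open>x\<close> that meets \<open>L\<close> has a chord in \<open>K\<close> of length at least that of \<open>x\<close>; the part of this chord
  of length \<open>norm x\<close> next to its first point \<open>?a\<close> lies outside \<open>K + x\<close>.\<close>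

lemma projection_volume_le_translate_defect:
  fixes K :: "(real^'n) set"
  assumes K: "compact K" "convex K" and L: "compact L"
    and LK: "\<And>y s. y \<in> L \<Longrightarrow> 0 \<le> s \<Longrightarrow> s \<le> 1 \<Longrightarrow> y + s *\<^sub>R x \<in> K"
  shows "projection_volume L x \<le> translate_defect K x"
proof (cases "x = 0")
  case True
  then show ?thesis by (simp add: translate_defect_def)
next
  case False
  let ?S = "{y. 0 \<le> y \<bullet> x \<and> y \<bullet> x < x \<bullet> x}"
  have m: "sweep L x \<inter> ?S \<in> sets borel"
  proof -
    have "?S \<in> sets borel" by measurable
    then show ?thesis using sweep_borel[OF L, of x] by auto
  qed
  have "(\<integral>\<^sup>+y. indicator (sweep L x \<inter> ?S) y \<partial>lborel) \<le> ennreal (translate_defect K x)"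
    unfolding emeasure_translate_defect_fibration[OF K(1) False]
  proof (rule nn_integral_mono)
    fix y
    let ?T = "{t::real. y + t *\<^sub>R x \<in> K \<and> y + (t - 1) *\<^sub>R x \<notin> K}" and ?C = "{t::real. y + t *\<^sub>R x \<in> K}"
    have "1 \<le> emeasure lborel ?T" if "y \<in> sweep L x"
    proof -
      obtain t where "y + t *\<^sub>R x \<in> L" using \<open>y \<in> sweep L x\<close> by (auto simp: sweep_def)
      from LK[OF this, of 0] LK[OF this, of 1] have t: "t \<in> ?C" "t + 1 \<in> ?C"
        by (simp_all add: algebra_simps)
      have cl: "closed ?C" using K by (intro closed_line_section compact_imp_closed)
      have bdd: "bdd_below ?C"
        using K False by (intro bounded_imp_bdd_below bounded_line_section compact_imp_bounded)
      let ?a = "Inf ?C"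
      have a: "?a \<in> ?C" using t by (intro closed_contains_Inf bdd cl) auto
      have at: "?a \<le> t" using t by (intro cInf_lower bdd)
      have "{?a..<?a + 1} \<subseteq> ?T"
      proof
        fix s assume s: "s \<in> {?a..<?a + 1}"
        have "\<not> s - 1 \<in> ?C" using cInf_lower[OF _ bdd, of "s - 1"] s by auto
        let ?u = "(s - ?a) / (t + 1 - ?a)"
        have u: "0 \<le> ?u" "?u \<le> 1" using s at by (auto simp: field_simps)
        have eq: "?u * (t + 1 - ?a) = s - ?a" using at by simp
        have "(1 - ?u) *\<^sub>R (y + ?a *\<^sub>R x) + ?u *\<^sub>R (y + (t + 1) *\<^sub>R x) = y + (?a + ?u * (t + 1 - ?a)) *\<^sub>R x"
          by (rule line_comb)
        also have "\<dots> = y + s *\<^sub>R x" by (simp only: eq) simp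
        finally have "s \<in> ?C"
          using convexD[OF K(2), of "y + ?a *\<^sub>R x" "y + (t + 1) *\<^sub>R x" "1 - ?u" ?u] a t(2) u by auto
        with \<open>\<not> s - 1 \<in> ?C\<close> show "s \<in> ?T" by simp
      qed
      moreover have "?T \<in> sets borel"
      proof -
        have "?C \<in> sets borel" using cl by simp
        moreover have "{t::real. y + (t - 1) *\<^sub>R x \<in> K} \<in> sets borel"
          using closed_line_section[of K "y - x" x] K(1) by (simp add: compact_imp_closed algebra_simps)
        ultimately have "?C - {t::real. y + (t - 1) *\<^sub>R x \<in> K} \<in> sets borel" by (rule sets.Diff)
        moreover have "?C - {t::real. y + (t - 1) *\<^sub>R x \<in> K} = ?T" by auto
        ultimately show ?thesis by simp
      qed
      ultimately have "emeasure lborel {?a..<?a + 1} \<le> emeasure lborel ?T" by (intro emeasure_mono) auto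
      then show ?thesis by simp
    qed
    then show "indicator (sweep L x \<inter> ?S) y \<le> indicator ?S y * emeasure lborel ?T"
      by (auto simp: indicator_def)
  qed
  moreover have "(\<integral>\<^sup>+y. indicator (sweep L x \<inter> ?S) y \<partial>lborel) = ennreal (projection_volume L x)" using m by (simp add: emeasure_projection_volume[OF L])
  ultimately show ?thesis by (simp add: translate_defect_nonneg)
qed

text \<open>Contracting \<open>K\<close> by the factor \<open>1 - 1 / N\<close> towards a chord \<open>N *\<^sub>R x\<close> leaves room for a translation by
  \<open>x\<close> inside \<open>K\<close>, and the contraction costs the factor \<open>(1 - 1 / N) ^ (n - 1)\<close> in the projection volume.\<close>

lemma translate_defect_ge_projection_volume:
  fixes K :: "(real^'n) set"
  assumes K: "compact K" "convex K" and c: "c \<in> K" "c + N *\<^sub>R x \<in> K" and N: "N > 1"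
  shows "(1 - 1 / N) ^ (CARD('n) - 1) * projection_volume K x \<le> translate_defect K x"
proof -
  have s: "1 - 1 / N > 0" using N by simp
  let ?L = "(\<lambda>z. z + (1 / N) *\<^sub>R c) ` (*\<^sub>R) (1 - 1 / N) ` K"
  have cs: "compact ((*\<^sub>R) (1 - 1 / N) ` K)" by (intro compact_scaling K)
  have cL: "compact ?L" using compact_translation[OF cs, of "(1 / N) *\<^sub>R c"] by (simp add: add.commute)
  have "projection_volume ?L x \<le> translate_defect K x"
  proof (rule projection_volume_le_translate_defect[OF K cL])
    fix y t assume "y \<in> ?L" and t: "0 \<le> t" "t \<le> (1::real)"
    then obtain k where k: "k \<in> K" "y = (1 - 1 / N) *\<^sub>R k + (1 / N) *\<^sub>R c" by auto
    have "(1 - t) *\<^sub>R c + t *\<^sub>R (c + N *\<^sub>R x) \<in> K" using c t by (intro convexD[OF K(2)]) auto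
    then have "c + (t * N) *\<^sub>R x \<in> K" by (simp add: algebra_simps)
    then have "(1 - 1 / N) *\<^sub>R k + (1 / N) *\<^sub>R (c + (t * N) *\<^sub>R x) \<in> K"
      using k s N by (intro convexD[OF K(2)]) auto
    moreover have "(1 / N) *\<^sub>R (c + (t * N) *\<^sub>R x) = (1 / N) *\<^sub>R c + t *\<^sub>R x" using N by (simp add: algebra_simps)
    ultimately show "y + t *\<^sub>R x \<in> K" by (simp add: k(2) add.assoc)
  qed
  then show ?thesis by (simp add: projection_volume_translation[OF cs] projection_volume_dilation[OF K(1) s])
qed

text \<open>Up to a factor 2, the defect is the measure of a symmetric difference of translates, hence a translation invariant distance.\<close>

lemma translate_defect_triangle:
  fixes K :: "(real^'n) set"
  assumes K: "compact K"
  shows "translate_defect K (x + y) \<le> translate_defect K x + translate_defect K y"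
proof -
  let ?D = "\<lambda>x. K - (\<lambda>z. z + x) ` K"
  have m: "?D z \<in> lmeasurable" for z
    using borel_diff_translate[OF K, of z] by (intro bounded_set_imp_lmeasurable) simp_all
  have m2: "(+) x ` ?D y \<in> lmeasurable" by (intro measurable_translation m)
  have "?D (x + y) \<subseteq> ?D x \<union> (+) x ` ?D y"
  proof
    fix z assume z: "z \<in> ?D (x + y)"
    show "z \<in> ?D x \<union> (+) x ` ?D y"
    proof (cases "z - x \<in> K")
      case True
      then have "z - x \<in> ?D y" using z by (auto simp: in_translate algebra_simps)
      moreover have "z = x + (z - x)" by simp
      ultimately show ?thesis by blast
    qed (use z in \<open>auto simp: in_translate\<close>)
  qed
  then have "vol (?D (x + y)) \<le> vol (?D x \<union> (+) x ` ?D y)"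
    using m m2 by (intro measure_mono_fmeasurable) auto
  also have "\<dots> \<le> vol (?D x) + vol ((+) x ` ?D y)"
    using m m2 by (intro measure_Un_le) auto
  finally show ?thesis by (simp add: translate_defect_def measure_translation)
qed

lemma translate_defect_multiple:
  fixes K :: "(real^'n) set"
  assumes K: "compact K"
  shows "translate_defect K (real N *\<^sub>R x) \<le> real N * translate_defect K x"
proof (induction N)
  case 0
  then show ?case by (simp add: translate_defect_def)
next
  case (Suc N)
  have "translate_defect K (real (Suc N) *\<^sub>R x) = translate_defect K (real N *\<^sub>R x + x)" by (simp add: algebra_simps)
  also have "\<dots> \<le> translate_defect K (real N *\<^sub>R x) + translate_defect K x" by (rule translate_defect_triangle[OF K])
  finally show ?case using Suc by (simp add: algebra_simps)
qed

lemma convex_bodyD: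
  assumes "convex_body K" shows "compact K" "convex K" "interior K \<noteq> {}" "closed K" "bounded K" "K \<noteq> {}" "K \<in> sets borel" "K \<in> lmeasurable"
  using assms interior_subset[of K] unfolding convex_body_def
  by (auto simp: compact_imp_closed compact_imp_bounded lmeasurable_compact)

lemma vol_convex_body_pos: "convex_body K \<Longrightarrow> vol K > 0"
proof -
  assume K: "convex_body K"
  have "\<not> negligible K" using convex_bodyD(2,3)[OF K] by (simp add: negligible_convex_interior)
  then show ?thesis using convex_bodyD(8)[OF K] by (simp add: negligible_iff_measure zero_less_measure_iff)
qed

lemma bounded_subset_cball_pos:
  fixes K :: "'a::euclidean_space set"
  assumes "bounded K" shows "\<exists>R>0. K \<subseteq> cball 0 R"
  using assms by (auto simp: bounded_pos subset_iff)

lemma convex_body_chord: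
  fixes K :: "(real^'n) set"
  assumes K: "convex_body K"
  obtains c s where "s > 0" "c \<in> K" "c + s *\<^sub>R x \<in> K"
proof -
  obtain c where "c \<in> interior K" using convex_bodyD(3)[OF K] by blast
  then obtain r where r: "r > 0" "cball c r \<subseteq> K" by (auto simp: mem_interior_cball)
  have "norm ((r / (norm x + 1)) *\<^sub>R x) \<le> r"
    using r(1) mult_left_mono[of "norm x" "norm x + 1" r]
    by (simp add: divide_le_eq add_nonneg_pos)
  then have "c + (r / (norm x + 1)) *\<^sub>R x \<in> cball c r" by (simp add: dist_norm)
  moreover have "c \<in> cball c r" using r by simp
  moreover have "r / (norm x + 1) > 0" using r(1) by (simp add: add_nonneg_pos)
  ultimately show ?thesis using that r(2) by blast
qed

text \<open>The projection volume inherits the triangle inequality from the defect, because it is the limit of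
  \<open>N * translate_defect K (x / N)\<close>.\<close>

lemma projection_volume_triangle:
  fixes K :: "(real^'n) set"
  assumes K: "convex_body K"
  shows "projection_volume K (x + y) \<le> projection_volume K x + projection_volume K y"
proof -
  note Kc = convex_bodyD(1,2)[OF K]
  obtain c s where s: "s > 0" and c: "c \<in> K" "c + s *\<^sub>R (x + y) \<in> K" using convex_body_chord[OF K] .
  let ?f = "\<lambda>N. (1 - (1 / real N) * (1 / s)) ^ (CARD('n) - 1) * projection_volume K (x + y)"
  have "?f \<longlonglongrightarrow> (1 - 0 * (1 / s)) ^ (CARD('n) - 1) * projection_volume K (x + y)"
    by (intro tendsto_intros lim_1_over_n)
  then have lim: "?f \<longlonglongrightarrow> projection_volume K (x + y)" by simp
  have "?f N \<le> projection_volume K x + projection_volume K y" if N: "N \<ge> Suc (nat \<lceil>1 / s\<rceil>)" for N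
  proof -
    have N0: "real N > 0" using N by simp
    have "1 / s < real N" using N by linarith
    then have Ns: "real N * s > 1" using s by (simp add: field_simps)
    have sc: "projection_volume K (z /\<^sub>R real N) = projection_volume K z / real N" for z
      using projection_volume_scale[OF Kc(1), of "inverse (real N)" z] N0 by (simp add: field_simps)
    have "(1 - 1 / (real N * s)) ^ (CARD('n) - 1) * projection_volume K ((x + y) /\<^sub>R real N) \<le> translate_defect K ((x + y) /\<^sub>R real N)"
    proof (rule translate_defect_ge_projection_volume[OF Kc c(1) _ Ns])
      have "(real N * s) *\<^sub>R ((x + y) /\<^sub>R real N) = s *\<^sub>R (x + y)" using N0 by simp
      then show "c + (real N * s) *\<^sub>R ((x + y) /\<^sub>R real N) \<in> K" using c(2) by (simp only:)
    qed
    also have "\<dots> \<le> translate_defect K (x /\<^sub>R real N) + translate_defect K (y /\<^sub>R real N)"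
      using translate_defect_triangle[OF Kc(1), of "x /\<^sub>R real N" "y /\<^sub>R real N"] by (simp add: scaleR_add_right)
    also have "\<dots> \<le> projection_volume K (x /\<^sub>R real N) + projection_volume K (y /\<^sub>R real N)"
      by (intro add_mono translate_defect_le_projection_volume Kc)
    finally have "(1 - 1 / (real N * s)) ^ (CARD('n) - 1) * projection_volume K (x + y) / real N \<le> (projection_volume K x + projection_volume K y) / real N"
      by (simp only: sc add_divide_distrib times_divide_eq_right)
    then show ?thesis using N0 by (simp add: divide_le_cancel)
  qed
  then show ?thesis by (intro LIMSEQ_le_const2[OF lim]) blast
qed

lemma projection_volume_uminus: "compact K \<Longrightarrow> projection_volume K (- x) = projection_volume K x"
  using projection_volume_scale[of K "-1" x] by simp

lemma convex_on_projection_volume: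
  fixes K :: "(real^'n) set"
  assumes K: "convex_body K"
  shows "convex_on UNIV (projection_volume K)"
proof (rule convex_onI)
  fix t :: real and x y :: "real^'n" assume t: "0 < t" "t < 1"
  have "projection_volume K ((1 - t) *\<^sub>R x + t *\<^sub>R y) \<le> projection_volume K ((1 - t) *\<^sub>R x) + projection_volume K (t *\<^sub>R y)" by (rule projection_volume_triangle[OF K])
  then show "projection_volume K ((1 - t) *\<^sub>R x + t *\<^sub>R y) \<le> (1 - t) * projection_volume K x + t * projection_volume K y"
    using t by (simp add: projection_volume_scale convex_bodyD[OF K])
qed simp

lemma continuous_projection_volume: "convex_body K \<Longrightarrow> continuous_on UNIV (projection_volume K)"
  by (intro convex_on_continuous convex_on_projection_volume) auto

lemma projection_volume_pos:
  assumes K: "convex_body K" and "x \<noteq> 0" shows "projection_volume K x > 0"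
proof -
  obtain R where R: "R > 0" "K \<subseteq> cball 0 R"
    using bounded_subset_cball_pos[OF convex_bodyD(5)[OF K]] by blast
  have "vol K * norm x \<le> 3 * R * projection_volume K x" by (rule projection_volume_lower_bound[OF convex_bodyD(1)[OF K] R(2,1)])
  moreover have "vol K * norm x > 0" using vol_convex_body_pos[OF K] assms(2) by simp
  ultimately show ?thesis using R(1) by (smt (verit) mult_nonneg_nonpos)
qed

section \<open>The polar projection body\<close>

definition polar_projection_body :: "(real^'n) set \<Rightarrow> (real^'n) set" where
  "polar_projection_body K = {x. projection_volume K x \<le> 1}"

lemma convex_body_polar_projection_body:
  fixes K :: "(real^'n) set"
  assumes K: "convex_body K"
  shows "convex_body (polar_projection_body K)"
  unfolding convex_body_def
proof (intro conjI)
  obtain R where R: "R > 0" "K \<subseteq> cball 0 R"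
    using bounded_subset_cball_pos[OF convex_bodyD(5)[OF K]] by blast
  have "norm x \<le> 3 * R / vol K" if "x \<in> polar_projection_body K" for x
  proof -
    have "vol K * norm x \<le> 3 * R * projection_volume K x" by (rule projection_volume_lower_bound[OF convex_bodyD(1)[OF K] R(2,1)])
    also have "\<dots> \<le> 3 * R * 1" using that R by (intro mult_left_mono) (auto simp: polar_projection_body_def)
    finally show ?thesis using vol_convex_body_pos[OF K] by (simp add: field_simps)
  qed
  then have "bounded (polar_projection_body K)" by (auto simp: bounded_iff)
  moreover have "closed (polar_projection_body K)"
    using closed_Collect_le[of "projection_volume K" "\<lambda>_. 1"] continuous_projection_volume[OF K] by (simp add: polar_projection_body_def)
  ultimately show "compact (polar_projection_body K)" by (simp add: compact_eq_bounded_closed)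
  show "convex (polar_projection_body K)"
  proof (rule convexI)
    fix x y and u v :: real assume xy: "x \<in> polar_projection_body K" "y \<in> polar_projection_body K" and uv: "0 \<le> u" "0 \<le> v" "u + v = 1"
    have "projection_volume K (u *\<^sub>R x + v *\<^sub>R y) \<le> u * projection_volume K x + v * projection_volume K y"
      using projection_volume_triangle[OF K, of "u *\<^sub>R x" "v *\<^sub>R y"] uv by (simp add: projection_volume_scale convex_bodyD[OF K])
    also have "\<dots> \<le> u * 1 + v * 1" using xy uv by (intro add_mono mult_left_mono) (auto simp: polar_projection_body_def)
    finally show "u *\<^sub>R x + v *\<^sub>R y \<in> polar_projection_body K" using uv by (simp add: polar_projection_body_def)
  qed
  have "open {x. projection_volume K x < 1}"
    using open_Collect_less[of "projection_volume K" "\<lambda>_. 1"] continuous_projection_volume[OF K] by simp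
  moreover have "{x. projection_volume K x < 1} \<subseteq> polar_projection_body K" by (auto simp: polar_projection_body_def)
  ultimately have "0 \<in> interior (polar_projection_body K)" by (intro interiorI[of "{x. projection_volume K x < 1}"]) auto
  then show "interior (polar_projection_body K) \<noteq> {}" by auto
qed

text \<open>The functional of Petty's projection inequality; the exponent makes it invariant under affine maps.\<close>

definition petty :: "(real^'n) set \<Rightarrow> real" where
  "petty K = vol K ^ (CARD('n) - 1) * vol (polar_projection_body K)"

lemma convex_body_affine_image:
  fixes f :: "real^'n \<Rightarrow> real^'n"
  assumes K: "convex_body K" and f: "linear f" "bij f"
  shows "convex_body ((\<lambda>z. f z + c) ` K)"
proof -
  have eq: "(\<lambda>z. f z + c) ` K = (+) c ` f ` K" by (auto simp: add.commute)
  have "compact (f ` K)"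
    using f convex_bodyD(1)[OF K] by (intro compact_continuous_image linear_continuous_on) (auto simp: linear_conv_bounded_linear)
  then have "compact ((+) c ` f ` K)" by (rule compact_translation)
  moreover have "convex ((+) c ` f ` K)"
    by (intro convex_translation convex_linear_image f convex_bodyD(2)[OF K])
  moreover have "interior ((+) c ` f ` K) = (+) c ` f ` interior K"
    by (simp add: interior_translation interior_bijective_linear_image[OF f])
  ultimately show ?thesis using convex_bodyD(3)[OF K] by (simp add: convex_body_def eq)
qed

lemma petty_affine_image:
  fixes f :: "real^'n \<Rightarrow> real^'n"
  assumes K: "convex_body K" and f: "linear f" "bij f"
  shows "petty ((\<lambda>z. f z + c) ` K) = petty K"
proof -
  let ?K = "(\<lambda>z. f z + c) ` K"
  have eq: "?K = (+) c ` f ` K" "?K = (\<lambda>z. z + c) ` f ` K" by (auto simp: add.commute)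
  have cf: "compact (f ` K)"
    using f convex_bodyD(1)[OF K] by (intro compact_continuous_image linear_continuous_on) (auto simp: linear_conv_bounded_linear)
  note sp = volume_factor_pos[OF f]
  have projection_volume: "projection_volume ?K (f x) = volume_factor f * projection_volume K x" for x
    by (simp only: eq(2) projection_volume_translation[OF cf] projection_volume_linear_image[OF convex_bodyD(1)[OF K] f])
  have "polar_projection_body ?K = f ` (*\<^sub>R) (1 / volume_factor f) ` polar_projection_body K"
  proof (intro set_eqI iffI)
    fix y assume y: "y \<in> polar_projection_body ?K"
    let ?z = "volume_factor f *\<^sub>R inv f y"
    have "projection_volume K ?z = projection_volume ?K y"
      using projection_volume[of "inv f y"] sp by (simp add: projection_volume_scale[OF convex_bodyD(1)[OF K]] linear_bij_inv[OF f])
    then have "?z \<in> polar_projection_body K" using y by (simp add: polar_projection_body_def)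
    moreover have "y = f ((1 / volume_factor f) *\<^sub>R ?z)" using sp by (simp add: linear_bij_inv[OF f])
    ultimately show "y \<in> f ` (*\<^sub>R) (1 / volume_factor f) ` polar_projection_body K" by blast
  next
    fix y assume "y \<in> f ` (*\<^sub>R) (1 / volume_factor f) ` polar_projection_body K"
    then obtain z where z: "y = f ((1 / volume_factor f) *\<^sub>R z)" "projection_volume K z \<le> 1" by (auto simp: polar_projection_body_def)
    then show "y \<in> polar_projection_body ?K"
      using sp by (simp add: polar_projection_body_def projection_volume projection_volume_scale[OF convex_bodyD(1)[OF K]])
  qed
  moreover have "(*\<^sub>R) (1 / volume_factor f) ` polar_projection_body K \<in> sets borel"
    using convex_bodyD(1)[OF convex_body_polar_projection_body[OF K]] by (intro borel_closed compact_imp_closed compact_scaling)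
  ultimately have "vol (polar_projection_body ?K) = volume_factor f * ((1 / volume_factor f) ^ CARD('n) * vol (polar_projection_body K))"
    using vol_linear_image[OF f, of "(*\<^sub>R) (1 / volume_factor f) ` polar_projection_body K"] vol_scaleR[of "1 / volume_factor f" "polar_projection_body K"] sp by simp
  moreover have "vol ?K = volume_factor f * vol K"
    by (simp only: eq(1) measure_translation vol_linear_image[OF f convex_bodyD(7)[OF K]])
  moreover have "(volume_factor f * vol K) ^ (CARD('n) - 1) * (volume_factor f * ((1 / volume_factor f) ^ CARD('n) * v)) =
     vol K ^ (CARD('n) - 1) * v" for v
  proof -
    have "volume_factor f ^ CARD('n) = volume_factor f * volume_factor f ^ (CARD('n) - 1)"
      by (metis One_nat_def Suc_pred power_Suc zero_less_card_finite)
    then show ?thesis using sp by (simp add: power_mult_distrib power_one_over field_simps)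
  qed
  ultimately show ?thesis by (simp add: petty_def)
qed

lemma petty_pos: "convex_body K \<Longrightarrow> petty K > 0"
  using vol_convex_body_pos[of K] vol_convex_body_pos[OF convex_body_polar_projection_body[of K]] by (simp add: petty_def)

text \<open>Continuity of the functional, in the form in which it is used with compactness; it comes from
  monotonicity and homogeneity of the projection volume.\<close>

lemma petty_sandwich:
  fixes M L :: "(real^'n) set"
  assumes M: "convex_body M" and L: "convex_body L" and s: "s > 0"
    and MsL: "M \<subseteq> (*\<^sub>R) s ` L" and LM: "L \<subseteq> (*\<^sub>R) s ` M"
  shows "petty M \<le> s ^ (2 * CARD('n) * (CARD('n) - 1)) * petty L"
proof -
  let ?n = "CARD('n)"
  have cs: "compact ((*\<^sub>R) c ` A)" if "convex_body A" for A :: "(real^'n) set" and c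
    using convex_bodyD(1)[OF that] by (rule compact_scaling)
  have "vol M \<le> vol ((*\<^sub>R) s ` L)"
    using cs[OF L] MsL convex_bodyD(8)[OF M] by (intro measure_mono_fmeasurable) (auto simp: lmeasurable_compact)
  then have 1: "vol M \<le> s ^ ?n * vol L" by (simp add: vol_scaleR[OF s])
  let ?q = "s ^ (?n - 1)"
  have q: "?q > 0" using s by simp
  have "polar_projection_body M \<subseteq> (*\<^sub>R) ?q ` polar_projection_body L"
  proof
    fix x assume x: "x \<in> polar_projection_body M"
    have "projection_volume L x \<le> projection_volume ((*\<^sub>R) s ` M) x" by (intro projection_volume_mono cs LM M convex_bodyD(1)[OF L])
    also have "\<dots> = ?q * projection_volume M x" by (rule projection_volume_dilation[OF convex_bodyD(1)[OF M] s])
    also have "\<dots> \<le> ?q * 1" using x q by (intro mult_left_mono) (auto simp: polar_projection_body_def)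
    finally have "projection_volume L (inverse ?q *\<^sub>R x) \<le> 1"
      using q by (subst projection_volume_scale[OF convex_bodyD(1)[OF L]]) (simp add: field_simps)
    then have "inverse ?q *\<^sub>R x \<in> polar_projection_body L" by (simp add: polar_projection_body_def)
    moreover have "x = ?q *\<^sub>R inverse ?q *\<^sub>R x" using s by simp
    ultimately show "x \<in> (*\<^sub>R) ?q ` polar_projection_body L" by blast
  qed
  then have "vol (polar_projection_body M) \<le> vol ((*\<^sub>R) ?q ` polar_projection_body L)"
    using cs[OF convex_body_polar_projection_body[OF L]] convex_bodyD(8)[OF convex_body_polar_projection_body[OF M]]
    by (intro measure_mono_fmeasurable) (auto simp: lmeasurable_compact)
  then have 2: "vol (polar_projection_body M) \<le> ?q ^ ?n * vol (polar_projection_body L)" by (simp only: vol_scaleR[OF q])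
  have "petty M \<le> (s ^ ?n * vol L) ^ (?n - 1) * (?q ^ ?n * vol (polar_projection_body L))"
    unfolding petty_def by (intro mult_mono power_mono 1 2) (use s in auto)
  also have "\<dots> = (s ^ ?n) ^ (?n - 1) * ?q ^ ?n * petty L"
    by (simp add: petty_def power_mult_distrib)
  also have "(s ^ ?n) ^ (?n - 1) * ?q ^ ?n = s ^ (2 * ?n * (?n - 1))"
    by (simp add: power_mult[symmetric] power_add[symmetric] mult_ac mult_2[symmetric])
  finally show ?thesis .
qed

section \<open>Convolution bodies and polar projection bodies\<close>

lemma C_body_translate_defect:
  fixes K :: "(real^'n) set"
  assumes K: "compact K"
  shows "C_body d K = {x. translate_defect K x \<le> (1 - d) * vol K}"
proof -
  have "translate_defect K x = vol K - vol (K \<inter> (\<lambda>z. z + x) ` K)" for x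
  proof -
    have "compact ((\<lambda>z. z + x) ` K)" using compact_translation[OF K, of x] by (simp add: add.commute)
    then have m: "K \<inter> (\<lambda>z. z + x) ` K \<in> lmeasurable" "K \<in> lmeasurable" using K by (auto intro: lmeasurable_compact)
    have "vol (K - (K \<inter> (\<lambda>z. z + x) ` K)) = vol K - vol (K \<inter> (\<lambda>z. z + x) ` K)"
      using m by (intro measurable_measure_Diff) auto
    then show ?thesis by (simp add: translate_defect_def Diff_Int)
  qed
  then have "d * vol K \<le> vol (K \<inter> (\<lambda>z. z + x) ` K) \<longleftrightarrow> translate_defect K x \<le> (1 - d) * vol K" for x
    by (simp add: left_diff_distrib)
  then show ?thesis by (simp add: C_body_def)
qed

text \<open>If \<open>K\<close> did not meet \<open>K + N *\<^sub>R x\<close>, then \<open>vol K\<close> would be at most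
  \<open>N\<close> times the defect of \<open>x\<close>, hence less than \<open>vol K\<close>. So there is a chord \<open>N *\<^sub>R x\<close>, which
  makes defect and projection volume comparable.\<close>

lemma C_body_subset_polar_projection_body:
  fixes K :: "(real^'n) set"
  assumes K: "convex_body K" and d: "d < 1" and N: "N \<ge> 2" "real N * (1 - d) < 1"
  shows "C_body d K \<subseteq> (*\<^sub>R) ((1 - d) * vol K / (1 - 1 / real N) ^ (CARD('n) - 1)) ` polar_projection_body K"
proof
  note Kc = convex_bodyD(1,2)[OF K]
  let ?r = "(1 - d) * vol K / (1 - 1 / real N) ^ (CARD('n) - 1)"
  have q: "(1 - 1 / real N) ^ (CARD('n) - 1) > 0" using N by simp
  have r: "?r > 0" using q d vol_convex_body_pos[OF K] by simp
  fix x assume "x \<in> C_body d K"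
  then have x: "translate_defect K x \<le> (1 - d) * vol K" by (simp add: C_body_translate_defect Kc)
  have "K \<inter> (\<lambda>z. z + real N *\<^sub>R x) ` K \<noteq> {}"
  proof
    assume "K \<inter> (\<lambda>z. z + real N *\<^sub>R x) ` K = {}"
    then have "vol K = translate_defect K (real N *\<^sub>R x)" by (simp add: translate_defect_def Diff_triv)
    also have "\<dots> \<le> real N * ((1 - d) * vol K)"
      using translate_defect_multiple[OF Kc(1), of N x] x mult_left_mono[OF x, of "real N"] by simp
    also have "\<dots> < vol K" using N(2) vol_convex_body_pos[OF K] by (simp add: mult.assoc[symmetric])
    finally show False by simp
  qed
  then obtain c where c: "c \<in> K" "c + real N *\<^sub>R x \<in> K" by auto
  have "(1 - 1 / real N) ^ (CARD('n) - 1) * projection_volume K x \<le> translate_defect K x"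
    using N by (intro translate_defect_ge_projection_volume[OF Kc c]) auto
  with x have "projection_volume K x \<le> ?r" using q by (simp add: field_simps)
  then have "projection_volume K (inverse ?r *\<^sub>R x) \<le> 1"
    unfolding projection_volume_scale[OF Kc(1)] using r by (simp add: divide_simps abs_of_pos del: inverse_divide abs_divide split: if_splits)
      (simp add: mult_ac)?
  moreover have "x = ?r *\<^sub>R inverse ?r *\<^sub>R x"
    unfolding scaleR_scaleR right_inverse[OF less_imp_neq[OF r, symmetric]] by simp
  ultimately show "x \<in> (*\<^sub>R) ?r ` polar_projection_body K" unfolding polar_projection_body_def by blast
qed

lemma polar_projection_body_subset_C_body:
  fixes K :: "(real^'n) set"
  assumes K: "convex_body K" and d: "d < 1"
  shows "(*\<^sub>R) ((1 - d) * vol K) ` polar_projection_body K \<subseteq> C_body d K"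
proof
  have r: "(1 - d) * vol K > 0" using d vol_convex_body_pos[OF K] by simp
  fix x assume "x \<in> (*\<^sub>R) ((1 - d) * vol K) ` polar_projection_body K"
  then obtain z where z: "x = ((1 - d) * vol K) *\<^sub>R z" "projection_volume K z \<le> 1" by (auto simp: polar_projection_body_def)
  have "translate_defect K x \<le> projection_volume K x" by (intro translate_defect_le_projection_volume convex_bodyD[OF K])
  also have "\<dots> = ((1 - d) * vol K) * projection_volume K z" using r by (simp add: z(1) projection_volume_scale convex_bodyD(1)[OF K])
  also have "\<dots> \<le> (1 - d) * vol K" using z(2) r by (simp add: mult_left_le)
  finally show "x \<in> C_body d K" by (simp add: C_body_translate_defect convex_bodyD(1)[OF K])
qed

lemma closed_C_body:
  fixes K :: "(real^'n) set"
  assumes K: "convex_body K"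
  shows "closed (C_body d K)"
proof -
  note Kc = convex_bodyD(1,2)[OF K]
  have step: "translate_defect K x - translate_defect K y \<le> projection_volume K (x - y)" for x y
    using translate_defect_triangle[OF Kc(1), of "x - y" y] translate_defect_le_projection_volume[OF Kc, of "x - y"] by simp
  have "isCont (translate_defect K) x" for x
  proof -
    have "((\<lambda>y. projection_volume K (y - x)) \<longlongrightarrow> projection_volume K (x - x)) (at x)"
      by (rule isCont_tendsto_compose[of _ "projection_volume K"])
         (use continuous_projection_volume[OF K] in \<open>auto simp: continuous_on_eq_continuous_at simp del: LIM_zero_iff intro!: tendsto_intros LIM_zero\<close>)
    then have "((\<lambda>y. projection_volume K (y - x)) \<longlongrightarrow> 0) (at x)" by simp
    then have "((\<lambda>y. translate_defect K y - translate_defect K x) \<longlongrightarrow> 0) (at x)"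
    proof (rule Lim_null_comparison[rotated], intro always_eventually allI)
      fix y
      have "projection_volume K (x - y) = projection_volume K (y - x)" using projection_volume_uminus[OF Kc(1), of "y - x"] by simp
      then show "norm (translate_defect K y - translate_defect K x) \<le> projection_volume K (y - x)" using step[of x y] step[of y x] by (simp add: abs_le_iff)
    qed
    then show ?thesis by (simp add: isCont_def LIM_zero_iff)
  qed
  then have "continuous_on UNIV (translate_defect K)" by (simp add: continuous_on_eq_continuous_at)
  then show ?thesis unfolding C_body_translate_defect[OF Kc(1)] by (intro closed_Collect_le) auto
qed

lemma vol_C_body_le:
  fixes K :: "(real^'n) set"
  assumes K: "convex_body K" and d: "d < 1" and N: "N \<ge> 2" "real N * (1 - d) < 1"
  shows "vol (C_body d K) \<le> ((1 - d) ^ CARD('n) * vol K) * petty K / ((1 - 1 / real N) ^ (CARD('n) - 1)) ^ CARD('n)"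
    "C_body d K \<in> lmeasurable"
proof -
  let ?q = "(1 - 1 / real N) ^ (CARD('n) - 1)" 
  let ?r = "(1 - d) * vol K / ?q"
  have r: "?r > 0" using N d vol_convex_body_pos[OF K] by simp
  have cp: "compact ((*\<^sub>R) ?r ` polar_projection_body K)" by (intro compact_scaling convex_bodyD(1) convex_body_polar_projection_body K)
  note sub = C_body_subset_polar_projection_body[OF K d N]
  show m: "C_body d K \<in> lmeasurable"
    using closed_C_body[OF K] sub cp by (meson bounded_subset compact_eq_bounded_closed compact_imp_bounded lmeasurable_compact)
  have "vol (C_body d K) \<le> vol ((*\<^sub>R) ?r ` polar_projection_body K)"
    using m cp sub by (intro measure_mono_fmeasurable) (auto simp: lmeasurable_compact)
  also have "\<dots> = ?r ^ CARD('n) * vol (polar_projection_body K)" by (rule vol_scaleR[OF r])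
  also have "\<dots> = (1 - d) ^ CARD('n) * (vol K ^ CARD('n) * vol (polar_projection_body K)) / ?q ^ CARD('n)"
    by (simp add: power_divide power_mult_distrib)
  also have "vol K ^ CARD('n) = vol K * vol K ^ (CARD('n) - 1)"
    by (metis One_nat_def Suc_pred power_Suc zero_less_card_finite)
  finally show "vol (C_body d K) \<le> ((1 - d) ^ CARD('n) * vol K) * petty K / ?q ^ CARD('n)"
    by (simp add: petty_def mult.assoc)
qed

lemma vol_C_body_ge:
  fixes K :: "(real^'n) set"
  assumes K: "convex_body K" and d: "d < 1" and N: "N \<ge> 2" "real N * (1 - d) < 1"
  shows "((1 - d) ^ CARD('n) * vol K) * petty K \<le> vol (C_body d K)"
proof -
  let ?r = "(1 - d) * vol K"
  have r: "?r > 0" using d vol_convex_body_pos[OF K] by simp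
  have cp: "compact ((*\<^sub>R) ?r ` polar_projection_body K)" by (intro compact_scaling convex_bodyD(1) convex_body_polar_projection_body K)
  have "?r ^ CARD('n) * vol (polar_projection_body K) = vol ((*\<^sub>R) ?r ` polar_projection_body K)" by (simp add: vol_scaleR[OF r])
  also have "\<dots> \<le> vol (C_body d K)"
    using vol_C_body_le(2)[OF assms] fmeasurableD[OF lmeasurable_compact[OF cp]] polar_projection_body_subset_C_body[OF K d]
    by (intro measure_mono_fmeasurable)
  also have "?r ^ CARD('n) * vol (polar_projection_body K) = (1 - d) ^ CARD('n) * (vol K ^ CARD('n) * vol (polar_projection_body K))"
    by (simp add: power_mult_distrib)
  also have "vol K ^ CARD('n) = vol K * vol K ^ (CARD('n) - 1)"
    by (metis One_nat_def Suc_pred power_Suc zero_less_card_finite)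
  finally show ?thesis by (simp add: petty_def mult.assoc)
qed

section \<open>Compactness of the space of convex bodies modulo affine maps\<close>

lemma spanning_basis_family:
  fixes C :: "(real^'n) set"
  assumes "interior C \<noteq> {}"
  obtains g :: "real^'n \<Rightarrow> real^'n" where "linear g" "bij g" "\<And>i. g (axis i 1) \<in> C"
proof -
  have dimC: "dim C = CARD('n)"
    using assms empty_interior_lowdim[of C] dim_subset_UNIV[of C] by (metis DIM_cart DIM_real le_neq_implies_less mult.right_neutral)
  obtain B where B: "B \<subseteq> C" "independent B" "C \<subseteq> span B" "card B = dim C"
    using basis_exists[of C] by blast
  have finB: "finite B" using B(2) by (rule independent_imp_finite)
  obtain h :: "'n \<Rightarrow> real^'n" where h: "bij_betw h UNIV B"
    using finite_same_card_bij[of "UNIV :: 'n set" B] finB B(4) dimC by auto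
  define g where "g = (\<lambda>c. \<Sum>i\<in>UNIV. c $ i *\<^sub>R h i)"
  have lin: "linear g" unfolding g_def
    by (intro linear_compose_sum ballI) (auto intro!: linearI simp: algebra_simps)
  have ax: "g (axis i 1) = h i" for i
    unfolding g_def by (subst sum.remove[of _ i]) (auto simp: axis_def intro!: sum.neutral)
  have "B \<subseteq> range g" using h ax by (metis bij_betw_def image_subset_iff rangeI)
  then have "span B \<subseteq> range g"
    by (intro span_minimal) (auto intro: linear_subspace_image lin)
  moreover have "span B = UNIV"
    using card_ge_dim_independent[of B UNIV] B dimC by (simp add: top.extremum_unique)
  ultimately have "surj g" by auto
  then have "bij g" using lin by (simp add: bij_def linear_surjective_imp_injective)
  then show ?thesis using that[OF lin] ax h B(1) by (metis UNIV_I bij_betwE subsetD)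
qed

text \<open>Choose \<open>n\<close> points of \<open>C\<close> with determinant of maximal modulus as the images of the unit vectors. Replacing one of them by
  another point of \<open>C\<close> multiplies the determinant by a coordinate of that point (Cramer's rule), so this coordinate is at most 1 in modulus.\<close>

lemma maximal_determinant_position:
  fixes C :: "(real^'n) set"
  assumes C: "compact C" "interior C \<noteq> {}"
  obtains f :: "real^'n \<Rightarrow> real^'n" where "linear f" "bij f" "\<And>i. f (axis i 1) \<in> C"
    "\<And>y i. f y \<in> C \<Longrightarrow> \<bar>y $ i\<bar> \<le> 1"
proof -
  let ?S = "{A :: real^'n^'n. \<forall>i. A $ i \<in> C}"
  have "closed ?S"
  proof -
    have "closed ((\<lambda>A :: real^'n^'n. A $ i) -` C)" for i
      using C(1) by (intro continuous_closed_vimage compact_imp_closed) (auto intro!: continuous_intros)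
    then have "closed (\<Inter>i. (\<lambda>A :: real^'n^'n. A $ i) -` C)" by blast
    moreover have "(\<Inter>i. (\<lambda>A :: real^'n^'n. A $ i) -` C) = ?S" by auto
    ultimately show ?thesis by simp
  qed
  moreover have "bounded ?S"
  proof -
    obtain R where R: "\<And>x. x \<in> C \<Longrightarrow> norm x \<le> R" using compact_imp_bounded[OF C(1)] by (auto simp: bounded_iff)
    have "norm A \<le> (\<Sum>i\<in>(UNIV::'n set). R)" if "A \<in> ?S" for A
    proof -
      have "norm A \<le> (\<Sum>i\<in>UNIV. norm (A $ i))" unfolding norm_vec_def by (intro L2_set_le_sum) simp
      also have "\<dots> \<le> (\<Sum>i\<in>(UNIV::'n set). R)" using R that by (intro sum_mono) auto
      finally show ?thesis .
    qed
    then show ?thesis unfolding bounded_iff by blast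
  qed
  ultimately have cS: "compact ?S" by (simp add: compact_eq_bounded_closed)
  have cont: "continuous_on ?S (\<lambda>A. \<bar>det A\<bar>)"
    unfolding det_def by (intro continuous_intros)
  obtain g :: "real^'n \<Rightarrow> real^'n" where g: "linear g" "bij g" "\<And>i. g (axis i 1) \<in> C" using spanning_basis_family[OF C(2)] by blast
  let ?B = "\<chi> i. g (axis i 1)"
  have "transpose ?B = matrix g" by (simp add: transpose_def matrix_def vec_eq_iff)
  then have detB: "det ?B \<noteq> 0"
    using g det_nz_iff_inj[OF g(1)] by (metis bij_is_inj det_transpose)
  have "?B \<in> ?S" using g(3) by simp
  then obtain A where A: "A \<in> ?S" "\<And>D. D \<in> ?S \<Longrightarrow> \<bar>det D\<bar> \<le> \<bar>det A\<bar>"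
    using continuous_attains_sup[OF cS _ cont] by blast
  have detA: "det A \<noteq> 0" using A(2)[OF \<open>?B \<in> ?S\<close>] detB by auto
  define f where "f = (\<lambda>c. transpose A *v c)"
  have lin: "linear f" unfolding f_def by (rule matrix_vector_mul_linear)
  have f_sum: "f c = (\<Sum>i\<in>UNIV. c $ i *s row i A)" for c
    unfolding f_def by (simp add: matrix_mult_sum column_transpose)
  have row: "row i A = A $ i" for i by (simp add: row_def vec_eq_iff)
  have "bij f"
  proof -
    have "det (matrix f) \<noteq> 0" using detA unfolding f_def matrix_of_matrix_vector_mul by (simp add: det_transpose)
    then have "inj f" using det_nz_iff_inj[OF lin] by simp
    then show ?thesis using lin by (simp add: bij_def linear_injective_imp_surjective)
  qed
  moreover have "f (axis i 1) \<in> C" for i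
  proof -
    have "f (axis i 1) = A $ i"
      unfolding f_sum row by (subst sum.remove[of _ i]) (auto simp: axis_def intro!: sum.neutral)
    then show ?thesis using A(1) by simp
  qed
  moreover have "\<bar>y $ k\<bar> \<le> 1" if y: "f y \<in> C" for y k
  proof -
    let ?D = "(\<chi> i. if i = k then (\<Sum>i\<in>UNIV. y $ i *s row i A) else row i A) :: real^'n^'n"
    have "?D \<in> ?S" using y A(1) by (simp add: f_sum row)
    then have "\<bar>y $ k * det A\<bar> \<le> \<bar>det A\<bar>"
      using A(2)[of ?D] cramer_lemma_transpose[of k y A] by simp
    then show ?thesis using detA by (simp add: abs_mult)
  qed
  ultimately show ?thesis using that[OF lin] by blast
qed

text \<open>Apply the previous lemma to \<open>K - k\<close> for a point \<open>k\<close> of \<open>K\<close>. The result contains the standard simplex, whose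
  point with all coordinates \<open>1 / (2 * n)\<close> is the centre of a ball of radius \<open>1 / (2 * n)\<close> inside the simplex.\<close>

lemma convex_body_position:
  fixes K :: "(real^'n) set"
  assumes K: "convex_body K"
  obtains f :: "real^'n \<Rightarrow> real^'n" and c where "linear f" "bij f"
    "cball 0 (1 / (2 * real CARD('n))) \<subseteq> (\<lambda>z. f z + c) ` K" "(\<lambda>z. f z + c) ` K \<subseteq> cball 0 (real CARD('n) + 1)"
proof -
  let ?n = "real CARD('n)"
  have n: "?n > 0" by simp
  obtain k where k: "k \<in> K" using convex_bodyD(6)[OF K] by blast
  let ?C = "(+) (- k) ` K"
  have "compact ?C" "interior ?C \<noteq> {}"
    using compact_translation[OF convex_bodyD(1)[OF K], of "- k"] interior_translation[of "- k" K] convex_bodyD(3)[OF K]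
    by (simp_all only: image_is_empty not_False_eq_True)
  then obtain f :: "real^'n \<Rightarrow> real^'n" where f: "linear f" "bij f" "\<And>i. f (axis i 1) \<in> ?C" "\<And>y i. f y \<in> ?C \<Longrightarrow> \<bar>y $ i\<bar> \<le> 1"
    using maximal_determinant_position by metis
  define p where "p = ((\<chi> i. 1 / (2 * ?n)) :: real^'n)"
  let ?f = "inv f" and ?c = "- inv f k - p"
  note fi = linear_bij_inv[OF f(1,2)]
  have mem: "z \<in> (\<lambda>z. ?f z + ?c) ` K \<longleftrightarrow> f (z + p) \<in> ?C" for z
  proof
    assume "z \<in> (\<lambda>z. ?f z + ?c) ` K"
    then obtain x where x: "x \<in> K" "z + p = ?f x - ?f k" by (auto simp: algebra_simps)
    then have "f (z + p) = - k + x" by (simp add: linear_diff f fi)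
    then show "f (z + p) \<in> ?C" using x by blast
  next
    assume "f (z + p) \<in> ?C"
    then obtain x where x: "x \<in> K" "f (z + p) = - k + x" by auto
    then have "z + p = ?f (x - k)" by (metis fi(4) uminus_add_conv_diff)
    then have "z = ?f x + ?c" using fi(1) by (simp add: linear_diff algebra_simps)
    then show "z \<in> (\<lambda>z. ?f z + ?c) ` K" using x by blast
  qed
  have convC: "convex ?C" by (intro convex_translation convex_bodyD[OF K])
  have C0: "0 \<in> ?C" using k by force
  have "cball 0 (1 / (2 * ?n)) \<subseteq> (\<lambda>z. ?f z + ?c) ` K"
  proof
    fix z :: "real^'n" assume z: "z \<in> cball 0 (1 / (2 * ?n))"
    let ?y = "z + p"
    have zi: "\<bar>z $ i\<bar> \<le> 1 / (2 * ?n)" for i using z component_le_norm_cart[of z i] by simp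
    have y: "0 \<le> ?y $ i" "?y $ i \<le> 1 / ?n" for i 
    proof -
      have h: "1 / ?n = 1 / (2 * ?n) + 1 / (2 * ?n)" by simp
      show "0 \<le> ?y $ i" "?y $ i \<le> 1 / ?n" using zi[of i] unfolding h by (simp_all add: p_def abs_le_iff)
    qed
    have s: "(\<Sum>i\<in>UNIV. ?y $ i) \<le> 1"
    proof -
      have "(\<Sum>i\<in>UNIV. ?y $ i) \<le> (\<Sum>i\<in>(UNIV::'n set). 1 / ?n)" by (intro sum_mono y)
      then show ?thesis by simp
    qed
    have fy: "f ?y = (\<Sum>i\<in>UNIV. ?y $ i *\<^sub>R f (axis i 1))"
    proof -
      have "?y = (\<Sum>i\<in>UNIV. ?y $ i *\<^sub>R axis i 1)" by (simp add: vec_eq_iff axis_def if_distrib cong: if_cong)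
      then have "f ?y = f (\<Sum>i\<in>UNIV. ?y $ i *\<^sub>R axis i 1)" by (rule arg_cong)
      then show ?thesis by (simp only: linear_sum[OF f(1)] linear_scale[OF f(1)])
    qed
    have "f ?y \<in> ?C"
    proof (cases "(\<Sum>i\<in>UNIV. ?y $ i) = 0")
      case True
      then have "\<forall>i\<in>UNIV. ?y $ i = 0" using y by (subst (asm) sum_nonneg_eq_0_iff) auto
      then show ?thesis unfolding fy using C0 by simp
    next
      case False
      let ?s = "\<Sum>i\<in>UNIV. ?y $ i"
      have sp: "?s > 0" using False y by (simp add: less_le sum_nonneg)
      have "(\<Sum>i\<in>UNIV. (?y $ i / ?s) *\<^sub>R f (axis i 1)) \<in> ?C"
        by (intro convex_sum convC) (use y sp f(3) False in \<open>auto simp: sum_divide_distrib[symmetric]\<close>)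
      then have "(1 - ?s) *\<^sub>R 0 + ?s *\<^sub>R (\<Sum>i\<in>UNIV. (?y $ i / ?s) *\<^sub>R f (axis i 1)) \<in> ?C"
        using sp s C0 by (intro convexD[OF convC]) auto
      moreover have "?s *\<^sub>R (\<Sum>i\<in>UNIV. (?y $ i / ?s) *\<^sub>R f (axis i 1)) = f ?y"
        unfolding fy scaleR_sum_right using False by (intro sum.cong) auto
      ultimately show ?thesis by simp
    qed
    then show "z \<in> (\<lambda>z. ?f z + ?c) ` K" by (simp only: mem)
  qed
  moreover have "(\<lambda>z. ?f z + ?c) ` K \<subseteq> cball 0 (?n + 1)"
  proof
    fix z assume "z \<in> (\<lambda>z. ?f z + ?c) ` K"
    then have y: "\<bar>(z + p) $ i\<bar> \<le> 1" for i using f(4) mem by blast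
    have "norm (z + p) \<le> (\<Sum>i\<in>UNIV. \<bar>(z + p) $ i\<bar>)" by (rule norm_le_l1_cart)
    also have "\<dots> \<le> (\<Sum>i\<in>(UNIV::'n set). 1)" by (intro sum_mono y)
    finally have "norm (z + p) \<le> ?n" by simp
    moreover have "norm p \<le> (\<Sum>i\<in>UNIV. \<bar>p $ i\<bar>)" by (rule norm_le_l1_cart)
    then have "norm p \<le> 1 / 2" by (simp add: p_def)
    ultimately have "norm z \<le> ?n + 1" using norm_triangle_ineq4[of "z + p" p] by simp
    then show "z \<in> cball 0 (?n + 1)" by simp
  qed
  ultimately show ?thesis using that[OF fi(1,2)] by blast
qed

definition support_function :: "'a::euclidean_space set \<Rightarrow> 'a \<Rightarrow> real" where
  "support_function M v = Sup ((\<lambda>x. x \<bullet> v) ` M)"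

lemma support_function_upper:
  assumes "compact M" "x \<in> M" shows "x \<bullet> v \<le> support_function M v"
proof -
  have "bounded ((\<lambda>x. x \<bullet> v) ` M)"
    by (intro compact_imp_bounded compact_continuous_image assms continuous_intros)
  then show ?thesis unfolding support_function_def using assms(2) by (intro cSup_upper bounded_imp_bdd_above) auto
qed

lemma support_function_le:
  assumes "M \<noteq> {}" "\<And>x. x \<in> M \<Longrightarrow> x \<bullet> v \<le> b" shows "support_function M v \<le> b"
  unfolding support_function_def using assms by (intro cSup_least) auto

lemma mem_of_support_function:
  fixes M :: "'a::euclidean_space set"
  assumes M: "closed M" "convex M" "compact M" "M \<noteq> {}" and z: "\<And>v. norm v = 1 \<Longrightarrow> z \<bullet> v \<le> support_function M v"
  shows "z \<in> M"
proof (rule ccontr)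
  assume "z \<notin> M"
  then obtain a b where ab: "a \<bullet> z < b" "\<And>x. x \<in> M \<Longrightarrow> a \<bullet> x > b"
    using separating_hyperplane_closed_point[OF M(2,1)] by blast
  have a0: "a \<noteq> 0" using ab M(4) by force
  let ?v = "- (a /\<^sub>R norm a)"
  have "support_function M ?v \<le> - (b / norm a)"
  proof (rule support_function_le[OF M(4)])
    fix x assume "x \<in> M"
    then have "b / norm a \<le> (a \<bullet> x) / norm a" using ab(2) by (intro divide_right_mono) (auto simp: less_imp_le)
    then show "x \<bullet> ?v \<le> - (b / norm a)" by (simp add: inner_commute divide_inverse_commute)
  qed
  also have "\<dots> < z \<bullet> ?v"
  proof -
    have "(a \<bullet> z) / norm a < b / norm a" using ab(1) a0 by (intro divide_strict_right_mono) auto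
    then show ?thesis by (simp add: inner_commute divide_inverse_commute)
  qed
  finally show False using z[of ?v] a0 by simp
qed

text \<open>The support functions are uniformly Lipschitz on the sphere, so a subsequence converges uniformly to some \<open>g\<close>, and
  the limit body is the intersection of the half spaces \<open>x \<bullet> v \<le> g v\<close>. Since all support functions are at least
  \<open>\<rho>\<close>, an additive error between them is a multiplicative one.\<close>

lemma blaschke_selection:
  fixes M :: "nat \<Rightarrow> (real^'n) set"
  assumes M: "\<And>i. compact (M i)" "\<And>i. convex (M i)" and rho: "\<rho> > 0"
    and sub: "\<And>i. cball 0 \<rho> \<subseteq> M i" "\<And>i. M i \<subseteq> cball 0 R"
  obtains L r where "convex_body L" "strict_mono (r :: nat \<Rightarrow> nat)"
    "\<And>e. e > 0 \<Longrightarrow> \<exists>N. \<forall>j\<ge>N. M (r j) \<subseteq> (*\<^sub>R) (1 + e) ` L \<and> L \<subseteq> (*\<^sub>R) (1 + e) ` M (r j)"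
proof -
  let ?S = "sphere (0::real^'n) 1"
  have ne: "M i \<noteq> {}" for i using sub(1)[of i] rho by force
  have R: "norm x \<le> R" if "x \<in> M i" for x i using sub(2)[of i] that by auto
  have R0: "R \<ge> 0" using R ne by (metis all_not_in_conv norm_ge_zero order_trans)
  have up: "support_function (M i) v \<le> R * norm v" for i v
  proof (rule support_function_le[OF ne])
    fix x assume "x \<in> M i"
    then show "x \<bullet> v \<le> R * norm v"
      using Cauchy_Schwarz_ineq2[of x v] R[of x i] mult_right_mono[of "norm x" R "norm v"] by auto
  qed
  have lo: "\<rho> \<le> support_function (M i) v" if "v \<in> ?S" for i v
  proof -
    have "\<rho> *\<^sub>R v \<in> M i" using that rho sub(1)[of i] by (auto simp: subset_iff)
    then show ?thesis using support_function_upper[OF M(1), of "\<rho> *\<^sub>R v" i v] that by (simp add: dot_square_norm)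
  qed
  have lip: "support_function (M i) v \<le> support_function (M i) w + R * norm (v - w)" for i v w
  proof (rule support_function_le[OF ne])
    fix x assume x: "x \<in> M i"
    have "x \<bullet> (v - w) \<le> R * norm (v - w)"
      using Cauchy_Schwarz_ineq2[of x "v - w"] R[OF x] mult_right_mono[of "norm x" R "norm (v - w)"] by auto
    then show "x \<bullet> v \<le> support_function (M i) w + R * norm (v - w)"
      using support_function_upper[OF M(1) x, of w] by (simp add: inner_diff_right)
  qed
  have lip2: "norm (support_function (M i) v - support_function (M i) w) \<le> R * norm (v - w)" for i v w
    using lip[of i v w] lip[of i w v] by (simp add: abs_le_iff norm_minus_commute)
  obtain g k where g: "continuous_on ?S g" "strict_mono (k :: nat \<Rightarrow> nat)"
    "\<And>e. 0 < e \<Longrightarrow> \<exists>N. \<forall>n x. n \<ge> N \<and> x \<in> ?S \<longrightarrow> norm (support_function (M (k n)) x - g x) < e"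
  proof (rule Arzela_Ascoli[of ?S "\<lambda>i. support_function (M i)" R])
    show "norm (support_function (M i) x) \<le> R" if "x \<in> ?S" for i x
      using up[of i x] lo[OF that, of i] that rho by simp
    show "\<exists>d. 0 < d \<and> (\<forall>n y. y \<in> ?S \<and> norm (x - y) < d \<longrightarrow> norm (support_function (M n) x - support_function (M n) y) < e)"
      if "x \<in> ?S" "0 < e" for x e
    proof (intro exI[of _ "e / (R + 1)"] conjI allI impI)
      show "0 < e / (R + 1)" using that R0 by simp
      fix n y assume "y \<in> ?S \<and> norm (x - y) < e / (R + 1)"
      then have "(R + 1) * norm (x - y) < e" using R0 by (simp add: field_simps)
      moreover have "R * norm (x - y) \<le> (R + 1) * norm (x - y)" by (intro mult_right_mono) auto
      ultimately show "norm (support_function (M n) x - support_function (M n) y) < e" using lip2[of n x y] by simp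
    qed
  qed (auto intro: that)
  have glo: "\<rho> \<le> g v" if v: "v \<in> ?S" for v
  proof (rule field_le_epsilon)
    fix e :: real assume "e > 0"
    from g(3)[OF this] obtain N where "norm (support_function (M (k N)) v - g v) < e" using v by blast
    then show "\<rho> \<le> g v + e" using lo[OF v, of "k N"] by simp
  qed
  have gup: "g v \<le> R" if v: "v \<in> ?S" for v
  proof (rule field_le_epsilon)
    fix e :: real assume "e > 0"
    from g(3)[OF this] obtain N where "norm (support_function (M (k N)) v - g v) < e" using v by blast
    then show "g v \<le> R + e" using up[of "k N" v] v by simp
  qed
  define L where "L = {x. \<forall>v\<in>?S. x \<bullet> v \<le> g v}"
  have Leq: "L = (\<Inter>v\<in>?S. {x. v \<bullet> x \<le> g v})" by (auto simp: L_def inner_commute)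
  have "closed L" unfolding Leq by (intro closed_INT ballI closed_halfspace_le)
  have "convex L" unfolding Leq by (intro convex_INT convex_halfspace_le)
  have "norm x \<le> R" if "x \<in> L" for x
  proof (cases "x = 0")
    case False
    then have "x /\<^sub>R norm x \<in> ?S" by simp
    with that have "x \<bullet> (x /\<^sub>R norm x) \<le> g (x /\<^sub>R norm x)" unfolding L_def by blast
    also have "\<dots> \<le> R" using False by (intro gup) simp
    finally show ?thesis using False by (simp add: dot_square_norm power2_eq_square inverse_eq_divide)
  qed (simp add: R0)
  then have "bounded L" by (auto simp: bounded_iff)
  have "cball 0 \<rho> \<subseteq> L"
  proof
    fix x :: "real^'n" assume x: "x \<in> cball 0 \<rho>"
    have "x \<bullet> v \<le> g v" if "v \<in> ?S" for v
      using Cauchy_Schwarz_ineq2[of x v] x that glo[OF that] by simp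
    then show "x \<in> L" by (simp add: L_def)
  qed
  then have "0 \<in> interior L" by (intro interiorI[of "ball 0 \<rho>"]) (use rho in auto)
  then have "interior L \<noteq> {}" by auto
  then have L: "convex_body L"
    using \<open>closed L\<close> \<open>convex L\<close> \<open>bounded L\<close> by (simp add: convex_body_def compact_eq_bounded_closed)
  have close: "\<exists>N. \<forall>j\<ge>N. M (k j) \<subseteq> (*\<^sub>R) (1 + e) ` L \<and> L \<subseteq> (*\<^sub>R) (1 + e) ` M (k j)" if e: "e > 0" for e :: real
  proof -
    have "e * \<rho> > 0" using e rho by simp
    from g(3)[OF this] obtain N where N: "\<And>n x. n \<ge> N \<Longrightarrow> x \<in> ?S \<Longrightarrow> norm (support_function (M (k n)) x - g x) < e * \<rho>" by blast
    have "M (k j) \<subseteq> (*\<^sub>R) (1 + e) ` L \<and> L \<subseteq> (*\<^sub>R) (1 + e) ` M (k j)" if j: "j \<ge> N" for j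
    proof (intro conjI subsetI)
      have sc: "x = (1 + e) *\<^sub>R (inverse (1 + e) *\<^sub>R x)" for x :: "real^'n" using e by simp
      fix x assume x: "x \<in> M (k j)"
      have "x \<bullet> v \<le> (1 + e) * g v" if v: "v \<in> ?S" for v
      proof -
        have "e * \<rho> \<le> e * g v" using glo[OF v] e by simp
        then show ?thesis using support_function_upper[OF M(1) x, of v] N[OF j v] unfolding distrib_right real_norm_def by linarith
      qed
      then have "inverse (1 + e) *\<^sub>R x \<in> L" using e by (simp add: L_def inverse_eq_divide divide_le_eq mult.commute)
      then show "x \<in> (*\<^sub>R) (1 + e) ` L" using sc[of x] by blast
    next
      have sc: "x = (1 + e) *\<^sub>R (inverse (1 + e) *\<^sub>R x)" for x :: "real^'n" using e by simp
      fix x assume x: "x \<in> L"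
      have "x \<bullet> v \<le> (1 + e) * support_function (M (k j)) v" if v: "v \<in> ?S" for v
      proof -
        have "x \<bullet> v \<le> g v" using x v unfolding L_def by blast
        moreover have "e * \<rho> \<le> e * support_function (M (k j)) v" using lo[OF v] e by simp
        ultimately show ?thesis using N[OF j v] unfolding distrib_right real_norm_def by linarith
      qed
      then have "inverse (1 + e) *\<^sub>R x \<in> M (k j)"
        using e by (intro mem_of_support_function M ne compact_imp_closed) (auto simp: inverse_eq_divide divide_le_eq mult.commute)
      then show "x \<in> (*\<^sub>R) (1 + e) ` M (k j)" using sc[of x] by blast
    qed
    then show ?thesis by blast
  qed
  show ?thesis by (rule that[OF L g(2) close])
qed

lemma affine_compactness:
  fixes K :: "nat \<Rightarrow> (real^'n) set"
  assumes K: "\<And>i. convex_body (K i)"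
  obtains L :: "(real^'n) set" and r where "convex_body L" "strict_mono (r :: nat \<Rightarrow> nat)"
    "\<And>e. e > 0 \<Longrightarrow> \<exists>N. \<forall>j\<ge>N. petty (K (r j)) \<le> (1 + e) * petty L"
    "\<And>e. e > 0 \<Longrightarrow> \<exists>N. \<forall>j\<ge>N. \<exists>(f :: real^'n \<Rightarrow> real^'n) c. linear f \<and> bij f \<and> (\<lambda>z. f z + c) ` K (r j) \<subseteq> (*\<^sub>R) (1 + e) ` L \<and>
       L \<subseteq> (*\<^sub>R) (1 + e) ` (\<lambda>z. f z + c) ` K (r j)"
proof -
  define P where "P i f c \<longleftrightarrow> linear f \<and> bij f \<and> cball 0 (1 / (2 * real CARD('n))) \<subseteq> (\<lambda>z. f z + c) ` K i \<and>
     (\<lambda>z. f z + c) ` K i \<subseteq> cball 0 (real CARD('n) + 1)" for i c and f :: "real^'n \<Rightarrow> real^'n"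
  have "\<exists>f c. P i f c" for i
    unfolding P_def by (rule convex_body_position[OF K[of i]]) blast
  then obtain f c where "\<And>i. P i (f i) (c i)" by metis
  then have fc: "\<And>i. linear (f i)" "\<And>i. bij (f i)"
    "\<And>i. cball 0 (1 / (2 * real CARD('n))) \<subseteq> (\<lambda>z. f i z + c i) ` K i"
    "\<And>i. (\<lambda>z. f i z + c i) ` K i \<subseteq> cball 0 (real CARD('n) + 1)"
    unfolding P_def by blast+
  let ?M = "\<lambda>i. (\<lambda>z. f i z + c i) ` K i"
  have M: "convex_body (?M i)" for i by (intro convex_body_affine_image K fc)
  obtain L r where Lr: "convex_body L" "strict_mono (r :: nat \<Rightarrow> nat)"
    "\<And>e. e > 0 \<Longrightarrow> \<exists>N. \<forall>j\<ge>N. ?M (r j) \<subseteq> (*\<^sub>R) (1 + e) ` L \<and> L \<subseteq> (*\<^sub>R) (1 + e) ` ?M (r j)"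
  proof (rule blaschke_selection)
    show "compact (?M i)" "convex (?M i)" for i using convex_bodyD(1,2)[OF M] by auto
    show "0 < 1 / (2 * real CARD('n))" by simp
    show "cball 0 (1 / (2 * real CARD('n))) \<subseteq> ?M i" "?M i \<subseteq> cball 0 (real CARD('n) + 1)" for i by (fact fc(3,4))+
  qed (rule that)
  have 1: "\<exists>N. \<forall>j\<ge>N. petty (K (r j)) \<le> (1 + e) * petty L" if e: "e > 0" for e
  proof -
    let ?p = "2 * CARD('n) * (CARD('n) - 1)"
    have "(\<lambda>d. (1 + d) ^ ?p) \<midarrow>0\<rightarrow> (1 + 0 :: real) ^ ?p" by (intro tendsto_intros)
    then have "\<forall>\<^sub>F d in at (0::real). (1 + d) ^ ?p < 1 + e" using e by (intro order_tendstoD) auto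
    then obtain d0 where d0: "d0 > 0" "\<And>d. d \<noteq> 0 \<Longrightarrow> dist d 0 < d0 \<Longrightarrow> (1 + d) ^ ?p < 1 + e"
      unfolding eventually_at by auto
    define d where "d = d0 / 2"
    have d: "d > 0" "(1 + d) ^ ?p < 1 + e" using d0 by (auto simp: d_def)
    obtain N where N: "\<And>j. j \<ge> N \<Longrightarrow> ?M (r j) \<subseteq> (*\<^sub>R) (1 + d) ` L \<and> L \<subseteq> (*\<^sub>R) (1 + d) ` ?M (r j)"
      using Lr(3)[OF d(1)] by blast
    have "petty (K (r j)) \<le> (1 + e) * petty L" if "j \<ge> N" for j
    proof -
      have "petty (K (r j)) = petty (?M (r j))" by (intro petty_affine_image[symmetric] K fc)
      also have "\<dots> \<le> (1 + d) ^ ?p * petty L"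
        using N[OF that] d(1) by (intro petty_sandwich M Lr(1)) auto
      also have "\<dots> \<le> (1 + e) * petty L"
        using d(2) petty_pos[OF Lr(1)] by (intro mult_right_mono) auto
      finally show ?thesis .
    qed
    then show ?thesis by blast
  qed
  have 2: "\<exists>N. \<forall>j\<ge>N. \<exists>(f :: real^'n \<Rightarrow> real^'n) c. linear f \<and> bij f \<and> (\<lambda>z. f z + c) ` K (r j) \<subseteq> (*\<^sub>R) (1 + e) ` L \<and>
       L \<subseteq> (*\<^sub>R) (1 + e) ` (\<lambda>z. f z + c) ` K (r j)" if e: "e > 0" for e
  proof -
    obtain N where N: "\<forall>j\<ge>N. ?M (r j) \<subseteq> (*\<^sub>R) (1 + e) ` L \<and> L \<subseteq> (*\<^sub>R) (1 + e) ` ?M (r j)"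
      using Lr(3)[OF e] by (rule exE)
    show ?thesis
    proof (intro exI[of _ N] allI impI)
      fix j assume "N \<le> j"
      then have "?M (r j) \<subseteq> (*\<^sub>R) (1 + e) ` L" "L \<subseteq> (*\<^sub>R) (1 + e) ` ?M (r j)" using N by simp_all
      then show "\<exists>(f :: real^'n \<Rightarrow> real^'n) c. linear f \<and> bij f \<and> (\<lambda>z. f z + c) ` K (r j) \<subseteq> (*\<^sub>R) (1 + e) ` L \<and>
         L \<subseteq> (*\<^sub>R) (1 + e) ` (\<lambda>z. f z + c) ` K (r j)"
        by (intro exI[of _ "f (r j)"] exI[of _ "c (r j)"] conjI fc)
    qed
  qed
  show ?thesis by (rule that[OF Lr(1,2) 1 2])
qed

lemma petty_attains_max:
  obtains L :: "(real^'n) set" where "convex_body L" "\<And>K :: (real^'n) set. convex_body K \<Longrightarrow> petty K \<le> petty L"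
proof -
  let ?P = "petty ` {K :: (real^'n) set. convex_body K}"
  have "bdd_above ?P"
  proof (rule ccontr)
    assume "\<not> bdd_above ?P"
    then have "\<exists>K :: (real^'n) set. convex_body K \<and> petty K > real i" for i
      unfolding bdd_above_def by (force simp: not_le)
    then obtain K :: "nat \<Rightarrow> (real^'n) set" where K: "\<And>i. convex_body (K i)" "\<And>i. petty (K i) > real i" by metis
    obtain L :: "(real^'n) set" and r where Lr: "strict_mono (r :: nat \<Rightarrow> nat)" "\<And>e. e > 0 \<Longrightarrow> \<exists>N. \<forall>j\<ge>N. petty (K (r j)) \<le> (1 + e) * petty L"
      by (rule affine_compactness[of K, OF K(1)], rule that)
    obtain N where N: "\<forall>j\<ge>N. petty (K (r j)) \<le> (1 + 1) * petty L" using Lr(2)[of 1] by auto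
    obtain m :: nat where m: "real m > 2 * petty L" using reals_Archimedean2 by blast
    let ?j = "max N m"
    have "real m \<le> real (r ?j)" using seq_suble[OF Lr(1), of ?j] by simp
    also have "\<dots> < petty (K (r ?j))" by (rule K)
    also have "\<dots> \<le> (1 + 1) * petty L" using N by simp
    finally show False using m by simp
  qed
  moreover have ne: "?P \<noteq> {}"
  proof -
    have "convex_body (cball (0::real^'n) 1)" by (simp add: convex_body_def)
    then show ?thesis by blast
  qed
  ultimately have up: "petty K \<le> Sup ?P" if "convex_body K" for K :: "(real^'n) set"
    using that by (intro cSup_upper) auto
  have "\<exists>K :: (real^'n) set. convex_body K \<and> Sup ?P - 1 / real (Suc i) < petty K" for i
    using less_cSupD[OF ne, of "Sup ?P - 1 / real (Suc i)"] by auto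
  then obtain K :: "nat \<Rightarrow> (real^'n) set" where K: "\<And>i. convex_body (K i)" "\<And>i. Sup ?P - 1 / real (Suc i) < petty (K i)" by metis
  obtain L :: "(real^'n) set" and r where Lr: "convex_body L" "strict_mono (r :: nat \<Rightarrow> nat)" "\<And>e. e > 0 \<Longrightarrow> \<exists>N. \<forall>j\<ge>N. petty (K (r j)) \<le> (1 + e) * petty L"
    by (rule affine_compactness[of K, OF K(1)], rule that)
  have "Sup ?P \<le> petty L"
  proof (rule field_le_epsilon)
    fix e :: real assume e: "e > 0"
    let ?e = "e / (2 * petty L)"
    have pL: "petty L > 0" by (rule petty_pos[OF Lr(1)])
    then have "?e > 0" using e by simp
    then obtain N where N: "\<forall>j\<ge>N. petty (K (r j)) \<le> (1 + ?e) * petty L" using Lr(3) by blast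
    obtain m :: nat where m: "1 / real (Suc m) < e / 2" using e nat_approx_posE[of "e / 2"] by auto
    let ?j = "max N m"
    have "1 / real (Suc (r ?j)) \<le> 1 / real (Suc m)"
      using seq_suble[OF Lr(2), of ?j] by (intro divide_left_mono) auto
    then have "Sup ?P - e / 2 < petty (K (r ?j))" using K(2)[of "r ?j"] m by linarith
    also have "\<dots> \<le> (1 + ?e) * petty L" using N by simp
    also have "\<dots> = petty L + e / 2" using pL by (simp add: field_simps)
    finally show "Sup ?P \<le> petty L + e" by simp
  qed
  then have max: "petty K \<le> petty L" if "convex_body K" for K :: "(real^'n) set"
    using up[OF that] by simp
  show ?thesis by (rule that[OF Lr(1) max])
qed

section \<open>Steiner symmetrization\<close>

text \<open>The chord of \<open>K\<close> on each line parallel to \<open>u\<close> is moved along the line so that it is bisected by the hyperplane orthogonal to \<open>u\<close>. The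
  symmetrized chord is written as half the difference set of the chord, which makes convexity and compactness immediate.\<close>

definition steiner :: "'a::euclidean_space \<Rightarrow> 'a set \<Rightarrow> 'a set" where
  "steiner u K = {z. \<exists>\<beta> \<gamma>. z + \<beta> *\<^sub>R u \<in> K \<and> z + \<gamma> *\<^sub>R u \<in> K \<and> z \<bullet> u = (\<beta> - \<gamma>) / 2}"

lemma steiner_line:
  assumes "norm u = 1"
  shows "y + t *\<^sub>R u \<in> steiner u K \<longleftrightarrow> (\<exists>\<beta> \<gamma>. y + \<beta> *\<^sub>R u \<in> K \<and> y + \<gamma> *\<^sub>R u \<in> K \<and> t = (\<beta> - \<gamma>) / 2 - y \<bullet> u)"
proof
  have uu: "u \<bullet> u = 1" using assms by (simp add: dot_square_norm)
  {
    assume "y + t *\<^sub>R u \<in> steiner u K"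
    then obtain b c where "y + t *\<^sub>R u + b *\<^sub>R u \<in> K" "y + t *\<^sub>R u + c *\<^sub>R u \<in> K" "(y + t *\<^sub>R u) \<bullet> u = (b - c) / 2"
      by (auto simp: steiner_def)
    then show "\<exists>\<beta> \<gamma>. y + \<beta> *\<^sub>R u \<in> K \<and> y + \<gamma> *\<^sub>R u \<in> K \<and> t = (\<beta> - \<gamma>) / 2 - y \<bullet> u"
      by (intro exI[of _ "t + b"] exI[of _ "t + c"]) (simp add: inner_add_left uu algebra_simps)
  next
    assume "\<exists>\<beta> \<gamma>. y + \<beta> *\<^sub>R u \<in> K \<and> y + \<gamma> *\<^sub>R u \<in> K \<and> t = (\<beta> - \<gamma>) / 2 - y \<bullet> u"
    then obtain b c where "y + b *\<^sub>R u \<in> K" "y + c *\<^sub>R u \<in> K" "t = (b - c) / 2 - y \<bullet> u" by blast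
    then show "y + t *\<^sub>R u \<in> steiner u K"
      unfolding steiner_def
      by (intro CollectI exI[of _ "b - t"] exI[of _ "c - t"]) (auto simp: inner_add_left uu algebra_simps)
  }
qed

lemma compact_steiner:
  assumes K: "compact K" and u: "norm u = 1"
  shows "compact (steiner u K)"
proof -
  have uu: "u \<bullet> u = 1" using u by (simp add: dot_square_norm)
  let ?P = "(K \<times> K) \<inter> {z. fst z - snd z = ((fst z - snd z) \<bullet> u) *\<^sub>R u}"
  let ?g = "\<lambda>z. fst z - ((fst z \<bullet> u + snd z \<bullet> u) / 2) *\<^sub>R u"
  have "closed {z. fst z - snd z = ((fst z - snd z) \<bullet> u) *\<^sub>R u}"
    by (intro closed_Collect_eq continuous_intros)
  then have "compact ?P" using K by (intro compact_Int_closed compact_Times)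
  then have "compact (?g ` ?P)" by (intro compact_continuous_image continuous_intros) auto
  moreover have "?g ` ?P = steiner u K"
  proof (intro set_eqI iffI)
    fix z assume "z \<in> ?g ` ?P"
    then obtain p q where pq: "p \<in> K" "q \<in> K" "p - q = ((p - q) \<bullet> u) *\<^sub>R u" "z = p - ((p \<bullet> u + q \<bullet> u) / 2) *\<^sub>R u" by auto
    let ?b = "(p \<bullet> u + q \<bullet> u) / 2" and ?c = "(p \<bullet> u + q \<bullet> u) / 2 - (p - q) \<bullet> u"
    have "z + ?b *\<^sub>R u = p" by (simp add: pq(4))
    moreover have "z + ?c *\<^sub>R u = q"
    proof -
      have "z + ?c *\<^sub>R u = p - ((p - q) \<bullet> u) *\<^sub>R u" unfolding pq(4) by (simp add: scaleR_diff_left)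
      also have "\<dots> = q" by (subst pq(3)[symmetric]) simp
      finally show ?thesis .
    qed
    moreover have "z \<bullet> u = (?b - ?c) / 2" by (simp add: pq(4) inner_diff_left uu field_simps)
    ultimately show "z \<in> steiner u K"
      using pq(1,2) unfolding steiner_def by (intro CollectI exI[of _ ?b] exI[of _ ?c]) simp
  next
    fix z assume "z \<in> steiner u K"
    then obtain b c where bc: "z + b *\<^sub>R u \<in> K" "z + c *\<^sub>R u \<in> K" "z \<bullet> u = (b - c) / 2" by (auto simp: steiner_def)
    have "z = ?g (z + b *\<^sub>R u, z + c *\<^sub>R u)"
    proof -
      have "((z + b *\<^sub>R u) \<bullet> u + (z + c *\<^sub>R u) \<bullet> u) / 2 = b" by (simp add: inner_add_left uu bc(3) field_simps)
      then show ?thesis by simp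
    qed
    moreover have "(z + b *\<^sub>R u, z + c *\<^sub>R u) \<in> ?P" using bc(1,2) by (simp add: inner_diff_left inner_add_left uu algebra_simps)
    ultimately show "z \<in> ?g ` ?P" by (rule image_eqI)
  qed
  ultimately show ?thesis by simp
qed

lemma convex_steiner:
  assumes K: "convex K"
  shows "convex (steiner u K)"
proof (rule convexI)
  fix x y and s t :: real assume x: "x \<in> steiner u K" and y: "y \<in> steiner u K" and st: "0 \<le> s" "0 \<le> t" "s + t = 1"
  obtain b c where bc: "x + b *\<^sub>R u \<in> K" "x + c *\<^sub>R u \<in> K" "x \<bullet> u = (b - c) / 2" using x by (auto simp: steiner_def)
  obtain d e where de: "y + d *\<^sub>R u \<in> K" "y + e *\<^sub>R u \<in> K" "y \<bullet> u = (d - e) / 2" using y by (auto simp: steiner_def)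
  have "s *\<^sub>R (x + b *\<^sub>R u) + t *\<^sub>R (y + d *\<^sub>R u) \<in> K" "s *\<^sub>R (x + c *\<^sub>R u) + t *\<^sub>R (y + e *\<^sub>R u) \<in> K"
    using bc de st by (auto intro: convexD[OF K])
  then show "s *\<^sub>R x + t *\<^sub>R y \<in> steiner u K"
    unfolding steiner_def
    by (intro CollectI exI[of _ "s * b + t * d"] exI[of _ "s * c + t * e"])
       (simp add: algebra_simps inner_add_left bc(3) de(3) add_divide_distrib diff_divide_distrib)
qed

lemma compact_convex_real:
  fixes I :: "real set"
  assumes "compact I" "convex I" "I \<noteq> {}"
  obtains a b where "a \<le> b" "I = {a..b}"
  using connected_compact_interval_1[of I] convex_connected[of I] assms
  by (metis atLeastatMost_empty_iff)

lemma convex_line_section: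
  assumes "convex K" shows "convex {t::real. y + t *\<^sub>R x \<in> K}"
proof (rule convexI)
  fix s t a b :: real assume "s \<in> {t. y + t *\<^sub>R x \<in> K}" "t \<in> {t. y + t *\<^sub>R x \<in> K}" and ab: "0 \<le> a" "0 \<le> b" "a + b = 1"
  then have "a *\<^sub>R (y + s *\<^sub>R x) + b *\<^sub>R (y + t *\<^sub>R x) \<in> K" by (intro convexD[OF assms]) auto
  moreover have "a *\<^sub>R (y + s *\<^sub>R x) + b *\<^sub>R (y + t *\<^sub>R x) = (a + b) *\<^sub>R y + (a * s + b * t) *\<^sub>R x"
    by (simp add: algebra_simps)
  ultimately show "a *\<^sub>R s + b *\<^sub>R t \<in> {t. y + t *\<^sub>R x \<in> K}" by (simp add: ab(3))
qed

lemma compact_line_section: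
  fixes K :: "'a::euclidean_space set"
  assumes "compact K" "x \<noteq> 0" shows "compact {t::real. y + t *\<^sub>R x \<in> K}"
  using closed_line_section[of K y x] bounded_line_section[of K x y] assms
  by (simp add: compact_eq_bounded_closed)

text \<open>The volume is preserved because corresponding chords have equal length.\<close>

lemma steiner_convex_body:
  fixes K :: "(real^'n) set"
  assumes K: "convex_body K" and u: "norm u = 1"
  shows "convex_body (steiner u K)" "vol (steiner u K) = vol K"
proof -
  let ?S = "steiner u K"
  note Kc = convex_bodyD(1,2)[OF K]
  have S: "compact ?S" "convex ?S" by (intro compact_steiner convex_steiner Kc u)+
  have u0: "u \<noteq> 0" using u by auto
  have len: "emeasure lborel {t::real. y + t *\<^sub>R u \<in> ?S} = emeasure lborel {t::real. y + t *\<^sub>R u \<in> K}" for y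
  proof (cases "{t::real. y + t *\<^sub>R u \<in> K} = {}")
    case True
    then have "{t::real. y + t *\<^sub>R u \<in> ?S} = {}" by (auto simp: steiner_line[OF u])
    with True show ?thesis by (simp only:)
  next
    case False
    obtain a b where ab: "a \<le> b" "{t::real. y + t *\<^sub>R u \<in> K} = {a..b}"
      using compact_convex_real[OF compact_line_section[OF Kc(1) u0] convex_line_section[OF Kc(2)] False] .
    have mem: "y + t *\<^sub>R u \<in> K \<longleftrightarrow> a \<le> t \<and> t \<le> b" for t
      using ab(2) by (metis atLeastAtMost_iff mem_Collect_eq)
    have "{t::real. y + t *\<^sub>R u \<in> ?S} = {- ((b - a) / 2) - y \<bullet> u .. (b - a) / 2 - y \<bullet> u}"
    proof (intro set_eqI iffI)
      fix t assume "t \<in> {t. y + t *\<^sub>R u \<in> ?S}"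
      then obtain c d where "a \<le> c" "c \<le> b" "a \<le> d" "d \<le> b" "t = (c - d) / 2 - y \<bullet> u"
        by (auto simp: steiner_line[OF u] mem)
      then show "t \<in> {- ((b - a) / 2) - y \<bullet> u .. (b - a) / 2 - y \<bullet> u}" by (simp add: field_simps)
    next
      fix t assume t: "t \<in> {- ((b - a) / 2) - y \<bullet> u .. (b - a) / 2 - y \<bullet> u}"
      let ?s = "t + y \<bullet> u"
      show "t \<in> {t. y + t *\<^sub>R u \<in> ?S}"
        unfolding steiner_line[OF u] mem using t
        by (intro CollectI exI[of _ "(a + b) / 2 + ?s"] exI[of _ "(a + b) / 2 - ?s"]) (auto simp: field_simps)
    qed
    then show ?thesis using ab by simp
  qed
  have "emeasure lborel ?S = emeasure lborel K"
    using S(1) convex_bodyD(7)[OF K] u0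
    by (simp add: emeasure_slab_fibration[of _ u u] compact_imp_closed len)
  then show v: "vol ?S = vol K"
    using S(1) convex_bodyD(7)[OF K] by (simp add: measure_def compact_imp_closed)
  then have "\<not> negligible ?S"
    using vol_convex_body_pos[OF K] lmeasurable_compact[OF S(1)] by (simp add: negligible_iff_measure)
  then show "convex_body ?S" using S by (simp add: convex_body_def negligible_convex_interior)
qed

section \<open>Widths of planar sections\<close>

text \<open>The length of the projection of a planar set along the direction \<open>(1, p)\<close>.\<close>

definition section_width :: "(real \<times> real) set \<Rightarrow> real \<Rightarrow> real" where
  "section_width L p = measure lborel ((\<lambda>z. snd z - fst z * p) ` L)"

lemma section_width_extremes:
  assumes "compact L" "convex L" "L \<noteq> {}"
  obtains zt zb where "zt \<in> L" "zb \<in> L" "\<And>z. z \<in> L \<Longrightarrow> snd z - fst z * p \<le> snd zt - fst zt * p"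
    "\<And>z. z \<in> L \<Longrightarrow> snd zb - fst zb * p \<le> snd z - fst z * p"
    "section_width L p = (snd zt - fst zt * p) - (snd zb - fst zb * p)"
proof -
  let ?h = "\<lambda>z::real \<times> real. snd z - fst z * p"
  have lin: "linear ?h" by (intro linearI) (auto simp: algebra_simps)
  have c: "compact (?h ` L)" by (intro compact_continuous_image continuous_intros assms)
  have v: "convex (?h ` L)" by (intro convex_linear_image assms lin)
  have ne: "?h ` L \<noteq> {}" using assms(3) by simp
  obtain a b where ab: "a \<le> b" "?h ` L = {a..b}" using compact_convex_real[OF c v ne] .
  have "b \<in> ?h ` L" "a \<in> ?h ` L" using ab by auto
  then obtain zt zb where z: "zt \<in> L" "zb \<in> L" "?h zt = b" "?h zb = a" by auto
  have "?h z \<le> b \<and> a \<le> ?h z" if "z \<in> L" for z using ab(2) that by auto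
  moreover have "section_width L p = b - a" using ab by (simp add: section_width_def)
  ultimately show ?thesis using z by (intro that[of zt zb]) simp_all
qed

text \<open>Some vertical chord of \<open>L\<close> has its upper end on the supporting line of slope \<open>p\<close> from above and
  its lower end on the supporting line of slope \<open>q\<close> from below.\<close>

definition opposite_touching :: "(real \<times> real) set \<Rightarrow> real \<Rightarrow> real \<Rightarrow> bool" where
  "opposite_touching L p q \<longleftrightarrow> (\<exists>\<alpha> \<beta> \<gamma>. (\<alpha>, \<beta>) \<in> L \<and> (\<alpha>, \<gamma>) \<in> L \<and>
     (\<forall>z\<in>L. snd z - fst z * p \<le> \<beta> - \<alpha> * p) \<and> (\<forall>z\<in>L. \<gamma> - \<alpha> * q \<le> snd z - fst z * q))"

lemma section_width_nonneg: "section_width L p \<ge> 0" by (simp add: section_width_def)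

text \<open>Here \<open>M\<close> is the Steiner symmetral of \<open>L\<close> in the vertical direction, shifted by \<open>k\<close>. The two extreme points of \<open>M\<close> for the slope
  \<open>(p - q) / 2\<close> come from two vertical chords of \<open>L\<close>; the first chord is compared with the upper supporting line of slope \<open>p\<close> and
  the lower one of slope \<open>q\<close>, the second chord with the other two. Equality forces all four comparisons to be sharp.\<close>

lemma section_width_steiner:
  assumes L: "compact L" "convex L" and M: "compact M" "convex M"
    and LM: "\<And>\<alpha> \<tau>. (\<alpha>, \<tau>) \<in> M \<longleftrightarrow> (\<exists>\<beta> \<gamma>. (\<alpha>, \<beta>) \<in> L \<and> (\<alpha>, \<gamma>) \<in> L \<and> \<tau> = (\<beta> - \<gamma>) / 2 - k)"
  shows section_width_steiner_le: "section_width M ((p - q) / 2) \<le> (section_width L p + section_width L q) / 2"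
    and section_width_steiner_eq: "section_width M ((p - q) / 2) = (section_width L p + section_width L q) / 2 \<Longrightarrow> L \<noteq> {} \<Longrightarrow>
      opposite_touching L p q \<and> opposite_touching L q p"
proof -
  have main: "section_width M ((p - q) / 2) \<le> (section_width L p + section_width L q) / 2 \<and> (section_width M ((p - q) / 2) = (section_width L p + section_width L q) / 2 \<longrightarrow>
      (opposite_touching L p q \<and> opposite_touching L q p))"
    if Lne: "L \<noteq> {}"
  proof -
    obtain \<alpha>0 \<beta>0 where "(\<alpha>0, \<beta>0) \<in> L" using Lne by force
    then have "(\<alpha>0, (\<beta>0 - \<beta>0) / 2 - k) \<in> M" unfolding LM by blast
    then have Mne: "M \<noteq> {}" by blast
    obtain pt pb where P: "pt \<in> L" "pb \<in> L" "\<And>z. z \<in> L \<Longrightarrow> snd z - fst z * p \<le> snd pt - fst pt * p"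
      "\<And>z. z \<in> L \<Longrightarrow> snd pb - fst pb * p \<le> snd z - fst z * p" "section_width L p = (snd pt - fst pt * p) - (snd pb - fst pb * p)"
      by (rule section_width_extremes[OF L Lne, of p], rule that)
    obtain qt qb where Q: "qt \<in> L" "qb \<in> L" "\<And>z. z \<in> L \<Longrightarrow> snd z - fst z * q \<le> snd qt - fst qt * q"
      "\<And>z. z \<in> L \<Longrightarrow> snd qb - fst qb * q \<le> snd z - fst z * q" "section_width L q = (snd qt - fst qt * q) - (snd qb - fst qb * q)"
      by (rule section_width_extremes[OF L Lne, of q], rule that)
    obtain mt mb where Z: "mt \<in> M" "mb \<in> M" "section_width M ((p - q) / 2) = (snd mt - fst mt * ((p - q) / 2)) - (snd mb - fst mb * ((p - q) / 2))"
      by (rule section_width_extremes[OF M Mne, of "(p - q) / 2"], rule that)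
    obtain \<alpha> \<beta> \<gamma> where a: "(\<alpha>, \<beta>) \<in> L" "(\<alpha>, \<gamma>) \<in> L" "mt = (\<alpha>, (\<beta> - \<gamma>) / 2 - k)" using Z(1) LM by (cases mt) auto
    obtain \<alpha>' \<beta>' \<gamma>' where b: "(\<alpha>', \<beta>') \<in> L" "(\<alpha>', \<gamma>') \<in> L" "mb = (\<alpha>', (\<beta>' - \<gamma>') / 2 - k)" using Z(2) LM by (cases mb) auto
    have arith: "w \<le> (A - D + (C - B)) / 2 \<and> (w = (A - D + (C - B)) / 2 \<longrightarrow> a = A \<and> b = B \<and> c = C \<and> d = D)"
      if "2 * w = a - b + (c - d)" "a \<le> A" "B \<le> b" "c \<le> C" "D \<le> d" for w a b c d A B C D :: real
      using that by (auto simp: field_simps)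
    have 0: "2 * section_width M ((p - q) / 2) = (\<beta> - \<alpha> * p) - (\<gamma> - \<alpha> * q) + ((\<gamma>' - \<alpha>' * q) - (\<beta>' - \<alpha>' * p))"
      unfolding Z(3) a(3) b(3) by (simp add: field_simps)
    have 1: "\<beta> - \<alpha> * p \<le> snd pt - fst pt * p" using P(3)[OF a(1)] by simp
    have 2: "snd qb - fst qb * q \<le> \<gamma> - \<alpha> * q" using Q(4)[OF a(2)] by simp
    have 3: "\<gamma>' - \<alpha>' * q \<le> snd qt - fst qt * q" using Q(3)[OF b(2)] by simp
    have 4: "snd pb - fst pb * p \<le> \<beta>' - \<alpha>' * p" using P(4)[OF b(1)] by simp
    have le: "section_width M ((p - q) / 2) \<le> (section_width L p + section_width L q) / 2"
      unfolding P(5) Q(5) using arith[OF 0 1 2 3 4] by blast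
    have eq: "section_width M ((p - q) / 2) = (section_width L p + section_width L q) / 2 \<Longrightarrow> \<beta> - \<alpha> * p = snd pt - fst pt * p \<and> \<gamma> - \<alpha> * q = snd qb - fst qb * q \<and>
        \<gamma>' - \<alpha>' * q = snd qt - fst qt * q \<and> \<beta>' - \<alpha>' * p = snd pb - fst pb * p"
      unfolding P(5) Q(5) using arith[OF 0 1 2 3 4] by blast
    show ?thesis
    proof (rule conjI[OF le impI])
      assume "section_width M ((p - q) / 2) = (section_width L p + section_width L q) / 2"
      note eq = eq[OF this]
      have "opposite_touching L p q" unfolding opposite_touching_def
        using a(1,2) eq P(3) Q(4) by (intro exI[of _ \<alpha>] exI[of _ \<beta>] exI[of _ \<gamma>]) simp
      moreover have "opposite_touching L q p" unfolding opposite_touching_def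
        using b(1,2) eq P(4) Q(3) by (intro exI[of _ \<alpha>'] exI[of _ \<gamma>'] exI[of _ \<beta>']) simp
      ultimately show "opposite_touching L p q \<and> opposite_touching L q p" ..
    qed
  qed
  show "section_width M ((p - q) / 2) \<le> (section_width L p + section_width L q) / 2"
  proof (cases "L = {}")
    case True
    then have "M = {}" using LM by auto
    then show ?thesis using section_width_nonneg[of L p] section_width_nonneg[of L q] by (simp add: section_width_def)
  qed (use main in blast)
  show "opposite_touching L p q \<and> opposite_touching L q p"
    if "section_width M ((p - q) / 2) = (section_width L p + section_width L q) / 2" "L \<noteq> {}" using main that by blast
qed

text \<open>The section of \<open>K\<close> by the plane through \<open>y\<close> spanned by \<open>\<theta>\<close> and \<open>u\<close>, in coordinates.\<close>

definition plane_section :: "'a::euclidean_space set \<Rightarrow> 'a \<Rightarrow> 'a \<Rightarrow> 'a \<Rightarrow> (real \<times> real) set" where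
  "plane_section K \<theta> u y = {(\<alpha>, \<beta>). y + \<alpha> *\<^sub>R \<theta> + \<beta> *\<^sub>R u \<in> K}"

lemma plane_section_compact_convex:
  assumes K: "compact K" "convex K" and u: "norm u = 1" "\<theta> \<bullet> u = 0" "\<theta> \<noteq> 0"
  shows "compact (plane_section K \<theta> u y)" "convex (plane_section K \<theta> u y)"
proof -
  have uu: "u \<bullet> u = 1" using u by (simp add: dot_square_norm)
  let ?j = "\<lambda>z :: real \<times> real. y + fst z *\<^sub>R \<theta> + snd z *\<^sub>R u"
  let ?g = "\<lambda>x. (((x - y) \<bullet> \<theta>) / (\<theta> \<bullet> \<theta>), (x - y) \<bullet> u)"
  have gj: "?g (?j z) = z" for z using u uu by (cases z) (simp add: inner_add_left inner_add_right inner_commute)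
  have s: "plane_section K \<theta> u y = ?j -` K" by (auto simp: plane_section_def)
  have "closed (?j -` K)" using K(1) by (intro continuous_closed_vimage compact_imp_closed) (auto intro!: continuous_intros)
  moreover have "?j -` K \<subseteq> ?g ` K" using gj by (metis (no_types, lifting) image_eqI subsetI vimageD)
  moreover have "compact (?g ` K)" by (intro compact_continuous_image K continuous_intros) (use u in auto)
  ultimately show "compact (plane_section K \<theta> u y)" unfolding s by (meson bounded_subset compact_eq_bounded_closed)
  show "convex (plane_section K \<theta> u y)" unfolding s
  proof (rule convexI)
    fix z w and a b :: real assume "z \<in> ?j -` K" "w \<in> ?j -` K" and ab: "0 \<le> a" "0 \<le> b" "a + b = 1"
    then have "a *\<^sub>R ?j z + b *\<^sub>R ?j w \<in> K" by (intro convexD[OF K(2)]) auto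
    moreover have "a *\<^sub>R ?j z + b *\<^sub>R ?j w = (a + b) *\<^sub>R y + (a * fst z + b * fst w) *\<^sub>R \<theta> + (a * snd z + b * snd w) *\<^sub>R u"
      by (simp add: algebra_simps)
    ultimately show "a *\<^sub>R z + b *\<^sub>R w \<in> ?j -` K" by (simp add: ab(3))
  qed
qed

lemma plane_section_steiner:
  assumes u: "norm u = 1" "\<theta> \<bullet> u = 0"
  shows "(\<alpha>, \<tau>) \<in> plane_section (steiner u K) \<theta> u y \<longleftrightarrow>
    (\<exists>\<beta> \<gamma>. (\<alpha>, \<beta>) \<in> plane_section K \<theta> u y \<and> (\<alpha>, \<gamma>) \<in> plane_section K \<theta> u y \<and> \<tau> = (\<beta> - \<gamma>) / 2 - y \<bullet> u)"
  using steiner_line[OF u(1), of "y + \<alpha> *\<^sub>R \<theta>" \<tau> K] u(2) by (simp add: plane_section_def inner_add_left)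

text \<open>A parameter domain for the planes parallel to \<open>\<theta>\<close> and \<open>u\<close>, in the way in which a slab is one for parallel lines.\<close>

definition cell :: "'a::euclidean_space \<Rightarrow> 'a \<Rightarrow> 'a set" where
  "cell \<theta> u = {y. 0 \<le> y \<bullet> \<theta> \<and> y \<bullet> \<theta> < \<theta> \<bullet> \<theta> \<and> 0 \<le> y \<bullet> u \<and> y \<bullet> u < 1}"

text \<open>The cylinder over \<open>K\<close> in direction \<open>\<theta> + p *\<^sub>R u\<close> meets each plane parallel to \<open>\<theta>\<close> and \<open>u\<close> in the strip
  over the section of \<open>K\<close>. The slab is taken orthogonal to \<open>\<theta>\<close>, so that it is the same for all \<open>p\<close>.\<close>

lemma projection_volume_eq_integral_width:
  fixes K :: "(real^'n) set"
  assumes K: "compact K" "convex K" and u: "norm u = 1" "\<theta> \<bullet> u = 0" "\<theta> \<noteq> 0"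
  shows "has_bochner_integral lborel (\<lambda>y. indicator (cell \<theta> u) y * section_width (plane_section K \<theta> u y) p) (projection_volume K (\<theta> + p *\<^sub>R u))"
proof -
  have uu: "u \<bullet> u = 1" using u by (simp add: dot_square_norm)
  let ?x = "\<theta> + p *\<^sub>R u"
  have tx: "\<theta> \<bullet> ?x = \<theta> \<bullet> \<theta>" using u by (simp add: inner_add_right)
  let ?D = "sweep K ?x \<inter> {y. 0 \<le> y \<bullet> \<theta> \<and> y \<bullet> \<theta> < 0 + \<theta> \<bullet> \<theta>}"
  have D: "?D \<in> sets borel"
  proof -
    have "{y. 0 \<le> y \<bullet> \<theta> \<and> y \<bullet> \<theta> < 0 + \<theta> \<bullet> \<theta>} \<in> sets borel" by measurable
    then show ?thesis using sweep_borel[OF K(1), of ?x] by auto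
  qed
  have slice: "{t. y + t *\<^sub>R u \<in> sweep K ?x} = (\<lambda>z. snd z - fst z * p) ` plane_section K \<theta> u y" for y
  proof (intro set_eqI iffI)
    fix t assume "t \<in> {t. y + t *\<^sub>R u \<in> sweep K ?x}"
    then obtain s where "y + t *\<^sub>R u + s *\<^sub>R ?x \<in> K" by (auto simp: sweep_def)
    then have "(s, t + s * p) \<in> plane_section K \<theta> u y" by (simp add: plane_section_def algebra_simps)
    then show "t \<in> (\<lambda>z. snd z - fst z * p) ` plane_section K \<theta> u y" by (intro image_eqI[of _ _ "(s, t + s * p)"]) auto
  next
    fix t assume "t \<in> (\<lambda>z. snd z - fst z * p) ` plane_section K \<theta> u y"
    then obtain a b where ab: "y + a *\<^sub>R \<theta> + b *\<^sub>R u \<in> K" "t = b - a * p" by (auto simp: plane_section_def)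
    moreover have "y + t *\<^sub>R u + a *\<^sub>R ?x = y + a *\<^sub>R \<theta> + b *\<^sub>R u" unfolding ab(2) by (simp add: algebra_simps)
    ultimately have "y + t *\<^sub>R u + a *\<^sub>R ?x \<in> K" by (simp only:)
    then show "t \<in> {t. y + t *\<^sub>R u \<in> sweep K ?x}" unfolding sweep_def by blast
  qed
  have em: "emeasure lborel {t. y + t *\<^sub>R u \<in> sweep K ?x} = ennreal (section_width (plane_section K \<theta> u y) p)" for y
  proof -
    have "compact ((\<lambda>z. snd z - fst z * p) ` plane_section K \<theta> u y)"
      by (intro compact_continuous_image continuous_intros plane_section_compact_convex[OF K u])
    then show ?thesis unfolding slice section_width_def by (rule emeasure_compact_real)
  qed
  have "(\<lambda>y. emeasure lborel {t::real. y + t *\<^sub>R u \<in> sweep K ?x}) \<in> borel_measurable borel"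
  proof -
    have m: "sweep K ?x \<in> sets borel" by (rule sweep_borel[OF K(1)])
    have "(\<lambda>y. \<integral>\<^sup>+t. indicator (sweep K ?x) (y + t *\<^sub>R u) \<partial>(lborel::real measure)) \<in> borel_measurable borel"
      using m by measurable
    moreover have "(\<integral>\<^sup>+t. indicator (sweep K ?x) (y + t *\<^sub>R u) \<partial>(lborel::real measure)) = emeasure lborel {t::real. y + t *\<^sub>R u \<in> sweep K ?x}" for y
    proof -
      have "{t::real. y + t *\<^sub>R u \<in> sweep K ?x} \<in> sets borel"
        using closed_line_section[OF closed_sweep[OF K(1)], of y u ?x] by simp
      moreover have "(\<integral>\<^sup>+t. indicator (sweep K ?x) (y + t *\<^sub>R u) \<partial>(lborel::real measure)) = (\<integral>\<^sup>+t. indicator {t::real. y + t *\<^sub>R u \<in> sweep K ?x} t \<partial>lborel)"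
        by (intro nn_integral_cong) (auto simp: indicator_def)
      ultimately show ?thesis by simp
    qed
    ultimately show ?thesis by simp
  qed
  then have wm: "(\<lambda>y. section_width (plane_section K \<theta> u y) p) \<in> borel_measurable borel"
    unfolding em using borel_measurable_enn2real[of "\<lambda>y. ennreal (section_width (plane_section K \<theta> u y) p)" borel] by (simp add: section_width_nonneg)
  have Q: "cell \<theta> u \<in> sets borel" unfolding cell_def by measurable
  show ?thesis
  proof (rule has_bochner_integral_nn_integral)
    show "(\<lambda>y. indicator (cell \<theta> u) y * section_width (plane_section K \<theta> u y) p) \<in> borel_measurable lborel"
      using wm Q by measurable
    have "ennreal (projection_volume K ?x) = emeasure lborel ?D"
      using emeasure_sweep_slab[OF K(1), of \<theta> ?x "\<theta> \<bullet> \<theta>" 0] u(3) by (simp add: tx)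
    also have "\<dots> = (\<integral>\<^sup>+y. indicator {y. 0 \<le> y \<bullet> u \<and> y \<bullet> u < u \<bullet> u} y * emeasure lborel {t::real. y + t *\<^sub>R u \<in> ?D} \<partial>lborel)"
      using D uu by (intro emeasure_slab_fibration) auto
    also have "\<dots> = (\<integral>\<^sup>+y. ennreal (indicator (cell \<theta> u) y * section_width (plane_section K \<theta> u y) p) \<partial>lborel)"
    proof (rule nn_integral_cong)
      fix y
      have "{t::real. y + t *\<^sub>R u \<in> ?D} = (if 0 \<le> y \<bullet> \<theta> \<and> y \<bullet> \<theta> < \<theta> \<bullet> \<theta> then {t::real. y + t *\<^sub>R u \<in> sweep K ?x} else {})"
        using u(2) by (auto simp: inner_add_left inner_add_right inner_commute)
      then show "indicator {y. 0 \<le> y \<bullet> u \<and> y \<bullet> u < u \<bullet> u} y * emeasure lborel {t::real. y + t *\<^sub>R u \<in> ?D}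
        = ennreal (indicator (cell \<theta> u) y * section_width (plane_section K \<theta> u y) p)"
        by (auto simp: em indicator_def cell_def uu)
    qed
    finally show "(\<integral>\<^sup>+y. ennreal (indicator (cell \<theta> u) y * section_width (plane_section K \<theta> u y) p) \<partial>lborel) = ennreal (projection_volume K ?x)" by simp
  qed (auto simp: projection_volume_nonneg section_width_nonneg)
qed

lemma projection_volume_steiner:
  fixes K :: "(real^'n) set"
  assumes K: "convex_body K" and u: "norm u = 1" "\<theta> \<bullet> u = 0" "\<theta> \<noteq> 0"
  shows projection_volume_steiner_le: "projection_volume (steiner u K) (\<theta> + ((p - q) / 2) *\<^sub>R u) \<le> (projection_volume K (\<theta> + p *\<^sub>R u) + projection_volume K (\<theta> + q *\<^sub>R u)) / 2"
    and projection_volume_steiner_eq_AE: "projection_volume (steiner u K) (\<theta> + ((p - q) / 2) *\<^sub>R u) = (projection_volume K (\<theta> + p *\<^sub>R u) + projection_volume K (\<theta> + q *\<^sub>R u)) / 2 \<Longrightarrow>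
      AE y in lborel. y \<in> cell \<theta> u \<longrightarrow>
         section_width (plane_section (steiner u K) \<theta> u y) ((p - q) / 2) = (section_width (plane_section K \<theta> u y) p + section_width (plane_section K \<theta> u y) q) / 2"
proof -
  let ?S = "steiner u K" and ?I = "\<lambda>y. indicator (cell \<theta> u) y :: real"
  note S = steiner_convex_body(1)[OF K u(1)]
  note Kc = convex_bodyD(1,2)[OF K] and Sc = convex_bodyD(1,2)[OF S]
  let ?f = "\<lambda>y. ((?I y * section_width (plane_section K \<theta> u y) p + ?I y * section_width (plane_section K \<theta> u y) q) / 2) - ?I y * section_width (plane_section ?S \<theta> u y) ((p - q) / 2)"
  let ?v = "(projection_volume K (\<theta> + p *\<^sub>R u) + projection_volume K (\<theta> + q *\<^sub>R u)) / 2 - projection_volume ?S (\<theta> + ((p - q) / 2) *\<^sub>R u)"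
  have hb: "has_bochner_integral lborel ?f ?v"
    by (intro has_bochner_integral_diff has_bochner_integral_divide has_bochner_integral_add projection_volume_eq_integral_width Kc Sc u)
  have nonneg: "?f y \<ge> 0" for y
    using section_width_steiner_le[OF plane_section_compact_convex[OF Kc u] plane_section_compact_convex[OF Sc u] plane_section_steiner[OF u(1,2)], of y p q]
    by (simp add: indicator_def)
  have "?v \<ge> 0"
    using Bochner_Integration.integral_nonneg[of lborel ?f] nonneg has_bochner_integral_integral_eq[OF hb] by simp
  then show "projection_volume ?S (\<theta> + ((p - q) / 2) *\<^sub>R u) \<le> (projection_volume K (\<theta> + p *\<^sub>R u) + projection_volume K (\<theta> + q *\<^sub>R u)) / 2" by simp
  assume "projection_volume ?S (\<theta> + ((p - q) / 2) *\<^sub>R u) = (projection_volume K (\<theta> + p *\<^sub>R u) + projection_volume K (\<theta> + q *\<^sub>R u)) / 2"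
  then have "integral\<^sup>L lborel ?f = 0" using has_bochner_integral_integral_eq[OF hb] by simp
  moreover have "integrable lborel ?f" using hb by (rule integrable.intros)
  ultimately have "AE y in lborel. ?f y = 0"
    using integral_nonneg_eq_0_iff_AE[of lborel ?f] nonneg by simp
  then show "AE y in lborel. y \<in> cell \<theta> u \<longrightarrow>
         section_width (plane_section ?S \<theta> u y) ((p - q) / 2) = (section_width (plane_section K \<theta> u y) p + section_width (plane_section K \<theta> u y) q) / 2"
    by eventually_elim auto
qed

section \<open>Convex functions on the line\<close>

text \<open>Cut the interval into \<open>N\<close> equal parts: the increments of \<open>g\<close> telescope and the bound becomes \<open>(b - a) * (g b - g a) / N\<close>. The set \<open>T\<close>
  allows the hypothesis to be known for rational points only.\<close>

lemma telescoping_constant: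
  fixes D g :: "real \<Rightarrow> real"
  assumes ab: "a \<le> b" and grid: "\<And>N i. i \<le> N \<Longrightarrow> a + real i * ((b - a) / real N) \<in> T"
    and D: "\<And>x y. x \<in> T \<Longrightarrow> y \<in> T \<Longrightarrow> a \<le> x \<Longrightarrow> x \<le> y \<Longrightarrow> y \<le> b \<Longrightarrow> \<bar>D y - D x\<bar> \<le> (y - x) * (g y - g x)"
  shows "D a = D b"
proof -
  have bound: "\<bar>D b - D a\<bar> \<le> (b - a) * (g b - g a) * (1 / real N)" if N: "N > 0" for N :: nat
  proof -
    let ?h = "(b - a) / real N"
    let ?x = "\<lambda>i. a + real i * ?h"
    have h: "?h \<ge> 0" using ab by simp
    have step: "\<bar>D (?x i) - D (?x 0)\<bar> \<le> ?h * (g (?x i) - g (?x 0))" if "i \<le> N" for i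
      using that
    proof (induction i)
      case (Suc i)
      have up: "?x (Suc i) \<le> b"
      proof -
        have "real (Suc i) * ?h \<le> real N * ?h" using Suc.prems h by (intro mult_right_mono) auto
        then show ?thesis using N by simp
      qed
      have "\<bar>D (?x (Suc i)) - D (?x i)\<bar> \<le> (?x (Suc i) - ?x i) * (g (?x (Suc i)) - g (?x i))"
      proof (rule D)
        show "?x i \<in> T" "?x (Suc i) \<in> T" using Suc.prems by (intro grid; simp)+
        have "0 \<le> real i * ?h" using h by (intro mult_nonneg_nonneg) auto
        then show "a \<le> ?x i" by simp
        have "?x (Suc i) = ?x i + ?h" by (simp only: of_nat_Suc distrib_right mult_1_left add.assoc add.commute[of ?h])
        then show "?x i \<le> ?x (Suc i)" using h by linarith
      qed (rule up)
      also have "?x (Suc i) - ?x i = ?h" by (simp add: distrib_right add_divide_distrib)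
      finally have 1: "\<bar>D (?x (Suc i)) - D (?x i)\<bar> \<le> ?h * (g (?x (Suc i)) - g (?x i))" .
      have 2: "\<bar>D (?x i) - D (?x 0)\<bar> \<le> ?h * (g (?x i) - g (?x 0))" using Suc by simp
      have "\<bar>D (?x (Suc i)) - D (?x 0)\<bar> \<le> ?h * (g (?x (Suc i)) - g (?x i)) + ?h * (g (?x i) - g (?x 0))"
        using 1 2 by (smt (verit))
      then show ?case by (simp only: distrib_left[symmetric]) simp
    qed simp
    have "?x N = b" using N by simp
    then show ?thesis using step[of N] by simp
  qed
  have "(\<lambda>N. (b - a) * (g b - g a) * (1 / real N)) \<longlonglongrightarrow> (b - a) * (g b - g a) * 0"
    by (intro tendsto_intros lim_1_over_n)
  then have "(\<lambda>N. (b - a) * (g b - g a) * (1 / real N)) \<longlonglongrightarrow> 0" by simp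
  then have "\<bar>D b - D a\<bar> \<le> 0"
    by (rule LIMSEQ_le_const) (use bound in \<open>auto intro!: exI[of _ 1]\<close>)
  then show ?thesis by simp
qed

lemma convex_chord_slope:
  fixes \<phi> :: "real \<Rightarrow> real"
  assumes \<phi>: "convex_on UNIV \<phi>" "\<phi> 0 = 0" and k: "0 < k" "k \<le> a"
  shows "\<phi> (s * k) / k \<le> \<phi> (s * a) / a"
proof -
  have "\<phi> ((1 - k / a) *\<^sub>R 0 + (k / a) *\<^sub>R (s * a)) \<le> (1 - k / a) * \<phi> 0 + (k / a) * \<phi> (s * a)"
    using k by (intro convex_onD[OF \<phi>(1)]) auto
  then show ?thesis using k \<phi>(2) by (simp add: field_simps)
qed

text \<open>A convex function lies above the concave function \<open>- \<psi>\<close> and touches it at 0, so a line separates the two. Its slope is the supremum of the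
  difference quotients that have to lie below it.\<close>

lemma opposite_subgradients:
  fixes \<phi> \<psi> :: "real \<Rightarrow> real"
  assumes \<phi>: "convex_on UNIV \<phi>" "\<phi> 0 = 0" and \<psi>: "convex_on UNIV \<psi>" "\<psi> 0 = 0" and nn: "\<And>e. \<phi> e + \<psi> e \<ge> 0"
  obtains m where "\<And>e. m * e \<le> \<phi> e" "\<And>e. - (m * e) \<le> \<psi> e"
proof -
  have mid: "h a / a + h (- b) / b \<ge> 0" if "convex_on UNIV h" "h 0 = 0" "a > 0" "b > 0" for h :: "real \<Rightarrow> real" and a b
  proof -
    have "h ((1 - a / (a + b)) *\<^sub>R a + (a / (a + b)) *\<^sub>R (- b)) \<le> (1 - a / (a + b)) * h a + (a / (a + b)) * h (- b)"
      using that by (intro convex_onD[OF that(1)]) auto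
    moreover have "(1 - a / (a + b)) *\<^sub>R a + (a / (a + b)) *\<^sub>R (- b) = 0" using that by (simp add: field_simps)
    ultimately have "0 \<le> (1 - a / (a + b)) * h a + (a / (a + b)) * h (- b)" using that(2) by simp
    also have "\<dots> = (b * h a + a * h (- b)) / (a + b)"
    proof -
      have "1 - a / (a + b) = b / (a + b)" using that(3,4) by (simp add: field_simps)
      then show ?thesis by (simp add: add_divide_distrib)
    qed
    also have "b * h a + a * h (- b) = a * b * (h a / a + h (- b) / b)" using that(3,4) by (simp add: field_simps)
    finally have "0 * (a + b) \<le> a * b * (h a / a + h (- b) / b)" using that(3,4) by (subst (asm) pos_le_divide_eq) auto
    then have "a * b * 0 \<le> a * b * (h a / a + h (- b) / b)" by simp
    moreover have "a * b > 0" using that(3,4) by simp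
    ultimately show ?thesis by (simp only: mult_le_cancel_left_pos)
  qed
  have cross: "\<phi> (s * a) / a + \<psi> (s * b) / b \<ge> 0" if "a > 0" "b > 0" for a b s
  proof -
    let ?k = "min a b"
    have "\<phi> (s * ?k) / ?k \<le> \<phi> (s * a) / a" "\<psi> (s * ?k) / ?k \<le> \<psi> (s * b) / b"
      using that by (intro convex_chord_slope \<phi> \<psi>; simp)+
    moreover have "\<phi> (s * ?k) / ?k + \<psi> (s * ?k) / ?k \<ge> 0"
      using nn[of "s * ?k"] that by (simp add: add_divide_distrib[symmetric])
    ultimately show ?thesis by linarith
  qed
  let ?Lo = "(\<lambda>a. - \<phi> (- a) / a) ` {0<..} \<union> (\<lambda>a. - \<psi> a / a) ` {0<..}"
  have up1: "l \<le> \<phi> b / b" if "l \<in> ?Lo" "b > 0" for l b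
    using that mid[OF \<phi>, of b] cross[of b _ 1] by (auto simp: minus_divide_left[symmetric] algebra_simps; force)
  have up2: "l \<le> \<psi> (- b) / b" if "l \<in> ?Lo" "b > 0" for l b
    using that mid[OF \<psi>, of _ b] cross[of _ b "-1"] by (auto simp: minus_divide_left[symmetric] algebra_simps; force)
  have bdd: "bdd_above ?Lo" using up1[of _ 1] by (intro bdd_aboveI) auto
  have ne: "?Lo \<noteq> {}" by auto
  let ?m = "Sup ?Lo"
  have m1: "?m \<le> \<phi> b / b" "?m \<le> \<psi> (- b) / b" if "b > 0" for b
    using up1 up2 that by (intro cSup_least[OF ne]; blast)+
  have m2: "- \<phi> (- a) / a \<le> ?m" "- \<psi> a / a \<le> ?m" if "a > 0" for a
    using that by (intro cSup_upper[OF _ bdd]; blast)+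
  show ?thesis
  proof (rule that[of ?m])
    fix e :: real
    show "?m * e \<le> \<phi> e"
    proof (cases e "0::real" rule: linorder_cases)
      case less
      then show ?thesis using m2(1)[of "- e"] by (simp add: field_simps)
    next
      case greater
      then show ?thesis using m1(1)[of e] by (simp add: field_simps)
    qed (simp add: \<phi>)
    show "- (?m * e) \<le> \<psi> e"
    proof (cases e "0::real" rule: linorder_cases)
      case less
      then show ?thesis using m1(2)[of "- e"] by (simp add: field_simps)
    next
      case greater
      then show ?thesis using m2(2)[of e] by (simp add: field_simps)
    qed (simp add: \<psi>)
  qed
qed

lemma coercive_convex_sublevel:
  fixes H :: "real \<Rightarrow> real"
  assumes H: "convex_on UNIV H" and \<kappa>: "\<kappa> > 0" "\<And>t. \<kappa> * \<bar>t\<bar> - C \<le> H t" and x0: "H x0 \<le> v"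
  obtains q p where "q \<le> p" "{t. H t \<le> v} = {q..p}" "H q = v" "H p = v"
proof -
  have cont: "continuous_on UNIV H" by (intro convex_on_continuous H) auto
  have bd: "\<bar>t\<bar> \<le> (v + C) / \<kappa>" if "H t \<le> v" for t
    using \<kappa>(2)[of t] that \<kappa>(1) by (simp add: field_simps)
  have "compact {t. H t \<le> v}"
    using closed_Collect_le[OF cont continuous_on_const[of UNIV v]] bd by (auto simp: compact_eq_bounded_closed bounded_iff)
  moreover have "convex {t. H t \<le> v}"
  proof (rule convexI)
    fix x y a b :: real assume xy: "x \<in> {t. H t \<le> v}" "y \<in> {t. H t \<le> v}" and ab: "0 \<le> a" "0 \<le> b" "a + b = 1"
    have "H (a *\<^sub>R x + b *\<^sub>R y) \<le> a * H x + b * H y" using H ab unfolding convex_on_def by auto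
    also have "\<dots> \<le> a * v + b * v" using xy ab by (intro add_mono mult_left_mono) auto
    also have "\<dots> = v" using ab by (simp add: distrib_right[symmetric])
    finally show "a *\<^sub>R x + b *\<^sub>R y \<in> {t. H t \<le> v}" by simp
  qed
  ultimately obtain q p where qp: "q \<le> p" "{t. H t \<le> v} = {q..p}"
    using connected_compact_interval_1[of "{t. H t \<le> v}"] convex_connected x0 by (metis atLeastatMost_empty_iff empty_iff mem_Collect_eq)
  have mem: "H t \<le> v \<longleftrightarrow> q \<le> t \<and> t \<le> p" for t using qp(2) by (metis atLeastAtMost_iff mem_Collect_eq)
  have edge: "H s = v" if "s \<in> {q, p}" for s
  proof (rule ccontr)
    assume "H s \<noteq> v"
    then have "H s < v" using mem[of s] qp(1) that by auto
    have "isCont H s" using cont by (simp add: continuous_on_eq_continuous_at)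
    then have "\<forall>\<^sub>F t in at s. H t < v" using \<open>H s < v\<close> unfolding isCont_def by (rule order_tendstoD)
    then obtain d where d: "d > 0" "\<And>t. t \<noteq> s \<Longrightarrow> dist t s < d \<Longrightarrow> H t < v" unfolding eventually_at by auto
    have "H (s + d / 2) < v" "H (s - d / 2) < v" using d(1) by (auto intro!: d(2) simp: dist_real_def)
    then have "s + d / 2 \<le> p" "q \<le> s - d / 2" using mem[of "s + d / 2"] mem[of "s - d / 2"] by simp_all
    then show False using that d(1) by auto
  qed
  show ?thesis using that[OF qp] edge by simp
qed

text \<open>Let \<open>{q v..p v}\<close> be the sublevel sets. By the hypothesis \<open>pair\<close>, \<open>H\<close> has opposite subgradients \<open>m v\<close> and \<open>- m v\<close> at the two ends. Between the levels \<open>v\<close> and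
  \<open>w\<close> both ends therefore move outwards by amounts between \<open>(w - v) / m w\<close> and \<open>(w - v) / m v\<close>; so \<open>p v + q v\<close> is constant by the telescoping lemma.\<close>

lemma reflection_symmetry:
  fixes H :: "real \<Rightarrow> real"
  assumes H: "convex_on UNIV H" and \<kappa>: "\<kappa> > 0" "\<And>t. \<kappa> * \<bar>t\<bar> - C \<le> H t"
    and pair: "\<And>p q e v. q \<le> p \<Longrightarrow> {t. H t \<le> v} = {q..p} \<Longrightarrow> H q = v \<Longrightarrow> H p = v \<Longrightarrow> H (p + e) + H (q + e) \<ge> 2 * v"
  obtains c where "\<And>t. H (c - t) = H t"
proof -
  have cont: "continuous_on UNIV H" by (intro convex_on_continuous H) auto
  obtain q0 p0 where q0: "q0 \<le> p0" "{t. H t \<le> H 0} = {q0..p0}"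
    by (rule coercive_convex_sublevel[OF H \<kappa>, of 0 "H 0"]) auto
  obtain x0 where x0: "x0 \<in> {q0..p0}" "\<And>t. t \<in> {q0..p0} \<Longrightarrow> H x0 \<le> H t"
    using continuous_attains_inf[of "{q0..p0}" H] q0(1) continuous_on_subset[OF cont] by auto
  have min: "H x0 \<le> H t" for t
    using x0 q0(2) by (cases "H t \<le> H 0") (force, metis atLeastAtMost_iff le_cases mem_Collect_eq order_trans)
  let ?m0 = "H x0"
  have "\<exists>q p. q \<le> p \<and> {t. H t \<le> v} = {q..p} \<and> H q = v \<and> H p = v" if "v > ?m0" for v
    using coercive_convex_sublevel[OF H \<kappa>, of x0 v] that by (metis less_imp_le)
  then obtain q p where qp: "\<And>v. v > ?m0 \<Longrightarrow> q v \<le> p v" "\<And>v. v > ?m0 \<Longrightarrow> {t. H t \<le> v} = {q v..p v}"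
    "\<And>v. v > ?m0 \<Longrightarrow> H (q v) = v" "\<And>v. v > ?m0 \<Longrightarrow> H (p v) = v" by metis
  have mem: "H t \<le> v \<longleftrightarrow> q v \<le> t \<and> t \<le> p v" if "v > ?m0" for t v
    using qp(2)[OF that] by (metis atLeastAtMost_iff mem_Collect_eq)
  have "\<exists>m. \<forall>e. v + m * e \<le> H (p v + e) \<and> v - m * e \<le> H (q v + e)" if v: "v > ?m0" for v
  proof -
    have shift: "convex_on UNIV (\<lambda>e. H (s + e) - v)" for s
    proof (rule convex_onI)
      fix t x y :: real assume "0 < t" "t < 1"
      then have "H ((1 - t) *\<^sub>R (s + x) + t *\<^sub>R (s + y)) \<le> (1 - t) * H (s + x) + t * H (s + y)" by (intro convex_onD[OF H]) auto
      then show "H (s + ((1 - t) *\<^sub>R x + t *\<^sub>R y)) - v \<le> (1 - t) * (H (s + x) - v) + t * (H (s + y) - v)"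
        by (simp add: algebra_simps)
    qed simp
    obtain m where "\<And>e. m * e \<le> H (p v + e) - v" "\<And>e. - (m * e) \<le> H (q v + e) - v"
    proof (rule opposite_subgradients[OF shift[of "p v"] _ shift[of "q v"]])
      show "0 \<le> H (p v + e) - v + (H (q v + e) - v)" for e using pair[OF qp(1-4)[OF v], of e] by simp
    qed (use qp(3,4)[OF v] in auto)
    then show ?thesis by (intro exI[of _ m]) (smt (verit))
  qed
  then obtain m where m: "\<And>v e. v > ?m0 \<Longrightarrow> v + m v * e \<le> H (p v + e)" "\<And>v e. v > ?m0 \<Longrightarrow> v - m v * e \<le> H (q v + e)"
    by metis
  have mpos: "m v > 0" if v: "v > ?m0" for v
  proof -
    have "m v * (x0 - p v) < 0" using m(1)[OF v, of "x0 - p v"] v by simp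
    moreover have "x0 - p v \<le> 0" using mem[OF v, of x0] v by simp
    ultimately show ?thesis by (simp add: mult_less_0_iff)
  qed
  have const: "p a + q a = p b + q b" if a: "?m0 < a" and ab: "a \<le> b" for a b
  proof (rule telescoping_constant[where D = "\<lambda>v. p v + q v" and T = UNIV and g = "\<lambda>v. - (1 / m v)", OF ab UNIV_I])
    fix v w assume vw: "a \<le> v" "v \<le> w" "w \<le> b"
    have v: "v > ?m0" and w: "w > ?m0" using a vw by auto
    let ?P = "p w - p v" and ?Q = "q v - q w"
    have "w - v \<ge> m v * ?P" using m(1)[OF v, of ?P] qp(4)[OF w] by simp
    moreover have "w - v \<le> m w * ?P" using m(1)[OF w, of "- ?P"] qp(4)[OF v] by (simp add: algebra_simps)
    moreover have "w - v \<ge> m v * ?Q" using m(2)[OF v, of "- ?Q"] qp(3)[OF w] by (simp add: algebra_simps)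
    moreover have "w - v \<le> m w * ?Q" using m(2)[OF w, of "?Q"] qp(3)[OF v] by (simp add: algebra_simps)
    ultimately have "?P \<le> (w - v) / m v" "(w - v) / m w \<le> ?P" "?Q \<le> (w - v) / m v" "(w - v) / m w \<le> ?Q"
      using mpos[OF v] mpos[OF w] by (simp_all add: field_simps)
    then have "\<bar>?P - ?Q\<bar> \<le> (w - v) / m v - (w - v) / m w" by linarith
    also have "\<dots> = (w - v) * (- (1 / m w) - - (1 / m v))" by (simp add: right_diff_distrib)
    finally show "\<bar>(p w + q w) - (p v + q v)\<bar> \<le> (w - v) * (- (1 / m w) - - (1 / m v))" by (simp add: algebra_simps)
  qed
  let ?c = "p (?m0 + 1) + q (?m0 + 1)"
  have c: "p v + q v = ?c" if "v > ?m0" for v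
  proof (cases "v \<le> ?m0 + 1")
    case False
    then show ?thesis by (intro const[of "?m0 + 1" v, symmetric]) auto
  qed (rule const[OF that])
  have ends: "t = p v \<or> t = q v" if t: "H t = v" and v: "v > ?m0" for t v
  proof (rule ccontr)
    assume "\<not> (t = p v \<or> t = q v)"
    then have tt: "q v < t" "t < p v" using mem[OF v, of t] t by auto
    have "t \<noteq> x0" using t v by auto
    define w where "w = (if x0 < t then p v else q v)"
    have w: "H w = v" "(x0 < t \<and> t < w) \<or> (w < t \<and> t < x0)"
      using qp(3,4)[OF v] tt \<open>t \<noteq> x0\<close> by (auto simp: w_def)
    let ?s = "(t - x0) / (w - x0)"
    have s: "0 < ?s" "?s < 1" and eq: "?s * (w - x0) = t - x0"
      using w(2) by (auto simp: field_simps)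
    have "(1 - r) *\<^sub>R x0 + r *\<^sub>R w = x0 + r * (w - x0)" for r by (simp add: algebra_simps)
    then have "(1 - ?s) *\<^sub>R x0 + ?s *\<^sub>R w = x0 + ?s * (w - x0)" .
    also have "\<dots> = t" using eq by simp
    finally have "H t \<le> (1 - ?s) * H x0 + ?s * H w" using convex_onD[OF H, of ?s x0 w] s by simp
    also have "\<dots> < (1 - ?s) * v + ?s * v" using s v w(1) by simp
    also have "\<dots> = v" by (simp only: distrib_right[symmetric]) simp
    finally show False using t by simp
  qed
  have above: "H (?c - t) = H t" if "H t > ?m0" for t
    using ends[OF refl that] c[OF that] qp(3,4)[OF that] by (metis add_diff_cancel_left' add_diff_cancel_right')
  have "H (?c - t) = H t" for t
  proof (cases "H t > ?m0")
    case False
    then have t: "H t = ?m0" using min[of t] by simp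
    show ?thesis
    proof (rule ccontr)
      assume "H (?c - t) \<noteq> H t"
      then have "H (?c - t) > ?m0" using min[of "?c - t"] t by simp
      from above[OF this] show False using t \<open>H (?c - t) > ?m0\<close> by simp
    qed
  qed (rule above)
  then show ?thesis by (rule that)
qed

section \<open>Equality in the symmetrization inequality\<close>

lemma projection_volume_steiner_axis:
  assumes "norm u = 1"
  shows "projection_volume (steiner u K) u = projection_volume K u"
proof -
  have "sweep (steiner u K) u = sweep K u"
  proof (intro set_eqI iffI)
    fix y assume "y \<in> sweep (steiner u K) u"
    then show "y \<in> sweep K u" by (auto simp: sweep_def steiner_line[OF assms])
  next
    fix y assume "y \<in> sweep K u"
    then obtain t where "y + t *\<^sub>R u \<in> K" by (auto simp: sweep_def)
    then have "y + ((t - t) / 2 - y \<bullet> u) *\<^sub>R u \<in> steiner u K" unfolding steiner_line[OF assms] by blast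
    then show "y \<in> sweep (steiner u K) u" unfolding sweep_def by blast
  qed
  then show ?thesis by (simp add: projection_volume_def)
qed

text \<open>This inclusion, due to Lutwak, Yang and Zhang, is the section-wise width inequality integrated over all parallel planes. The points on the axis need a separate argument,
  because they do not determine a plane.\<close>

lemma steiner_polar_projection_body_subset:
  fixes K :: "(real^'n) set"
  assumes K: "convex_body K" and u: "norm u = 1"
  shows "steiner u (polar_projection_body K) \<subseteq> polar_projection_body (steiner u K)"
proof
  have uu: "u \<bullet> u = 1" using u by (simp add: dot_square_norm)
  note S = steiner_convex_body(1)[OF K u]
  fix z assume "z \<in> steiner u (polar_projection_body K)"
  then obtain b c where bc: "projection_volume K (z + b *\<^sub>R u) \<le> 1" "projection_volume K (z + c *\<^sub>R u) \<le> 1" "z \<bullet> u = (b - c) / 2"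
    by (auto simp: steiner_def polar_projection_body_def)
  let ?s = "z \<bullet> u" let ?\<theta> = "z - ?s *\<^sub>R u"
  have zb: "z + b *\<^sub>R u = ?\<theta> + (?s + b) *\<^sub>R u" "z + c *\<^sub>R u = ?\<theta> + (?s + c) *\<^sub>R u"
    and z: "z = ?\<theta> + (((?s + b) - (?s + c)) / 2) *\<^sub>R u"
    by (simp_all add: scaleR_add_left bc(3))
  show "z \<in> polar_projection_body (steiner u K)"
  proof (cases "?\<theta> = 0")
    case False
    have "projection_volume (steiner u K) z \<le> (projection_volume K (z + b *\<^sub>R u) + projection_volume K (z + c *\<^sub>R u)) / 2"
      using projection_volume_steiner_le[OF K u _ False, of "?s + b" "?s + c"] unfolding zb z[symmetric]
      by (simp add: inner_diff_left uu)
    then show ?thesis using bc by (simp add: polar_projection_body_def)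
  next
    case True
    then have zu: "z = ?s *\<^sub>R u" by simp
    have "\<bar>?s + b\<bar> * projection_volume K u \<le> 1" "\<bar>?s + c\<bar> * projection_volume K u \<le> 1"
      using bc(1,2) unfolding zb True by (simp_all add: projection_volume_scale convex_bodyD(1)[OF K])
    moreover have "?s = ((?s + b) - (?s + c)) / 2" by (simp add: bc(3))
    then have "2 * \<bar>?s\<bar> = \<bar>(?s + b) - (?s + c)\<bar>" by (simp add: bc(3))
    then have "\<bar>?s\<bar> \<le> (\<bar>?s + b\<bar> + \<bar>?s + c\<bar>) / 2" using abs_triangle_ineq4[of "?s + b" "?s + c"] by simp
    then have "\<bar>?s\<bar> * projection_volume K u \<le> (\<bar>?s + b\<bar> + \<bar>?s + c\<bar>) / 2 * projection_volume K u" by (intro mult_right_mono projection_volume_nonneg)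
    ultimately have "\<bar>?s\<bar> * projection_volume K u \<le> 1" by (simp add: distrib_right)
    then have "projection_volume (steiner u K) (?s *\<^sub>R u) \<le> 1"
      by (simp add: projection_volume_scale convex_bodyD(1)[OF S] projection_volume_steiner_axis[OF u])
    then show ?thesis using zu by (simp add: polar_projection_body_def)
  qed
qed

lemma convex_body_eqI:
  fixes A B :: "(real^'n) set"
  assumes A: "convex_body A" and B: "convex_body B" and sub: "A \<subseteq> B" and v: "vol B \<le> vol A"
  shows "A = B"
proof (rule ccontr)
  assume "A \<noteq> B"
  then obtain b where b: "b \<in> B" "b \<notin> A" using sub by blast
  let ?W = "interior B - A"
  have "b \<in> closure (interior B)"
    using b(1) convex_closure_interior[OF convex_bodyD(2,3)[OF B]] closure_subset by blast
  moreover have "open (- A)" "b \<in> - A" using convex_bodyD(4)[OF A] b(2) by auto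
  ultimately have "?W \<noteq> {}" unfolding closure_iff_nhds_not_empty by blast
  moreover have "open ?W" using convex_bodyD(4)[OF A] by (intro open_Diff) auto
  ultimately have "\<not> negligible ?W" by (rule open_not_negligible[rotated])
  moreover have W: "?W \<in> lmeasurable"
    using convex_bodyD(5)[OF B] \<open>open ?W\<close> by (meson Diff_subset bounded_interior bounded_subset lmeasurable_open)
  ultimately have "vol ?W > 0" by (simp add: negligible_iff_measure zero_less_measure_iff)
  moreover have "vol (A \<union> ?W) = vol A + vol ?W"
    using measure_Union[of lebesgue A ?W] fmeasurableD2[OF convex_bodyD(8)[OF A]] fmeasurableD2[OF W] fmeasurableD[OF convex_bodyD(8)[OF A]] fmeasurableD[OF W]
    unfolding infinity_ennreal_def by blast
  moreover have "vol (A \<union> ?W) \<le> vol B"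
    using sub interior_subset[of B] convex_bodyD(8)[OF A] convex_bodyD(8)[OF B] W by (intro measure_mono_fmeasurable) (auto simp: fmeasurableD)
  ultimately show False using v by simp
qed

definition petty_max :: "(real^'n) set \<Rightarrow> bool" where
  "petty_max K \<longleftrightarrow> convex_body K \<and> (\<forall>L :: (real^'n) set. convex_body L \<longrightarrow> petty L \<le> petty K)"

text \<open>Both sides are convex bodies of the same volume, and one contains the other.\<close>

lemma petty_max_steiner:
  fixes K :: "(real^'n) set"
  assumes K: "petty_max K" and u: "norm u = 1"
  shows "polar_projection_body (steiner u K) = steiner u (polar_projection_body K)"
proof -
  have Kb: "convex_body K" using K by (simp add: petty_max_def)
  note S = steiner_convex_body[OF Kb u]
  have "petty (steiner u K) \<le> petty K" using K S(1) by (simp add: petty_max_def)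
  then have "vol (polar_projection_body (steiner u K)) \<le> vol (polar_projection_body K)"
    using vol_convex_body_pos[OF Kb] by (simp add: petty_def S(2) mult_le_cancel_left_pos)
  also have "\<dots> = vol (steiner u (polar_projection_body K))" by (rule steiner_convex_body(2)[OF convex_body_polar_projection_body[OF Kb] u, symmetric])
  finally show ?thesis
    using convex_body_eqI[OF steiner_convex_body(1)[OF convex_body_polar_projection_body[OF Kb] u] convex_body_polar_projection_body[OF S(1)] steiner_polar_projection_body_subset[OF Kb u]]
    by simp
qed

lemma continuous_projection_volume_line:
  assumes "convex_body K"
  shows "continuous_on UNIV (\<lambda>t::real. projection_volume K (x + t *\<^sub>R u))"
  by (rule continuous_on_compose2[OF continuous_projection_volume[OF assms]]) (auto intro!: continuous_intros)

lemma convex_projection_volume_line: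
  assumes "convex_body K"
  shows "convex_on UNIV (\<lambda>t::real. projection_volume K (x + t *\<^sub>R u))"
proof (rule convex_onI)
  fix t a b :: real assume t: "0 < t" "t < 1"
  have "x + ((1 - t) *\<^sub>R a + t *\<^sub>R b) *\<^sub>R u = (1 - t) *\<^sub>R (x + a *\<^sub>R u) + t *\<^sub>R (x + b *\<^sub>R u)"
    by (simp add: algebra_simps)
  then show "projection_volume K (x + ((1 - t) *\<^sub>R a + t *\<^sub>R b) *\<^sub>R u) \<le> (1 - t) * projection_volume K (x + a *\<^sub>R u) + t * projection_volume K (x + b *\<^sub>R u)"
    using convex_onD[OF convex_on_projection_volume[OF assms], of t "x + a *\<^sub>R u" "x + b *\<^sub>R u"] t by simp
qed simp

text \<open>The points \<open>\<theta> / v + (p / v) *\<^sub>R u\<close> and \<open>\<theta> / v + (q / v) *\<^sub>R u\<close> are the ends of a chord of the polar projection body, so the end of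
  its symmetrization is a boundary point of the polar projection body of \<open>steiner u K\<close>.\<close>

lemma petty_max_pair:
  fixes K :: "(real^'n) set"
  assumes K: "petty_max K" and u: "norm u = 1" "\<theta> \<bullet> u = 0" "\<theta> \<noteq> 0"
    and qp: "q \<le> p" "{t. projection_volume K (\<theta> + t *\<^sub>R u) \<le> v} = {q..p}" and Hv: "projection_volume K (\<theta> + q *\<^sub>R u) = v" "projection_volume K (\<theta> + p *\<^sub>R u) = v"
  shows "projection_volume (steiner u K) (\<theta> + ((p - q) / 2) *\<^sub>R u) = v"
proof (rule antisym)
  have Kb: "convex_body K" using K by (simp add: petty_max_def)
  have uu: "u \<bullet> u = 1" using u by (simp add: dot_square_norm)
  note S = steiner_convex_body(1)[OF Kb u(1)]
  show "projection_volume (steiner u K) (\<theta> + ((p - q) / 2) *\<^sub>R u) \<le> v"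
    using projection_volume_steiner_le[OF Kb u, of p q] Hv by simp
  show "v \<le> projection_volume (steiner u K) (\<theta> + ((p - q) / 2) *\<^sub>R u)"
  proof (rule ccontr)
    have ne: "\<theta> + q *\<^sub>R u \<noteq> 0"
    proof
      assume "\<theta> + q *\<^sub>R u = 0"
      then have "(\<theta> + q *\<^sub>R u) \<bullet> \<theta> = 0" by simp
      then show False using u by (simp add: inner_add_left inner_add_right inner_commute)
    qed
    have v: "v > 0" using projection_volume_pos[OF Kb ne] Hv(1) by simp
    let ?g = "\<lambda>t. projection_volume (steiner u K) (\<theta> + t *\<^sub>R u)" and ?m = "(p - q) / 2"
    assume "\<not> v \<le> ?g ?m"
    then have "?g ?m < v" by simp
    moreover have "isCont ?g ?m" using continuous_projection_volume_line[OF S] by (simp add: continuous_on_eq_continuous_at)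
    ultimately have "\<forall>\<^sub>F t in at ?m. ?g t < v" unfolding isCont_def by (intro order_tendstoD)
    then obtain d where d: "d > 0" "\<And>t. t \<noteq> ?m \<Longrightarrow> dist t ?m < d \<Longrightarrow> ?g t < v" unfolding eventually_at by auto
    define m' where "m' = ?m + d / 2"
    have gm': "?g m' < v"
    proof (rule d(2))
      show "m' \<noteq> ?m" using d(1) unfolding m'_def by linarith
      show "dist m' ?m < d" using d(1) unfolding m'_def dist_real_def by simp
    qed
    let ?z = "(1 / v) *\<^sub>R (\<theta> + m' *\<^sub>R u)"
    have "projection_volume (steiner u K) ?z \<le> 1"
      using gm' v by (subst projection_volume_scale[OF convex_bodyD(1)[OF S]]) (simp add: field_simps)
    then have "?z \<in> steiner u (polar_projection_body K)" using petty_max_steiner[OF K u(1)] by (auto simp: polar_projection_body_def)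
    then obtain b c where bc: "projection_volume K (?z + b *\<^sub>R u) \<le> 1" "projection_volume K (?z + c *\<^sub>R u) \<le> 1" "?z \<bullet> u = (b - c) / 2"
      by (auto simp: steiner_def polar_projection_body_def)
    have zu: "?z \<bullet> u = m' / v" using u uu by (simp add: inner_add_left)
    have H: "projection_volume K (\<theta> + (m' + v * a) *\<^sub>R u) \<le> v" if "projection_volume K (?z + a *\<^sub>R u) \<le> 1" for a
    proof -
      have "\<theta> + (m' + v * a) *\<^sub>R u = v *\<^sub>R (?z + a *\<^sub>R u)" using v by (simp add: algebra_simps)
      then have "projection_volume K (\<theta> + (m' + v * a) *\<^sub>R u) = v * projection_volume K (?z + a *\<^sub>R u)"
        using v by (simp only: projection_volume_scale[OF convex_bodyD(1)[OF Kb]] abs_of_pos)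
      also have "\<dots> \<le> v * 1" using that v by (intro mult_left_mono) auto
      finally show ?thesis by simp
    qed
    have "m' + v * b \<in> {q..p}" "m' + v * c \<in> {q..p}" using H[OF bc(1)] H[OF bc(2)] by (simp_all only: qp(2)[symmetric] mem_Collect_eq)
    then have "v * b - v * c \<le> p - q" by auto
    moreover have "m' / v = (b - c) / 2" using bc(3) unfolding zu .
    then have "v * b - v * c = 2 * m'" using v by (simp add: field_simps)
    moreover have "2 * m' = (p - q) + d" unfolding m'_def by (simp add: distrib_left)
    ultimately show False using d(1) by simp
  qed
qed

lemma projection_volume_coercive:
  fixes K :: "(real^'n) set"
  assumes K: "convex_body K"
  obtains \<kappa> where "\<kappa> > 0" "\<And>x. \<kappa> * norm x \<le> projection_volume K x"
proof -
  obtain R where R: "R > 0" "K \<subseteq> cball 0 R" using bounded_subset_cball_pos[OF convex_bodyD(5)[OF K]] by blast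
  have "vol K / (3 * R) * norm x \<le> projection_volume K x" for x
    using projection_volume_lower_bound[OF convex_bodyD(1)[OF K] R(2,1), of x] R(1) by (simp add: field_simps)
  moreover have "vol K / (3 * R) > 0" using vol_convex_body_pos[OF K] R(1) by simp
  ultimately show ?thesis using that by blast
qed

lemma petty_max_symmetric:
  fixes K :: "(real^'n) set"
  assumes K: "petty_max K" and u: "norm u = 1" "\<theta> \<bullet> u = 0" "\<theta> \<noteq> 0"
  obtains c where "\<And>t. projection_volume K (\<theta> + (c - t) *\<^sub>R u) = projection_volume K (\<theta> + t *\<^sub>R u)"
proof -
  have Kb: "convex_body K" using K by (simp add: petty_max_def)
  have uu: "u \<bullet> u = 1" using u by (simp add: dot_square_norm)
  obtain \<kappa> where \<kappa>: "\<kappa> > 0" "\<And>x. \<kappa> * norm x \<le> projection_volume K x" using projection_volume_coercive[OF Kb] by metis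
  let ?H = "\<lambda>t. projection_volume K (\<theta> + t *\<^sub>R u)"
  have low: "\<kappa> * \<bar>t\<bar> - 0 \<le> ?H t" for t
  proof -
    have "\<bar>(\<theta> + t *\<^sub>R u) \<bullet> u\<bar> \<le> norm (\<theta> + t *\<^sub>R u) * norm u" by (rule Cauchy_Schwarz_ineq2)
    then have "\<bar>t\<bar> \<le> norm (\<theta> + t *\<^sub>R u)" using u uu by (simp add: inner_add_left)
    then have "\<kappa> * \<bar>t\<bar> \<le> \<kappa> * norm (\<theta> + t *\<^sub>R u)" using \<kappa>(1) by (intro mult_left_mono) auto
    then show ?thesis using \<kappa>(2)[of "\<theta> + t *\<^sub>R u"] by simp
  qed
  show ?thesis
  proof (rule reflection_symmetry[of ?H \<kappa> 0])
    show "convex_on UNIV ?H" by (rule convex_projection_volume_line[OF Kb])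
    show "2 * v \<le> ?H (p + e) + ?H (q + e)" if "q \<le> p" "{t. ?H t \<le> v} = {q..p}" "?H q = v" "?H p = v" for p q e v
      using petty_max_pair[OF K u that] projection_volume_steiner_le[OF Kb u, of "p + e" "q + e"] by simp
  qed (use \<kappa> low that in auto)
qed

section \<open>The polar projection body of a maximizer has no segments in its boundary\<close>

text \<open>In the plane of \<open>y\<close> and \<open>w\<close>, the point \<open>e\<close> of the ball \<open>h x \<le> h y\<close> that is farthest from the origin is an extreme point. The symmetry
  along the direction \<open>y - f\<close>, where \<open>f\<close> is \<open>e\<close> or \<open>- e\<close>, is a linear isometry of \<open>h\<close> on this plane which exchanges \<open>y\<close> and \<open>f\<close>, provided
  that \<open>y\<close> and \<open>f\<close> are the only two points of norm \<open>h y\<close> on their line. So \<open>y\<close> is an extreme point as well. The proviso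
  fails for both signs only if the ball is the parallelogram with vertices \<open>y\<close>, \<open>- y\<close>, \<open>e\<close> and \<open>- e\<close>, and then \<open>y\<close> is extreme anyway.\<close>

lemma no_boundary_segment:
  fixes h :: "'a::euclidean_space \<Rightarrow> real"
  assumes tri: "\<And>x y. h (x + y) \<le> h x + h y" and scale: "\<And>s x. h (s *\<^sub>R x) = \<bar>s\<bar> * h x"
    and cont: "continuous_on UNIV h" and \<kappa>: "\<kappa> > 0" "\<And>x. \<kappa> * norm x \<le> h x"
    and sym: "\<And>u \<theta>. norm u = 1 \<Longrightarrow> \<theta> \<bullet> u = 0 \<Longrightarrow> \<theta> \<noteq> 0 \<Longrightarrow> \<exists>c. \<forall>t. h (\<theta> + (c - t) *\<^sub>R u) = h (\<theta> + t *\<^sub>R u)"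
    and flat: "h (y + w) \<le> h y" "h (y - w) \<le> h y"
  shows "w = 0"
proof (rule ccontr)
  assume w0: "w \<noteq> 0"
  have even: "h (- x) = h x" for x using scale[of "-1" x] by simp
  have pos: "h x > 0" if "x \<noteq> 0" for x
  proof -
    have "\<kappa> * norm x > 0" using that \<kappa>(1) by simp
    then show ?thesis using \<kappa>(2)[of x] by linarith
  qed
  have y0: "y \<noteq> 0"
  proof
    assume "y = 0"
    then have "h w \<le> 0" using flat(1) scale[of 0 0] by simp
    then show False using pos[OF w0] by simp
  qed
  let ?v = "h y"
  have v: "?v > 0" by (rule pos[OF y0])
  have par: False if "w = s *\<^sub>R y" for s
  proof -
    have e: "y + w = (1 + s) *\<^sub>R y" "y - w = (1 - s) *\<^sub>R y" by (simp_all add: that algebra_simps)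
    have "\<bar>1 + s\<bar> * ?v \<le> 1 * ?v" "\<bar>1 - s\<bar> * ?v \<le> 1 * ?v" using flat unfolding e scale by simp_all
    then have "\<bar>1 + s\<bar> \<le> 1" "\<bar>1 - s\<bar> \<le> 1" using v mult_right_le_imp_le[of _ ?v 1] by blast+
    then have "s = 0" by linarith
    then show False using w0 that by simp
  qed
  let ?E = "span {y, w}"
  have yE: "y \<in> ?E" and wE: "w \<in> ?E" by (auto intro: span_base)
  let ?S = "?E \<inter> {x. h x \<le> ?v}"
  have "bounded {x. h x \<le> ?v}"
  proof -
    have "norm x \<le> ?v / \<kappa>" if "h x \<le> ?v" for x using \<kappa>(2)[of x] that \<kappa>(1) by (simp add: field_simps)
    then show ?thesis by (auto simp: bounded_iff)
  qed
  moreover have "closed {x. h x \<le> ?v}" using closed_Collect_le[OF cont continuous_on_const[of UNIV ?v]] by simp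
  ultimately have "compact ?S"
    by (intro closed_Int_compact closed_subspace subspace_span) (simp add: compact_eq_bounded_closed)
  moreover have "?S \<noteq> {}" using yE by auto
  moreover have "continuous_on ?S norm" by (intro continuous_intros)
  ultimately obtain e where e: "e \<in> ?S" "\<And>x. x \<in> ?S \<Longrightarrow> norm x \<le> norm e"
    using continuous_attains_sup[of ?S norm] by blast
  have ext0: "z = 0" if z: "z \<in> ?E" "h (e + z) \<le> ?v" "h (e - z) \<le> ?v" for z
  proof -
    have "e + z \<in> ?S" "e - z \<in> ?S" using z e(1) by (auto intro: span_add span_diff)
    then have "(norm (e + z))\<^sup>2 \<le> (norm e)\<^sup>2" "(norm (e - z))\<^sup>2 \<le> (norm e)\<^sup>2" using e(2) by (auto intro!: power_mono)
    moreover have "(norm (e + z))\<^sup>2 + (norm (e - z))\<^sup>2 = 2 * (norm e)\<^sup>2 + 2 * (norm z)\<^sup>2"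
      by (simp add: power2_norm_eq_inner inner_add_left inner_add_right inner_diff_left inner_diff_right inner_commute)
    ultimately have "(norm z)\<^sup>2 \<le> 0" by linarith
    then show "z = 0" by simp
  qed
  have e0: "e \<noteq> 0" using e(2)[of y] yE y0 by auto
  have ev: "h e = ?v"
  proof (rule ccontr)
    assume "h e \<noteq> ?v"
    then have lt: "h e < ?v" using e(1) by auto
    have "(?v / h e) *\<^sub>R e \<in> ?S" using e(1) pos[OF e0] v by (auto simp: scale intro: span_scale)
    then have "\<bar>?v / h e\<bar> * norm e \<le> norm e" using e(2)[of "(?v / h e) *\<^sub>R e"] by simp
    then have "\<bar>?v / h e\<bar> * norm e \<le> 1 * norm e" by simp
    then have "\<bar>?v / h e\<bar> \<le> 1" using e0 mult_right_le_imp_le[of _ "norm e" 1] zero_less_norm_iff by blast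
    then show False using lt pos[OF e0] v by (simp add: field_simps)
  qed
  have indep: "y \<noteq> s *\<^sub>R e" for s
  proof
    assume ys: "y = s *\<^sub>R e"
    then have "?v = \<bar>s\<bar> * ?v" using scale[of s e] ev by simp
    then have "\<bar>s\<bar> = 1" using v by simp
    then consider "y = e" | "y = - e" using ys by (cases "s \<ge> 0") auto
    then show False
    proof cases
      case 1
      then show False using ext0[OF wE] flat w0 by simp
    next
      case 2
      have "e + w = - (y - w)" "e - w = - (y + w)" by (simp_all add: 2)
      then have "h (e + w) = h (y - w)" "h (e - w) = h (y + w)" by (simp_all only: even)
      then show False using ext0[OF wE] flat w0 by simp
    qed
  qed
  have wcomb: "\<exists>a b. w = a *\<^sub>R y + b *\<^sub>R e"
  proof -
    obtain a where "e - a *\<^sub>R y \<in> span {w}" using e(1) by (auto simp: span_insert)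
    then obtain b where b: "e - a *\<^sub>R y = b *\<^sub>R w" by (auto simp: span_singleton)
    have "b \<noteq> 0"
    proof
      assume "b = 0"
      then have "e = a *\<^sub>R y" using b by simp
      moreover from this have "a \<noteq> 0" using e0 by auto
      ultimately have "y = (1 / a) *\<^sub>R e" by simp
      then show False using indep by blast
    qed
    then have "w = (1 / b) *\<^sub>R (e - a *\<^sub>R y)" using b by simp
    then have "w = (- a / b) *\<^sub>R y + (1 / b) *\<^sub>R e" by (simp add: algebra_simps)
    then show ?thesis by blast
  qed
  have proper: "h (y + e) < 2 * ?v \<or> h (y - e) < 2 * ?v"
  proof (rule ccontr)
    assume "\<not> (h (y + e) < 2 * ?v \<or> h (y - e) < 2 * ?v)"
    then have big: "h (y + e) \<ge> 2 * ?v" "h (y - e) \<ge> 2 * ?v" by auto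
    have lower: "h (s *\<^sub>R y + t *\<^sub>R e) \<ge> ?v * (s + \<bar>t\<bar>)" if st: "\<bar>t\<bar> \<le> s" for s t
    proof -
      define \<sigma> :: real where "\<sigma> = (if t \<ge> 0 then 1 else -1)"
      have "s * (2 * ?v) \<le> h (s *\<^sub>R (y + \<sigma> *\<^sub>R e))"
        using big st v unfolding scale \<sigma>_def by (auto intro!: mult_mono)
      also have "s *\<^sub>R (y + \<sigma> *\<^sub>R e) = (s *\<^sub>R y + t *\<^sub>R e) + (s * \<sigma> - t) *\<^sub>R e" by (simp add: algebra_simps)
      also have "h \<dots> \<le> h (s *\<^sub>R y + t *\<^sub>R e) + \<bar>s * \<sigma> - t\<bar> * h e" using tri scale by metis
      also have "\<bar>s * \<sigma> - t\<bar> = s - \<bar>t\<bar>" using st by (auto simp: \<sigma>_def)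
      finally show ?thesis by (simp add: ev algebra_simps)
    qed
    obtain a b where ab: "w = a *\<^sub>R y + b *\<^sub>R e" using wcomb by blast
    \<comment> \<open>Small enough for \<open>y + k *\<^sub>R w\<close> and \<open>y - k *\<^sub>R w\<close> to have their larger coefficient at \<open>y\<close>.\<close>
    define k where "k = 1 / (2 * (1 + \<bar>a\<bar> + \<bar>b\<bar>))"
    have k: "k > 0" "k \<le> 1" "k * \<bar>a\<bar> \<le> 1 / 2" "k * \<bar>b\<bar> \<le> 1 / 2" by (auto simp: k_def field_simps)
    have ka: "\<bar>k * a\<bar> \<le> 1 / 2" "\<bar>k * b\<bar> \<le> 1 / 2" using k by (simp_all add: abs_mult)
    have small: "h (y + s *\<^sub>R w) \<le> ?v" if "h (y + r *\<^sub>R w) \<le> ?v" "s = k * r" for s r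
    proof -
      have "y + s *\<^sub>R w = (1 - k) *\<^sub>R y + k *\<^sub>R (y + r *\<^sub>R w)" by (simp add: that(2) algebra_simps)
      then have "h (y + s *\<^sub>R w) \<le> (1 - k) * ?v + k * h (y + r *\<^sub>R w)"
        using tri[of "(1 - k) *\<^sub>R y" "k *\<^sub>R (y + r *\<^sub>R w)"] k by (simp add: scale)
      also have "\<dots> \<le> (1 - k) * ?v + k * ?v" using that(1) k by (intro add_mono mult_left_mono) auto
      finally show ?thesis by (simp add: algebra_simps)
    qed
    have b1: "\<bar>k * b\<bar> \<le> 1 + k * a" using ka abs_ge_minus_self[of "k * a"] by simp
    have b2: "\<bar>- (k * b)\<bar> \<le> 1 - k * a" using ka abs_ge_self[of "k * a"] by simp
    have "y + k *\<^sub>R w = (1 + k * a) *\<^sub>R y + (k * b) *\<^sub>R e" "y + (- k) *\<^sub>R w = (1 - k * a) *\<^sub>R y + (- (k * b)) *\<^sub>R e"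
      by (simp_all add: ab algebra_simps)
    then have "?v * (1 + k * a + \<bar>k * b\<bar>) \<le> h (y + k *\<^sub>R w)" "?v * (1 - k * a + \<bar>k * b\<bar>) \<le> h (y + (- k) *\<^sub>R w)"
      using lower[OF b1] lower[OF b2] by simp_all
    moreover have "h (y + k *\<^sub>R w) \<le> ?v" "h (y + (- k) *\<^sub>R w) \<le> ?v" using small[of 1 k] small[of "-1" "- k"] flat by simp_all
    ultimately have "?v * (1 + k * a + \<bar>k * b\<bar>) \<le> ?v * 1" "?v * (1 - k * a + \<bar>k * b\<bar>) \<le> ?v * 1" by linarith+
    then have "1 + k * a + \<bar>k * b\<bar> \<le> 1" "1 - k * a + \<bar>k * b\<bar> \<le> 1" using v by (simp_all only: mult_le_cancel_left_pos)
    then have "\<bar>k * b\<bar> \<le> 0" by linarith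
    then have "b = 0" using k(1) by simp
    then show False using par[of a] ab by simp
  qed
  have "\<exists>f. (f = e \<or> f = - e) \<and> h (y + f) < 2 * ?v" using proper by (metis diff_conv_add_uminus)
  then obtain f where f: "f = e \<or> f = - e" "h (y + f) < 2 * ?v" by blast
  have fv: "h f = ?v" using f(1) ev even by auto
  have indf: "y \<noteq> s *\<^sub>R f" for s using f(1) indep[of s] indep[of "- s"] by auto
  have fE: "f \<in> ?E" using f(1) e(1) by (auto intro: span_neg)
  have extf: "z = 0" if z: "z \<in> ?E" "h (f + z) \<le> ?v" "h (f - z) \<le> ?v" for z
  proof (cases "f = e")
    case False
    then have "f = - e" using f(1) by simp
    then have "e + z = - (f - z)" "e - z = - (f + z)" by simp_all
    then have "h (e + z) = h (f - z)" "h (e - z) = h (f + z)" by (simp_all only: even)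
    then show ?thesis using ext0 z by simp
  qed (use ext0 z in simp)
  let ?d = "y - f"
  have d0: "?d \<noteq> 0" using indf[of 1] by auto
  define u where "u = ?d /\<^sub>R norm ?d"
  have u: "norm u = 1" using d0 by (simp add: u_def)
  have uu: "u \<bullet> u = 1" using u by (simp add: dot_square_norm)
  have du: "?d = norm ?d *\<^sub>R u" using d0 by (simp add: u_def)
  define t1 where "t1 = f \<bullet> u"
  define t2 where "t2 = t1 + norm ?d"
  define \<theta> where "\<theta> = f - t1 *\<^sub>R u"
  have f_eq: "f = \<theta> + t1 *\<^sub>R u" by (simp add: \<theta>_def)
  have y_eq: "y = \<theta> + t2 *\<^sub>R u" using du by (simp add: \<theta>_def t2_def algebra_simps)
  have t12: "t1 < t2" using d0 by (simp add: t2_def)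
  have \<theta>u: "\<theta> \<bullet> u = 0" by (simp add: \<theta>_def t1_def inner_diff_left uu)
  have \<theta>0: "\<theta> \<noteq> 0"
  proof
    assume "\<theta> = 0"
    then have fy: "f = t1 *\<^sub>R u" "y = t2 *\<^sub>R u" using f_eq y_eq by simp_all
    have "t1 \<noteq> 0" using fy(1) fv v scale[of 0 0] by auto
    then have "y = (t2 / t1) *\<^sub>R f" using fy by simp
    then show False using indf by blast
  qed
  obtain c where c: "\<And>t. h (\<theta> + (c - t) *\<^sub>R u) = h (\<theta> + t *\<^sub>R u)" using sym[OF u \<theta>u \<theta>0] by blast
  let ?H = "\<lambda>t. h (\<theta> + t *\<^sub>R u)"
  have H12: "?H t1 = ?v" "?H t2 = ?v" using fv f_eq y_eq by simp_all
  have Hmid: "?H ((t1 + t2) / 2) < ?v"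
  proof -
    have "\<theta> + ((t1 + t2) / 2) *\<^sub>R u = (1 / 2) *\<^sub>R (y + f)"
    proof -
      have "y + f = 2 *\<^sub>R \<theta> + (t1 + t2) *\<^sub>R u" unfolding scaleR_2 by (subst f_eq, subst y_eq) (simp add: algebra_simps)
      then show ?thesis by (simp add: scaleR_add_right)
    qed
    then show ?thesis using f(2) scale[of "1/2" "y + f"] by simp
  qed
  have Hconv: "?H ((1 - s) * a + s * b) \<le> (1 - s) * ?H a + s * ?H b" if "0 \<le> s" "s \<le> 1" for s a b
  proof -
    have "\<theta> + ((1 - s) * a + s * b) *\<^sub>R u = (1 - s) *\<^sub>R (\<theta> + a *\<^sub>R u) + s *\<^sub>R (\<theta> + b *\<^sub>R u)" by (simp add: algebra_simps)
    then show ?thesis using tri[of "(1 - s) *\<^sub>R (\<theta> + a *\<^sub>R u)" "s *\<^sub>R (\<theta> + b *\<^sub>R u)"] that by (simp add: scale)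
  qed
  have between: "?H t < ?v \<or> ?v < ?H t" if "t \<noteq> t1" "t \<noteq> t2" for t
  proof -
    let ?\<mu> = "(t1 + t2) / 2"
    have in1: "?H s < ?v" if st: "r * (s - ?\<mu>) = r' - ?\<mu>" "r > 1" "?H r' \<le> ?v" for s r r'
    proof -
      have "s = (1 - 1 / r) * ?\<mu> + (1 / r) * r'"
        using st(1,2) by (simp add: field_simps)
      then have "?H s \<le> (1 - 1 / r) * ?H ?\<mu> + (1 / r) * ?H r'" using Hconv[of "1 / r" ?\<mu> r'] st(2) by simp
      also have "\<dots> < (1 - 1 / r) * ?v + (1 / r) * ?v" using Hmid st(2,3)
        by (intro add_less_le_mono mult_strict_left_mono mult_left_mono) auto
      also have "\<dots> = ?v" by (simp only: distrib_right[symmetric]) simp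
      finally show ?thesis .
    qed
    show ?thesis
    proof (cases "t = ?\<mu>")
      case True
      show ?thesis using Hmid unfolding True by blast
    next
      case False
      let ?t = "if t > ?\<mu> then t2 else t1"
      let ?r = "(?t - ?\<mu>) / (t - ?\<mu>)"
      have rpos: "?r > 0" "?r \<noteq> 1" using False t12 that by (auto simp: field_simps)
      have r: "?r * (t - ?\<mu>) = ?t - ?\<mu>" using False by simp
      show ?thesis
      proof (cases "?r > 1")
        case True
        have "?H ?t \<le> ?v" using H12 by simp
        then show ?thesis using in1[OF r True] by blast
      next
        case f: False
        have inv: "1 / a > 1" if "0 < a" "a \<noteq> 1" "\<not> a > 1" for a :: real using that by (simp add: field_simps)
        have swap: "(1 / a) * B = A" if "a * A = B" "a > 0" for a A B :: real using that by (simp add: field_simps)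
        have r1: "1 / ?r > 1" by (rule inv[OF rpos f])
        have "(1 / ?r) * (?t - ?\<mu>) = t - ?\<mu>" by (rule swap[OF r rpos(1)])
        then have "?H t \<le> ?v \<Longrightarrow> ?H ?t < ?v" using in1[OF _ r1] by blast
        then show ?thesis using H12 by (auto simp: not_less split: if_splits)
      qed
    qed
  qed
  have "c - t1 = t2"
  proof (rule ccontr)
    assume ne: "c - t1 \<noteq> t2"
    have "?H (c - t1) = ?v" "?H (c - t2) = ?v" using c H12 by simp_all
    then have "c - t1 = t1" "c - t2 = t1 \<or> c - t2 = t2" using between[of "c - t1"] between[of "c - t2"] ne by auto
    then show False using t12 ne by auto
  qed
  then have c12: "c = t1 + t2" by simp
  have refl: "h (l *\<^sub>R \<theta> + (c * l - s) *\<^sub>R u) = h (l *\<^sub>R \<theta> + s *\<^sub>R u)" for l s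
  proof (cases "l = 0")
    case True
    then show ?thesis using even[of "s *\<^sub>R u"] by simp
  next
    case False
    have "l *\<^sub>R \<theta> + (c * l - s) *\<^sub>R u = l *\<^sub>R (\<theta> + (c - s / l) *\<^sub>R u)" "l *\<^sub>R \<theta> + s *\<^sub>R u = l *\<^sub>R (\<theta> + (s / l) *\<^sub>R u)"
      using False by (simp_all add: algebra_simps)
    then show ?thesis using c[of "s / l"] by (simp only: scale)
  qed
  obtain a b where ab: "w = a *\<^sub>R y + b *\<^sub>R e" using wcomb by blast
  have "\<exists>l s. w = l *\<^sub>R \<theta> + s *\<^sub>R u"
  proof -
    obtain b' where "w = a *\<^sub>R y + b' *\<^sub>R f" using f(1) ab by (metis scaleR_minus_left scaleR_minus_right minus_minus)
    then have "w = (a + b') *\<^sub>R \<theta> + (a * t2 + b' * t1) *\<^sub>R u" by (subst (asm) f_eq, subst (asm) y_eq) (simp add: algebra_simps)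
    then show ?thesis by blast
  qed
  then obtain l s where ls: "w = l *\<^sub>R \<theta> + s *\<^sub>R u" by blast
  let ?w = "l *\<^sub>R \<theta> + (c * l - s) *\<^sub>R u"
  have uE: "u \<in> ?E" unfolding u_def using yE fE by (intro span_scale span_diff)
  have \<theta>E: "\<theta> \<in> ?E" unfolding \<theta>_def using uE fE by (intro span_scale span_diff)
  have "?w \<in> ?E" using uE \<theta>E by (intro span_add span_scale)
  moreover have "h (f + ?w) \<le> ?v"
  proof -
    have "f + ?w = (1 + l) *\<^sub>R \<theta> + (c * (1 + l) - (t2 + s)) *\<^sub>R u" by (subst f_eq) (simp add: c12 algebra_simps)
    moreover have "y + w = (1 + l) *\<^sub>R \<theta> + (t2 + s) *\<^sub>R u" unfolding ls by (subst y_eq) (simp add: algebra_simps)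
    ultimately show ?thesis using refl[of "1 + l" "t2 + s"] flat(1) by simp
  qed
  moreover have "h (f - ?w) \<le> ?v"
  proof -
    have "f - ?w = (1 - l) *\<^sub>R \<theta> + (c * (1 - l) - (t2 - s)) *\<^sub>R u" by (subst f_eq) (simp add: c12 algebra_simps)
    moreover have "y - w = (1 - l) *\<^sub>R \<theta> + (t2 - s) *\<^sub>R u" unfolding ls by (subst y_eq) (simp add: algebra_simps)
    ultimately show ?thesis using refl[of "1 - l" "t2 - s"] flat(2) by simp
  qed
  ultimately have w': "?w = 0" by (rule extf)
  then have "?w \<bullet> \<theta> = 0" by simp
  then have "l = 0" using \<theta>u \<theta>0 by (simp add: inner_add_left inner_add_right inner_commute)
  then have "s *\<^sub>R u = 0" using w' by simp
  then show False using ls \<open>l = 0\<close> w0 by simp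
qed

text \<open>Without a segment parallel to \<open>u\<close> in the boundary of the unit ball, the function has a strict minimum at \<open>c / 2\<close>; convexity and symmetry then determine all sublevel sets.\<close>

lemma petty_max_sublevel:
  fixes K :: "(real^'n) set"
  assumes K: "petty_max K" and u: "norm u = 1" "\<theta> \<bullet> u = 0" "\<theta> \<noteq> 0"
    and c: "\<And>t. projection_volume K (\<theta> + (c - t) *\<^sub>R u) = projection_volume K (\<theta> + t *\<^sub>R u)" and ct: "c / 2 \<le> t"
  shows "{s. projection_volume K (\<theta> + s *\<^sub>R u) \<le> projection_volume K (\<theta> + t *\<^sub>R u)} = {c - t..t}"
proof -
  have Kb: "convex_body K" using K by (simp add: petty_max_def)
  note Kc = convex_bodyD(1)[OF Kb]
  let ?H = "\<lambda>t. projection_volume K (\<theta> + t *\<^sub>R u)"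
  have Hconv: "?H ((1 - r) * a + r * b) \<le> (1 - r) * ?H a + r * ?H b" if "0 \<le> r" "r \<le> 1" for r a b
    using convex_onD[OF convex_projection_volume_line[OF Kb, of \<theta> u], of r a b] that by simp
  have inside: "?H s \<le> ?H t" if s: "s \<in> {c - t..t}" for s t
  proof (cases "t = c - t")
    case False
    let ?r = "(s - (c - t)) / (t - (c - t))"
    have r: "0 \<le> ?r" "?r \<le> 1" using s False by (auto simp: field_simps)
    have eq: "?r * (t - (c - t)) = s - (c - t)" using False by simp
    have "(1 - r) * (c - t) + r * t = (c - t) + r * (t - (c - t))" for r by (simp add: algebra_simps)
    then have "(1 - ?r) * (c - t) + ?r * t = (c - t) + ?r * (t - (c - t))" .
    also have "\<dots> = s" unfolding eq by simp
    finally have "?H s \<le> (1 - ?r) * ?H (c - t) + ?r * ?H t" using Hconv[OF r, of "c - t" t] by simp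
    also have "\<dots> = ?H t" unfolding c by (simp only: distrib_right[symmetric]) simp
    finally show ?thesis .
  qed (use s in auto)
  have noflat: "c / 2 \<le> s \<Longrightarrow> s \<le> t" if le: "?H s \<le> ?H t" for s
  proof (rule ccontr)
    assume cs: "c / 2 \<le> s" and st: "\<not> s \<le> t"
    have Hts: "?H t = ?H s" using inside[of t s] ct cs st le by auto
    have small: "?H s \<le> ?H (c / 2)"
    proof -
      let ?r = "(t - c / 2) / (s - c / 2)"
      have r: "0 \<le> ?r" "?r < 1" using ct st by (auto simp: field_simps)
      have eq: "?r * (s - c / 2) = t - c / 2" using st ct by simp
      have "(1 - r) * (c / 2) + r * s = c / 2 + r * (s - c / 2)" for r by (simp add: field_simps)
      then have "(1 - ?r) * (c / 2) + ?r * s = c / 2 + ?r * (s - c / 2)" .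
      also have "\<dots> = t" unfolding eq by simp
      finally have "?H t \<le> (1 - ?r) * ?H (c / 2) + ?r * ?H s" using Hconv[of ?r "c / 2" s] r by simp
      moreover have "(1 - ?r) * ?H s + ?r * ?H s = ?H s" by (simp only: distrib_right[symmetric]) simp
      ultimately have "(1 - ?r) * ?H s \<le> (1 - ?r) * ?H (c / 2)" using Hts by linarith
      moreover have "1 - ?r > 0" using r by simp
      ultimately show ?thesis by (simp only: mult_le_cancel_left_pos)
    qed
    let ?y = "\<theta> + (c / 2) *\<^sub>R u" and ?w = "(s - c / 2) *\<^sub>R u"
    obtain \<kappa> where \<kappa>: "\<kappa> > 0" "\<And>x. \<kappa> * norm x \<le> projection_volume K x" using projection_volume_coercive[OF Kb] by metis
    have "?y + ?w = \<theta> + (c / 2 + (s - c / 2)) *\<^sub>R u" "?y - ?w = \<theta> + (c / 2 - (s - c / 2)) *\<^sub>R u"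
      by (simp_all only: scaleR_add_left scaleR_diff_left add.assoc add_diff_eq)
    moreover have "c / 2 + (s - c / 2) = s" "c / 2 - (s - c / 2) = c - s" by (simp_all add: field_simps)
    ultimately have e1: "?y + ?w = \<theta> + s *\<^sub>R u" and e2: "?y - ?w = \<theta> + (c - s) *\<^sub>R u"
      by (simp_all only:)
    have "?w = 0"
    proof (rule no_boundary_segment[of "projection_volume K" \<kappa> ?y])
      show "\<exists>c. \<forall>t. projection_volume K (\<theta>' + (c - t) *\<^sub>R u') = projection_volume K (\<theta>' + t *\<^sub>R u')" if "norm u' = 1" "\<theta>' \<bullet> u' = 0" "\<theta>' \<noteq> 0" for u' \<theta>'
        using petty_max_symmetric[OF K that] by metis
      show "projection_volume K (?y + ?w) \<le> projection_volume K ?y" unfolding e1 by (rule small)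
      show "projection_volume K (?y - ?w) \<le> projection_volume K ?y" unfolding e2 c by (rule small)
    qed (use projection_volume_triangle[OF Kb] projection_volume_scale[OF Kc] continuous_projection_volume[OF Kb] \<kappa> in auto)
    then show False using cs st ct u(1) by auto
  qed
  show ?thesis
  proof (intro set_eqI iffI)
    fix s assume s: "s \<in> {s. ?H s \<le> ?H t}"
    show "s \<in> {c - t..t}"
    proof (cases "c / 2 \<le> s")
      case True
      then show ?thesis using noflat[of s] s ct by auto
    next
      case False
      then have "c - s \<le> t" using noflat[of "c - s"] s c[of s] by simp
      then show ?thesis using False ct by auto
    qed
  qed (use inside in auto)
qed

lemma petty_max_steiner_width:
  fixes K :: "(real^'n) set"
  assumes K: "petty_max K" and u: "norm u = 1" "\<theta> \<bullet> u = 0" "\<theta> \<noteq> 0"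
    and c: "\<And>t. projection_volume K (\<theta> + (c - t) *\<^sub>R u) = projection_volume K (\<theta> + t *\<^sub>R u)"
  shows "AE y in lborel. y \<in> cell \<theta> u \<longrightarrow> plane_section K \<theta> u y \<noteq> {} \<longrightarrow> opposite_touching (plane_section K \<theta> u y) t (c - t)"
proof -
  have Kb: "convex_body K" using K by (simp add: petty_max_def)
  note Kc = convex_bodyD(1,2)[OF Kb]
  note S = steiner_convex_body(1)[OF Kb u(1)]
  note Sc = convex_bodyD(1,2)[OF S]
  have main: "AE y in lborel. y \<in> cell \<theta> u \<longrightarrow> plane_section K \<theta> u y \<noteq> {} \<longrightarrow>
      opposite_touching (plane_section K \<theta> u y) t (c - t) \<and> opposite_touching (plane_section K \<theta> u y) (c - t) t" if t: "c / 2 \<le> t" for t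
  proof -
    have "projection_volume (steiner u K) (\<theta> + ((t - (c - t)) / 2) *\<^sub>R u) = projection_volume K (\<theta> + t *\<^sub>R u)"
      using t c[of t] petty_max_sublevel[OF K u c t] by (intro petty_max_pair[OF K u]) auto
    then have "projection_volume (steiner u K) (\<theta> + ((t - (c - t)) / 2) *\<^sub>R u) = (projection_volume K (\<theta> + t *\<^sub>R u) + projection_volume K (\<theta> + (c - t) *\<^sub>R u)) / 2"
      using c[of t] by simp
    from projection_volume_steiner_eq_AE[OF Kb u this] show ?thesis
    proof eventually_elim
      case (elim y)
      show ?case
        using elim section_width_steiner_eq[OF plane_section_compact_convex[OF Kc u] plane_section_compact_convex[OF Sc u] plane_section_steiner[OF u(1,2)], of y t "c - t"] by blast
    qed
  qed
  show ?thesis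
  proof (cases "c / 2 \<le> t")
    case True
    from main[OF this] show ?thesis by eventually_elim blast
  next
    case False
    then have "c / 2 \<le> c - t" by simp
    from main[OF this] show ?thesis by eventually_elim simp
  qed
qed

section \<open>Affine reflections of a maximizer\<close>

text \<open>A separating line may be tilted a little, because \<open>L\<close> is bounded. So it can be taken non-vertical and with slope in a given dense set.\<close>

lemma separating_slope:
  fixes L :: "(real \<times> real) set"
  assumes L: "compact L" "convex L" and z: "z \<notin> L"
  obtains \<eta> t0 r :: real where "\<eta> \<noteq> 0" "r > 0"
    "\<And>t x. \<bar>t - t0\<bar> < r \<Longrightarrow> x \<in> L \<Longrightarrow> \<eta> * (snd z - fst z * t) < \<eta> * (snd x - fst x * t)"
proof -
  obtain a b where ab: "a \<bullet> z < b" "\<And>x. x \<in> L \<Longrightarrow> a \<bullet> x > b"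
    using separating_hyperplane_closed_point[OF L(2) compact_imp_closed[OF L(1)] z] by blast
  obtain M where M: "M > 0" "\<And>x. x \<in> L \<Longrightarrow> norm x \<le> M"
    using compact_imp_bounded[OF L(1)] by (auto simp: bounded_pos)
  define B where "B = M + norm z"
  have B: "B > 0" using M(1) by (simp add: B_def add_pos_nonneg)
  have Bx: "\<bar>fst x - fst z\<bar> \<le> B" "\<bar>snd x - snd z\<bar> \<le> B" if "x \<in> L" for x
  proof -
    have "dist x z \<le> B" using norm_triangle_ineq4[of x z] M(2)[OF that] by (simp add: B_def dist_norm)
    then show "\<bar>fst x - fst z\<bar> \<le> B" "\<bar>snd x - snd z\<bar> \<le> B"
      using dist_fst_le[of x z] dist_snd_le[of x z] by (simp_all add: dist_real_def)
  qed
  define g where "g = b - a \<bullet> z"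
  have g: "g > 0" "\<And>x. x \<in> L \<Longrightarrow> a \<bullet> (x - z) > g" using ab by (auto simp: g_def inner_diff_right)
  \<comment> \<open>A vertical separating line is tilted by an amount that uses up at most half of the gap \<open>g\<close>.\<close>
  define \<eta> where "\<eta> = (if snd a = 0 then g / (2 * B) else snd a)"
  have \<eta>: "\<eta> \<noteq> 0" "\<bar>\<eta> - snd a\<bar> \<le> g / (2 * B)" using g(1) B by (auto simp: \<eta>_def)
  define t0 where "t0 = - fst a / \<eta>"
  define r where "r = g / (2 * B) / \<bar>\<eta>\<bar>"
  have r: "r > 0" using g(1) B \<eta> by (simp add: r_def)
  have "\<eta> * (snd z - fst z * t) < \<eta> * (snd x - fst x * t)" if t: "\<bar>t - t0\<bar> < r" and x: "x \<in> L" for t x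
  proof -
    let ?d1 = "fst x - fst z" and ?d2 = "snd x - snd z"
    have "\<eta> * t + fst a = \<eta> * (t - t0)" using \<eta>(1) by (simp add: t0_def field_simps)
    then have "\<bar>\<eta> * t + fst a\<bar> = \<bar>\<eta>\<bar> * \<bar>t - t0\<bar>" by (simp only: abs_mult)
    also have "\<dots> < \<bar>\<eta>\<bar> * r" using t \<eta>(1) by (intro mult_strict_left_mono) auto
    also have "\<dots> = g / (2 * B)" using \<eta>(1) by (simp add: r_def)
    finally have e1: "\<bar>\<eta> * t + fst a\<bar> \<le> g / (2 * B)" by simp
    have "\<bar>(\<eta> * t + fst a) * ?d1\<bar> \<le> g / (2 * B) * B" unfolding abs_mult using e1 Bx(1)[OF x] B g(1) by (intro mult_mono) auto
    then have d1: "\<bar>(\<eta> * t + fst a) * ?d1\<bar> \<le> g / 2" using B by simp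
    have "\<bar>(\<eta> - snd a) * ?d2\<bar> \<le> g / (2 * B) * B" unfolding abs_mult using \<eta>(2) Bx(2)[OF x] B g(1) by (intro mult_mono) auto
    then have d2: "\<bar>(\<eta> - snd a) * ?d2\<bar> \<le> g / 2" using B by simp
    have "\<eta> * (snd x - fst x * t) - \<eta> * (snd z - fst z * t) = a \<bullet> (x - z) + (\<eta> - snd a) * ?d2 - (\<eta> * t + fst a) * ?d1"
      by (simp add: inner_prod_def algebra_simps)
    then show ?thesis using g(2)[OF x] d1 d2 by (simp only: abs_le_iff) linarith
  qed
  then show ?thesis using that[OF \<eta>(1) r] by blast
qed

text \<open>Let \<open>?B t\<close> be the height of the upper supporting line of slope \<open>t\<close> and \<open>- ?A t\<close> that of the lower one of slope \<open>c - t\<close>. Both functions are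
  convex in \<open>t\<close>, and \<open>- \<alpha> t\<close> is a common subgradient; so they differ by a constant \<open>k\<close>. This says that \<open>L\<close> and its image under
  \<open>(\<alpha>, \<beta>) \<mapsto> (\<alpha>, c * \<alpha> + k - \<beta>)\<close> have the same supporting lines.\<close>

lemma reflection_of_touching:
  fixes L :: "(real \<times> real) set"
  assumes L: "compact L" "convex L" "L \<noteq> {}" and touch: "\<And>t. t \<in> \<rat> \<Longrightarrow> opposite_touching L t (c - t)"
  shows "\<exists>k. \<forall>\<alpha> \<beta>. (\<alpha>, \<beta>) \<in> L \<longrightarrow> (\<alpha>, c * \<alpha> + k - \<beta>) \<in> L"
proof -
  have "\<exists>\<alpha> \<beta> \<gamma>. (\<alpha>, \<beta>) \<in> L \<and> (\<alpha>, \<gamma>) \<in> L \<and> (\<forall>z\<in>L. snd z - fst z * t \<le> \<beta> - \<alpha> * t) \<and>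
     (\<forall>z\<in>L. \<gamma> - \<alpha> * (c - t) \<le> snd z - fst z * (c - t))" if "t \<in> \<rat>" for t
    using touch[OF that] by (simp add: opposite_touching_def)
  then obtain \<alpha> \<beta> \<gamma> where w: "\<And>t. t \<in> \<rat> \<Longrightarrow> (\<alpha> t, \<beta> t) \<in> L" "\<And>t. t \<in> \<rat> \<Longrightarrow> (\<alpha> t, \<gamma> t) \<in> L"
     "\<And>t z. t \<in> \<rat> \<Longrightarrow> z \<in> L \<Longrightarrow> snd z - fst z * t \<le> \<beta> t - \<alpha> t * t"
     "\<And>t z. t \<in> \<rat> \<Longrightarrow> z \<in> L \<Longrightarrow> \<gamma> t - \<alpha> t * (c - t) \<le> snd z - fst z * (c - t)" by metis
  let ?B = "\<lambda>t. \<beta> t - \<alpha> t * t" and ?A = "\<lambda>t. \<alpha> t * (c - t) - \<gamma> t"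
  have const: "?B a - ?A a = ?B b - ?A b" if ab: "a \<in> \<rat>" "b \<in> \<rat>" "a \<le> b" for a b
  proof (rule telescoping_constant[where D = "\<lambda>t. ?B t - ?A t" and T = "\<rat>" and g = "\<lambda>t. - \<alpha> t", OF ab(3)])
    show "a + real i * ((b - a) / real N) \<in> \<rat>" for i N using ab by simp
    fix x y :: real assume x: "x \<in> \<rat>" and y: "y \<in> \<rat>" and xy: "x \<le> y"
    have "\<beta> x - \<alpha> x * y \<le> ?B y" using w(3)[OF y w(1)[OF x]] by simp
    moreover have "\<beta> y - \<alpha> y * x \<le> ?B x" using w(3)[OF x w(1)[OF y]] by simp
    moreover have "\<alpha> x * (c - y) - \<gamma> x \<le> ?A y" using w(4)[OF y w(2)[OF x]] by simp
    moreover have "\<alpha> y * (c - x) - \<gamma> y \<le> ?A x" using w(4)[OF x w(2)[OF y]] by simp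
    ultimately show "\<bar>?B y - ?A y - (?B x - ?A x)\<bar> \<le> (y - x) * (- \<alpha> y - - \<alpha> x)"
      by (simp add: abs_le_iff algebra_simps)
  qed
  define k where "k = ?B 0 - ?A 0"
  have k: "?B t = ?A t + k" if "t \<in> \<rat>" for t
  proof (cases "0 \<le> t")
    case True
    then show ?thesis using const[of 0 t] that by (simp add: k_def)
  next
    case False
    then show ?thesis using const[of t 0] that by (simp add: k_def)
  qed
  have "(p, c * p + k - s) \<in> L" if ps: "(p, s) \<in> L" for p s
  proof (rule ccontr)
    assume "(p, c * p + k - s) \<notin> L"
    from separating_slope[OF L(1,2) this] obtain \<eta> t0 r where sep: "\<eta> \<noteq> 0" "r > 0"
      "\<And>t x. \<bar>t - t0\<bar> < r \<Longrightarrow> x \<in> L \<Longrightarrow> \<eta> * (c * p + k - s - p * t) < \<eta> * (snd x - fst x * t)"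
      by (metis fst_conv snd_conv)
    show False
    proof (cases "\<eta> > 0")
      case True
      obtain q where q: "q \<in> \<rat>" "c - t0 - r < q" "q < c - t0 + r"
        using Rats_dense_in_real[of "c - t0 - r" "c - t0 + r"] sep(2) by auto
      have "\<eta> * (c * p + k - s - p * (c - q)) < \<eta> * (\<gamma> q - \<alpha> q * (c - q))"
        using sep(3)[of "c - q" "(\<alpha> q, \<gamma> q)"] q w(2)[OF q(1)] by (simp add: abs_less_iff)
      then have "c * p + k - s - p * (c - q) < \<gamma> q - \<alpha> q * (c - q)" using True by simp
      moreover have "s - p * q \<le> ?B q" using w(3)[OF q(1) ps] by simp
      ultimately show False using k[OF q(1)] by (simp add: algebra_simps)
    next
      case False
      then have neg: "\<eta> < 0" using sep(1) by simp
      obtain q where q: "q \<in> \<rat>" "t0 - r < q" "q < t0 + r"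
        using Rats_dense_in_real[of "t0 - r" "t0 + r"] sep(2) by auto
      have "\<eta> * (c * p + k - s - p * q) < \<eta> * (\<beta> q - \<alpha> q * q)"
        using sep(3)[of q "(\<alpha> q, \<beta> q)"] q w(1)[OF q(1)] by (simp add: abs_less_iff)
      then have "c * p + k - s - p * q > \<beta> q - \<alpha> q * q" using neg by simp
      moreover have "\<gamma> q - \<alpha> q * (c - q) \<le> s - p * (c - q)" using w(4)[OF q(1) ps] by simp
      ultimately show False using k[OF q(1)] by (simp add: algebra_simps)
    qed
  qed
  then show ?thesis by blast
qed

lemma AE_lborel_dense:
  fixes U :: "'a::euclidean_space set"
  assumes "AE y in lborel. P y" "open U" "U \<noteq> {}"
  obtains y where "y \<in> U" "P y"
proof -
  obtain N where N: "{x \<in> space lborel. \<not> P x} \<subseteq> N" "N \<in> null_sets lborel" using assms(1) unfolding eventually_ae_filter by blast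
  have "\<not> U \<subseteq> N"
  proof
    assume "U \<subseteq> N"
    then have "negligible U" using N(2)
      by (meson negligible_iff_null_sets negligible_subset null_sets_completionI)
    then show False using open_not_negligible[OF assms(2,3)] by simp
  qed
  then show ?thesis using N(1) that by auto
qed

text \<open>Twice the parameter of the midpoint of the chord through \<open>x\<close> in direction \<open>u\<close>.\<close>

definition chord_sum :: "'a::euclidean_space set \<Rightarrow> 'a \<Rightarrow> 'a \<Rightarrow> real" where
  "chord_sum K u x = Sup {t. x + t *\<^sub>R u \<in> K} + Inf {t. x + t *\<^sub>R u \<in> K}"

lemma chord_sum_eqI:
  fixes K :: "'a::euclidean_space set"
  assumes K: "compact K" and u: "u \<noteq> 0" and x: "x + s *\<^sub>R u \<in> K"
    and refl: "\<And>t. x + t *\<^sub>R u \<in> K \<Longrightarrow> x + (k - t) *\<^sub>R u \<in> K"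
  shows "chord_sum K u x = k"
proof -
  let ?C = "{t. x + t *\<^sub>R u \<in> K}"
  have C: "compact ?C" by (rule compact_line_section[OF K u])
  have ne: "?C \<noteq> {}" using x by auto
  note bd = bounded_imp_bdd_above[OF compact_imp_bounded[OF C]] bounded_imp_bdd_below[OF compact_imp_bounded[OF C]]
  have S: "Sup ?C \<in> ?C" "Inf ?C \<in> ?C"
    using closed_contains_Sup[OF ne bd(1) compact_imp_closed[OF C]] closed_contains_Inf[OF ne bd(2) compact_imp_closed[OF C]] by auto
  have "k - Sup ?C \<in> ?C" "k - Inf ?C \<in> ?C" using refl S by auto
  then have "Inf ?C \<le> k - Sup ?C" "k - Inf ?C \<le> Sup ?C" using cInf_lower[OF _ bd(2)] cSup_upper[OF _ bd(1)] by blast+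
  then show ?thesis by (simp add: chord_sum_def)
qed

lemma chord_sum_reflect:
  fixes K :: "'a::euclidean_space set"
  assumes K: "compact K" "convex K" and u: "u \<noteq> 0" and x: "x + t *\<^sub>R u \<in> K"
  shows "x + (chord_sum K u x - t) *\<^sub>R u \<in> K"
proof -
  let ?C = "{t. x + t *\<^sub>R u \<in> K}"
  have C: "compact ?C" "convex ?C" "?C \<noteq> {}" using compact_line_section[OF K(1) u] convex_line_section[OF K(2)] x by auto
  obtain a b where ab: "a \<le> b" "?C = {a..b}" using compact_convex_real[OF C] .
  have "chord_sum K u x = b + a" unfolding chord_sum_def ab(2) using ab(1) by simp
  moreover have "t \<in> {a..b}" using x unfolding ab(2)[symmetric] by simp
  ultimately have "chord_sum K u x - t \<in> {a..b}" by simp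
  then show ?thesis unfolding ab(2)[symmetric] by simp
qed

text \<open>The section of \<open>K\<close> by the plane through \<open>y\<close> is invariant under the affine reflection that reverses \<open>u\<close> and
  maps \<open>\<theta>\<close> to \<open>\<theta> + c *\<^sub>R u\<close>; the number \<open>k\<close> fixes the axis.\<close>

definition reflects :: "'a::euclidean_space set \<Rightarrow> 'a \<Rightarrow> 'a \<Rightarrow> real \<Rightarrow> 'a \<Rightarrow> real \<Rightarrow> bool" where
  "reflects K \<theta> u c y k \<longleftrightarrow> (\<forall>\<alpha> \<beta>. y + \<alpha> *\<^sub>R \<theta> + \<beta> *\<^sub>R u \<in> K \<longrightarrow> y + \<alpha> *\<^sub>R \<theta> + (c * \<alpha> + k - \<beta>) *\<^sub>R u \<in> K)"

lemma reflects_shift: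
  assumes "reflects K \<theta> u c y k"
  shows "reflects K \<theta> u c (y + s *\<^sub>R \<theta> + \<tau> *\<^sub>R u) (k + c * s - 2 * \<tau>)"
  unfolding reflects_def
proof (intro allI impI)
  fix a b assume "y + s *\<^sub>R \<theta> + \<tau> *\<^sub>R u + a *\<^sub>R \<theta> + b *\<^sub>R u \<in> K"
  then have "y + (s + a) *\<^sub>R \<theta> + (\<tau> + b) *\<^sub>R u \<in> K" by (simp add: algebra_simps)
  then have "y + (s + a) *\<^sub>R \<theta> + (c * (s + a) + k - (\<tau> + b)) *\<^sub>R u \<in> K" using assms unfolding reflects_def by blast
  moreover have "y + (s + a) *\<^sub>R \<theta> + (c * (s + a) + k - (\<tau> + b)) *\<^sub>R u =
    y + s *\<^sub>R \<theta> + \<tau> *\<^sub>R u + a *\<^sub>R \<theta> + (c * a + (k + c * s - 2 * \<tau>) - b) *\<^sub>R u"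
  proof -
    have "y + (s + a) *\<^sub>R \<theta> + (\<tau> + C) *\<^sub>R u = y + s *\<^sub>R \<theta> + \<tau> *\<^sub>R u + a *\<^sub>R \<theta> + C *\<^sub>R u" for C
      by (simp add: algebra_simps)
    moreover have "c * (s + a) + k - (\<tau> + b) = \<tau> + (c * a + (k + c * s - 2 * \<tau>) - b)" by (simp add: algebra_simps)
    ultimately show ?thesis by (simp only:)
  qed
  ultimately show "y + s *\<^sub>R \<theta> + \<tau> *\<^sub>R u + a *\<^sub>R \<theta> + (c * a + (k + c * s - 2 * \<tau>) - b) *\<^sub>R u \<in> K" by simp
qed

text \<open>The constants \<open>k\<close> stay bounded because \<open>K\<close> is bounded. Points of the section in the interior of \<open>K\<close> can be moved to the nearby
  planes without leaving \<open>K\<close>; the remaining ones are limits of such points.\<close>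

lemma reflects_limit:
  fixes K :: "'a::euclidean_space set"
  assumes K: "compact K" "convex K" and u: "u \<noteq> 0" and x: "x \<in> interior K"
    and dense: "\<And>e. e > 0 \<Longrightarrow> \<exists>y k. dist y x < e \<and> reflects K \<theta> u c y k"
  shows "\<exists>k. reflects K \<theta> u c x k"
proof -
  have "\<exists>y k. dist y x < 1 / real (Suc n) \<and> reflects K \<theta> u c y k" for n by (rule dense) simp
  then obtain y k where yk: "\<And>n. dist (y n) x < 1 / real (Suc n)" "\<And>n. reflects K \<theta> u c (y n) (k n)" by metis
  have ylim: "y \<longlonglongrightarrow> x"
  proof (rule LIMSEQ_I)
    fix r :: real assume "r > 0"
    then obtain N where N: "1 / real (Suc N) < r" using nat_approx_posE by blast
    have "norm (y n - x) < r" if "n \<ge> N" for n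
    proof -
      have "1 / real (Suc n) \<le> 1 / real (Suc N)" using that by (intro divide_left_mono) auto
      then show ?thesis using yk(1)[of n] N by (simp add: dist_norm)
    qed
    then show "\<exists>N. \<forall>n\<ge>N. norm (y n - x) < r" by blast
  qed
  have evK: "\<forall>\<^sub>F n in sequentially. y n \<in> interior K"
    using topological_tendstoD[OF ylim open_interior x] .
  obtain R where R: "\<And>z. z \<in> K \<Longrightarrow> norm z \<le> R" using compact_imp_bounded[OF K(1)] by (auto simp: bounded_iff)
  have kb: "\<bar>k n\<bar> \<le> 2 * R / norm u" if "y n \<in> interior K" for n
  proof -
    have yK: "y n \<in> K" using that interior_subset by blast
    then have "y n + 0 *\<^sub>R \<theta> + (c * 0 + k n - 0) *\<^sub>R u \<in> K" using yk(2)[of n] unfolding reflects_def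
      by (metis add.right_neutral scaleR_zero_left)
    then have "norm (y n + k n *\<^sub>R u) \<le> R" using R by simp
    moreover have "norm (k n *\<^sub>R u) \<le> norm (y n + k n *\<^sub>R u) + norm (y n)" by (metis add.commute add_diff_cancel_left' norm_triangle_ineq4)
    ultimately have "\<bar>k n\<bar> * norm u \<le> 2 * R" using R[OF yK] by simp
    then show ?thesis using u by (simp add: field_simps)
  qed
  obtain N where N: "\<And>n. n \<ge> N \<Longrightarrow> y n \<in> interior K" using evK by (auto simp: eventually_sequentially)
  have "bounded (range (\<lambda>n. k (n + N)))"
    unfolding bounded_iff using kb N by (intro exI[of _ "2 * R / norm u"]) auto
  then obtain k0 r where r: "strict_mono (r :: nat \<Rightarrow> nat)" "((\<lambda>n. k (n + N)) \<circ> r) \<longlonglongrightarrow> k0"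
    using bounded_imp_convergent_subsequence by blast
  have klim: "(\<lambda>n. k (r n + N)) \<longlonglongrightarrow> k0" using r(2) by (simp add: o_def)
  have "strict_mono (\<lambda>n. r n + N)" using r(1) by (simp add: strict_mono_def)
  then have ylim': "(\<lambda>n. y (r n + N)) \<longlonglongrightarrow> x" using LIMSEQ_subseq_LIMSEQ[OF ylim] by (simp add: o_def)
  have inner: "x + a *\<^sub>R \<theta> + (c * a + k0 - b) *\<^sub>R u \<in> K" if z: "x + a *\<^sub>R \<theta> + b *\<^sub>R u \<in> interior K" for a b
  proof -
    have "(\<lambda>n. y (r n + N) + a *\<^sub>R \<theta> + b *\<^sub>R u) \<longlonglongrightarrow> x + a *\<^sub>R \<theta> + b *\<^sub>R u" by (intro tendsto_intros ylim')
    from topological_tendstoD[OF this open_interior z]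
    have "\<forall>\<^sub>F n in sequentially. y (r n + N) + a *\<^sub>R \<theta> + (c * a + k (r n + N) - b) *\<^sub>R u \<in> K"
    proof eventually_elim
      case (elim n)
      then have "y (r n + N) + a *\<^sub>R \<theta> + b *\<^sub>R u \<in> K" using interior_subset by blast
      then show ?case using yk(2)[of "r n + N"] unfolding reflects_def by blast
    qed
    moreover have "(\<lambda>n. y (r n + N) + a *\<^sub>R \<theta> + (c * a + k (r n + N) - b) *\<^sub>R u) \<longlonglongrightarrow> x + a *\<^sub>R \<theta> + (c * a + k0 - b) *\<^sub>R u"
      by (intro tendsto_intros ylim' klim)
    ultimately show ?thesis by (rule Lim_in_closed_set[OF compact_imp_closed[OF K(1)] _ trivial_limit_sequentially])
  qed
  have "x + a *\<^sub>R \<theta> + (c * a + k0 - b) *\<^sub>R u \<in> K" if z: "x + a *\<^sub>R \<theta> + b *\<^sub>R u \<in> K" for a b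
  proof -
    let ?s = "\<lambda>n. 1 - 1 / real (Suc (Suc n))"
    have sl: "?s \<longlonglongrightarrow> 1"
    proof -
      have "(\<lambda>n. 1 - inverse (real (Suc (Suc n)))) \<longlonglongrightarrow> 1 - 0"
        by (intro tendsto_intros LIMSEQ_Suc[OF LIMSEQ_inverse_real_of_nat])
      then show ?thesis by (simp add: inverse_eq_divide)
    qed
    have "x + (?s n * a) *\<^sub>R \<theta> + (c * (?s n * a) + k0 - ?s n * b) *\<^sub>R u \<in> K" for n
    proof (rule inner)
      have s01: "0 < 1 / real (Suc (Suc n))" "1 / real (Suc (Suc n)) \<le> 1" by simp_all
      have "x + (?s n * a) *\<^sub>R \<theta> + (?s n * b) *\<^sub>R u = (x + a *\<^sub>R \<theta> + b *\<^sub>R u) - (1 / real (Suc (Suc n))) *\<^sub>R ((x + a *\<^sub>R \<theta> + b *\<^sub>R u) - x)"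
        by (simp add: algebra_simps)
      also have "\<dots> \<in> interior K" by (rule mem_interior_convex_shrink[OF K(2) x z s01])
      finally show "x + (?s n * a) *\<^sub>R \<theta> + (?s n * b) *\<^sub>R u \<in> interior K" .
    qed
    moreover have "(\<lambda>n. x + (?s n * a) *\<^sub>R \<theta> + (c * (?s n * a) + k0 - ?s n * b) *\<^sub>R u) \<longlonglongrightarrow> x + (1 * a) *\<^sub>R \<theta> + (c * (1 * a) + k0 - 1 * b) *\<^sub>R u"
      by (intro tendsto_intros sl)
    ultimately have "x + (1 * a) *\<^sub>R \<theta> + (c * (1 * a) + k0 - 1 * b) *\<^sub>R u \<in> K"
      by (rule closed_sequentially[OF compact_imp_closed[OF K(1)]])
    then show ?thesis by simp
  qed
  then show ?thesis unfolding reflects_def by blast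
qed

text \<open>The reflection is available for almost every plane, hence for planes arbitrarily close to a given one. The slope
  \<open>c\<close> is the same for all planes, since it comes from the polar projection body.\<close>

lemma petty_max_reflects:
  fixes K :: "(real^'n) set"
  assumes K: "petty_max K" and u: "norm u = 1" "\<theta> \<bullet> u = 0" "\<theta> \<noteq> 0"
  shows "\<exists>c. \<forall>x\<in>interior K. \<exists>k. reflects K \<theta> u c x k"
proof -
  have Kb: "convex_body K" using K by (simp add: petty_max_def)
  note Kc = convex_bodyD(1,2)[OF Kb]
  have uu: "u \<bullet> u = 1" using u by (simp add: dot_square_norm)
  obtain c where c: "\<And>t. projection_volume K (\<theta> + (c - t) *\<^sub>R u) = projection_volume K (\<theta> + t *\<^sub>R u)" using petty_max_symmetric[OF K u] by blast
  \<comment> \<open>Countably many slopes, so that one null set serves for all of them.\<close>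
  have "AE y in lborel. \<forall>t\<in>\<rat>. y \<in> cell \<theta> u \<longrightarrow> plane_section K \<theta> u y \<noteq> {} \<longrightarrow> opposite_touching (plane_section K \<theta> u y) t (c - t)"
    using petty_max_steiner_width[OF K u c] by (subst AE_ball_countable) (auto intro: countable_rat)
  then have ae: "AE y in lborel. y \<in> cell \<theta> u \<longrightarrow> (\<exists>k. reflects K \<theta> u c y k)"
  proof eventually_elim
    case (elim y)
    show ?case
    proof
      assume y: "y \<in> cell \<theta> u"
      show "\<exists>k. reflects K \<theta> u c y k"
      proof (cases "plane_section K \<theta> u y = {}")
        case True
        then show ?thesis by (auto simp: reflects_def plane_section_def)
      next
        case False
        then show ?thesis using reflection_of_touching[OF plane_section_compact_convex[OF Kc u] False, of c] elim y
          by (simp add: reflects_def plane_section_def)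
      qed
    qed
  qed
  have "\<exists>k. reflects K \<theta> u c x k" if x: "x \<in> interior K" for x
  proof (rule reflects_limit[OF Kc _ x])
    show "u \<noteq> 0" using u by auto
    fix e :: real assume e: "e > 0"
    \<comment> \<open>Within its plane, \<open>x\<close> can be moved to the middle of the cell.\<close>
    define s where "s = 1 / 2 - (x \<bullet> \<theta>) / (\<theta> \<bullet> \<theta>)"
    define \<tau> where "\<tau> = 1 / 2 - x \<bullet> u"
    define x' where "x' = x + s *\<^sub>R \<theta> + \<tau> *\<^sub>R u"
    let ?V = "{y. 0 < y \<bullet> \<theta>} \<inter> {y. y \<bullet> \<theta> < \<theta> \<bullet> \<theta>} \<inter> {y. 0 < y \<bullet> u} \<inter> {y. y \<bullet> u < 1}"
    have "open ?V" by (intro open_Int open_Collect_less continuous_intros)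
    moreover have "x' \<in> ?V"
    proof -
      have tt: "\<theta> \<bullet> \<theta> > 0" using u by simp
      have "x' \<bullet> \<theta> = (\<theta> \<bullet> \<theta>) / 2"
        using u by (simp add: x'_def s_def inner_add_left inner_commute[of u] left_diff_distrib)
      then have "0 < x' \<bullet> \<theta>" "x' \<bullet> \<theta> < \<theta> \<bullet> \<theta>" using tt by linarith+
      moreover have "x' \<bullet> u = 1 / 2" using u uu by (simp add: x'_def \<tau>_def inner_add_left)
      ultimately show ?thesis by simp
    qed
    moreover have "x' \<in> ball x' e" using e by simp
    ultimately have V: "open (ball x' e \<inter> ?V)" and ne: "ball x' e \<inter> ?V \<noteq> {}" by (blast intro: open_Int open_ball)+
    from AE_lborel_dense[OF ae V ne] obtain y where y: "y \<in> ball x' e \<inter> ?V" "y \<in> cell \<theta> u \<longrightarrow> (\<exists>k. reflects K \<theta> u c y k)" .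
    then have "y \<in> cell \<theta> u" by (auto simp: cell_def)
    with y(2) obtain k where k: "reflects K \<theta> u c y k" by blast
    have "reflects K \<theta> u c (y + (- s) *\<^sub>R \<theta> + (- \<tau>) *\<^sub>R u) (k + c * (- s) - 2 * (- \<tau>))" by (rule reflects_shift[OF k])
    moreover have "dist (y + (- s) *\<^sub>R \<theta> + (- \<tau>) *\<^sub>R u) x < e"
    proof -
      have d: "y + (- s) *\<^sub>R \<theta> + (- \<tau>) *\<^sub>R u - x = y - x'" by (simp add: x'_def)
      show ?thesis unfolding dist_norm d using y(1) by (simp add: dist_norm norm_minus_commute)
    qed
    ultimately show "\<exists>y k. dist y x < e \<and> reflects K \<theta> u c y k" by blast
  qed
  then show ?thesis by blast
qed

lemma petty_max_chord_sum:
  fixes K :: "(real^'n) set"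
  assumes K: "petty_max K" and u: "norm u = 1"
  shows "\<exists>c. \<forall>x\<in>interior K. \<forall>s. x + s *\<^sub>R w \<in> interior K \<longrightarrow> chord_sum K u (x + s *\<^sub>R w) = chord_sum K u x + c * s"
proof -
  have Kb: "convex_body K" using K by (simp add: petty_max_def)
  note Kc = convex_bodyD(1,2)[OF Kb]
  have u0: "u \<noteq> 0" using u by auto
  have uu: "u \<bullet> u = 1" using u by (simp add: dot_square_norm)
  define \<tau> where "\<tau> = w \<bullet> u"
  define \<theta> where "\<theta> = w - \<tau> *\<^sub>R u"
  have w: "w = \<theta> + \<tau> *\<^sub>R u" by (simp add: \<theta>_def)
  have \<theta>u: "\<theta> \<bullet> u = 0" by (simp add: \<theta>_def \<tau>_def inner_diff_left uu)
  obtain c where c: "\<And>x. x \<in> interior K \<Longrightarrow> \<exists>k. reflects K \<theta> u c x k"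
  proof (cases "\<theta> = 0")
    case True
    have "\<exists>k. reflects K \<theta> u 0 x k" for x
      using chord_sum_reflect[OF Kc u0] unfolding reflects_def True by (intro exI[of _ "chord_sum K u x"]) simp
    then show ?thesis using that by blast
  qed (use petty_max_reflects[OF K u \<theta>u] that in blast)
  have "chord_sum K u (x + s *\<^sub>R w) = chord_sum K u x + (c - 2 * \<tau>) * s"
    if x: "x \<in> interior K" and xs: "x + s *\<^sub>R w \<in> interior K" for x s
  proof -
    obtain k where k: "reflects K \<theta> u c x k" using c[OF x] by blast
    have eq: "chord_sum K u y = j" if r: "reflects K \<theta> u c y j" and y: "y \<in> interior K" for y j
    proof (rule chord_sum_eqI[OF Kc(1) u0])
      show "y + 0 *\<^sub>R u \<in> K" using y interior_subset by auto
      fix t assume "y + t *\<^sub>R u \<in> K"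
      then have "y + 0 *\<^sub>R \<theta> + t *\<^sub>R u \<in> K" by simp
      then have "y + 0 *\<^sub>R \<theta> + (c * 0 + j - t) *\<^sub>R u \<in> K" using r unfolding reflects_def by blast
      then show "y + (j - t) *\<^sub>R u \<in> K" by simp
    qed
    have "x + s *\<^sub>R w = x + s *\<^sub>R \<theta> + (s * \<tau>) *\<^sub>R u" by (simp add: w algebra_simps)
    then have "reflects K \<theta> u c (x + s *\<^sub>R w) (k + c * s - 2 * (s * \<tau>))" using reflects_shift[OF k, of s "s * \<tau>"] by (simp only:)
    then show ?thesis using eq[OF k x] eq[OF _ xs] by (simp add: algebra_simps)
  qed
  then show ?thesis by blast
qed

lemma affine_on_interior:
  fixes G :: "'a::euclidean_space set" and f :: "'a \<Rightarrow> real"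
  assumes G: "open G" "G \<noteq> {}"
    and f: "\<And>w. \<exists>c. \<forall>x\<in>G. \<forall>s. x + s *\<^sub>R w \<in> G \<longrightarrow> f (x + s *\<^sub>R w) = f x + c * s"
  obtains l where "linear l" "\<And>x y. x \<in> G \<Longrightarrow> y \<in> G \<Longrightarrow> f y = f x + l (y - x)"
proof -
  obtain l where l: "\<And>w x s. x \<in> G \<Longrightarrow> x + s *\<^sub>R w \<in> G \<Longrightarrow> f (x + s *\<^sub>R w) = f x + l w * s"
    using f by metis
  obtain x0 where x0: "x0 \<in> G" using G(2) by blast
  obtain r where r: "r > 0" "ball x0 r \<subseteq> G" using G(1) x0 by (auto simp: open_contains_ball)
  have small: "\<exists>s>0. x0 + s *\<^sub>R v \<in> G \<and> x0 + s *\<^sub>R w \<in> G" for v w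
  proof (intro exI[of _ "r / (2 * (norm v + norm w + 1))"] conjI)
    let ?s = "r / (2 * (norm v + norm w + 1))"
    show s: "?s > 0" using r(1) by (simp add: add_nonneg_pos)
    have "norm (?s *\<^sub>R z) < r" if "norm z \<le> norm v + norm w" for z :: 'a
    proof -
      have "?s * norm z \<le> ?s * (norm v + norm w + 1)" using s that by (intro mult_left_mono) auto
      also have "\<dots> = r / 2" using add_nonneg_pos[of "norm v + norm w" 1] by (simp add: field_simps)
      also have "\<dots> < r" using r(1) by simp
      finally show ?thesis using s r(1) by simp
    qed
    then show "x0 + ?s *\<^sub>R v \<in> G" "x0 + ?s *\<^sub>R w \<in> G" using r(2) by (auto simp: subset_iff dist_norm)
  qed
  have "linear l"
  proof (rule linearI)
    fix v w :: 'a and a :: real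
    obtain s where s: "s > 0" "x0 + s *\<^sub>R v \<in> G" "x0 + s *\<^sub>R (v + w) \<in> G" using small[of v "v + w"] by blast
    have "f (x0 + s *\<^sub>R v + s *\<^sub>R w) = f (x0 + s *\<^sub>R v) + l w * s"
      using s by (intro l) (simp_all add: algebra_simps)
    moreover have "f (x0 + s *\<^sub>R (v + w)) = f x0 + l (v + w) * s" "f (x0 + s *\<^sub>R v) = f x0 + l v * s"
      using s x0 by (auto intro: l)
    moreover have "x0 + s *\<^sub>R v + s *\<^sub>R w = x0 + s *\<^sub>R (v + w)" by (simp add: algebra_simps)
    ultimately have "l (v + w) * s = (l v + l w) * s" by (simp add: algebra_simps)
    then show "l (v + w) = l v + l w" using s(1) by simp
    obtain s where s: "s > 0" "x0 + s *\<^sub>R (a *\<^sub>R v) \<in> G" using small[of "a *\<^sub>R v" 0] by blast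
    have "f (x0 + s *\<^sub>R (a *\<^sub>R v)) = f x0 + l (a *\<^sub>R v) * s" using s x0 by (intro l) auto
    moreover have "f (x0 + (s * a) *\<^sub>R v) = f x0 + l v * (s * a)" using s x0 by (intro l) auto
    moreover have "x0 + s *\<^sub>R (a *\<^sub>R v) = x0 + (s * a) *\<^sub>R v" by simp
    ultimately have "l (a *\<^sub>R v) * s = l v * (s * a)" by (metis add_left_cancel)
    then have "l (a *\<^sub>R v) * s = (a * l v) * s" by (simp only: mult_ac)
    moreover have "s \<noteq> 0" using s(1) by simp
    ultimately have "l (a *\<^sub>R v) = a * l v" using mult_right_cancel[of s "l (a *\<^sub>R v)" "a * l v"] by blast
    then show "l (a *\<^sub>R v) = a *\<^sub>R l v" by simp
  qed
  moreover have "f y = f x + l (y - x)" if "x \<in> G" "y \<in> G" for x y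
    using l[of x 1 "y - x"] that by simp
  ultimately show ?thesis by (rule that)
qed

text \<open>The midpoint function changes along every line with a rate that depends on the direction only, so it is affine.\<close>

lemma petty_max_affine_reflection:
  fixes K :: "(real^'n) set"
  assumes K: "petty_max K" and u: "norm u = 1"
  obtains l k where "linear l" "l u = -2" "\<And>x. x \<in> K \<Longrightarrow> x + (l x + k) *\<^sub>R u \<in> K"
proof -
  have Kb: "convex_body K" using K by (simp add: petty_max_def)
  note Kc = convex_bodyD(1,2)[OF Kb]
  have u0: "u \<noteq> 0" using u by auto
  let ?f = "chord_sum K u"
  obtain l where l: "linear l" "\<And>x y. x \<in> interior K \<Longrightarrow> y \<in> interior K \<Longrightarrow> ?f y = ?f x + l (y - x)"
    using affine_on_interior[OF open_interior convex_bodyD(3)[OF Kb] petty_max_chord_sum[OF K u]] by metis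
  obtain x0 where x0: "x0 \<in> interior K" using convex_bodyD(3)[OF Kb] by blast
  let ?k = "?f x0 - l x0"
  have f: "?f x = l x + ?k" if "x \<in> interior K" for x
    using l(2)[OF x0 that] l(1) by (simp add: linear_diff)
  have int: "x + (l x + ?k) *\<^sub>R u \<in> K" if x: "x \<in> interior K" for x
  proof -
    have "x + 0 *\<^sub>R u \<in> K" using x interior_subset by auto
    from chord_sum_reflect[OF Kc u0 this] show ?thesis using f[OF x] by simp
  qed
  have lc: "continuous_on UNIV l" using l(1) by (intro linear_continuous_on) (simp add: linear_conv_bounded_linear)
  have "x + (l x + ?k) *\<^sub>R u \<in> K" if x: "x \<in> K" for x
  proof -
    have "closed ((\<lambda>x. x + (l x + ?k) *\<^sub>R u) -` K)"
      using lc by (intro continuous_closed_vimage convex_bodyD(4)[OF Kb])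
        (auto simp: continuous_on_eq_continuous_at intro!: continuous_intros)
    moreover have "interior K \<subseteq> (\<lambda>x. x + (l x + ?k) *\<^sub>R u) -` K" using int by auto
    ultimately have "closure (interior K) \<subseteq> (\<lambda>x. x + (l x + ?k) *\<^sub>R u) -` K" by (rule closure_minimal[rotated])
    moreover have "x \<in> closure (interior K)"
      using x convex_closure_interior[OF Kc(2) convex_bodyD(3)[OF Kb]] closure_subset by blast
    ultimately show ?thesis by auto
  qed
  moreover have "l u = -2"
  proof -
    obtain r where r: "r > 0" "cball x0 r \<subseteq> interior K" using x0 open_contains_cball[of "interior K"] by auto
    have xr: "x0 + r *\<^sub>R u \<in> interior K" using r u by (auto simp: subset_iff dist_norm)
    have "?f (x0 + r *\<^sub>R u) = ?f x0 - 2 * r"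
    proof (rule chord_sum_eqI[OF Kc(1) u0])
      show "x0 + r *\<^sub>R u + 0 *\<^sub>R u \<in> K" using xr interior_subset by auto
      fix t assume "x0 + r *\<^sub>R u + t *\<^sub>R u \<in> K"
      then have "x0 + (r + t) *\<^sub>R u \<in> K" by (simp add: algebra_simps)
      from chord_sum_reflect[OF Kc u0 this]
      moreover have "x0 + r *\<^sub>R u + (?f x0 - 2 * r - t) *\<^sub>R u = x0 + (r + (?f x0 - 2 * r - t)) *\<^sub>R u"
        by (simp only: scaleR_add_left add.assoc)
      moreover have "r + (?f x0 - 2 * r - t) = ?f x0 - (r + t)" by simp
      ultimately show "x0 + r *\<^sub>R u + (?f x0 - 2 * r - t) *\<^sub>R u \<in> K" by (simp only:)
    qed
    moreover have "?f (x0 + r *\<^sub>R u) = ?f x0 + r * l u" using l(2)[OF x0 xr] l(1) by (simp add: linear_scale)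
    ultimately have "r * l u = r * (-2)" by simp
    moreover have "r \<noteq> 0" using r(1) by simp
    ultimately show ?thesis using mult_left_cancel[of r "l u" "-2"] by blast
  qed
  ultimately show ?thesis using that l(1) by blast
qed

section \<open>Bodies with affine reflections in all directions are ellipsoids\<close>

text \<open>The map is an affine involution, hence maps \<open>K\<close> onto itself; so its volume factor is 1.\<close>

lemma involution_preserves_integral:
  fixes K :: "(real^'n) set" and \<phi> :: "real^'n \<Rightarrow> 'b::{banach, second_countable_topology}"
  assumes K: "convex_body K" and l: "linear l" "l u = (-2::real)" and T: "\<And>x. x \<in> K \<Longrightarrow> x + (l x + k) *\<^sub>R u \<in> K"
    and \<phi>: "\<phi> \<in> borel_measurable borel"
  shows "(LINT x|lborel. indicator K x *\<^sub>R \<phi> (x + (l x + k) *\<^sub>R u)) = (LINT x|lborel. indicator K x *\<^sub>R \<phi> x)"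
proof -
  let ?T = "\<lambda>x. x + (l x + k) *\<^sub>R u" and ?A = "\<lambda>x. x + l x *\<^sub>R u"
  have lin: "linear ?A" using l(1) by (intro linearI) (simp_all add: linear_add linear_scale algebra_simps)
  have lT: "l (?T x) = - l x - 2 * k" for x using l by (simp add: linear_add linear_scale algebra_simps)
  have TT: "?T (?T x) = x" for x
  proof -
    have "?T (?T x) = ?T x + (- l x - 2 * k + k) *\<^sub>R u" by (simp only: lT)
    also have "\<dots> = x" by (simp add: algebra_simps scaleR_2)
    finally show ?thesis .
  qed
  have lA: "l (?A x) = - l x" for x using l by (simp add: linear_add linear_scale)
  have AA: "?A (?A x) = x" for x by (simp only: lA) simp
  have bij: "bij ?A" by (rule involuntory_imp_bij) (rule AA)
  have TA: "?T ` B = (+) (k *\<^sub>R u) ` ?A ` B" for B by (auto simp: image_image algebra_simps)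
  have Tvol: "emeasure lborel (?T ` B) = ennreal (volume_factor ?A) * emeasure lborel B" if B: "B \<in> sets borel" for B
  proof -
    have "emeasure lborel (?T ` B) = emeasure lborel (?A ` B)"
    proof -
      let ?C = "?A ` B"
      have C: "?C \<in> sets borel" by (rule borel_linear_image[OF lin bij B])
      have "(+) (k *\<^sub>R u) ` ?C = (\<lambda>x. x - k *\<^sub>R u) -` ?C" by (force simp: image_iff algebra_simps)
      moreover have "(\<lambda>x. x - k *\<^sub>R u) -` ?C \<in> sets borel"
        using measurable_sets[of "\<lambda>x. x - k *\<^sub>R u" borel borel ?C] C by simp
      ultimately have D: "(+) (k *\<^sub>R u) ` ?C \<in> sets borel" by simp
      have leb: "emeasure lborel X = emeasure lebesgue X" if "X \<in> sets borel" for X :: "(real^'n) set" using that by simp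
      have "(+) (k *\<^sub>R u) ` ?C = (\<lambda>x. 1 *\<^sub>R x + k *\<^sub>R u) ` ?C" by (auto simp: add.commute)
      then show ?thesis
        unfolding TA leb[OF D] leb[OF C] using emeasure_lebesgue_affine[of 1 "k *\<^sub>R u" ?C] by (simp only:) simp
    qed
    then show ?thesis using emeasure_linear_image[OF lin bij B] by simp
  qed
  have TK: "?T ` K = K" using T TT by (metis (no_types, lifting) image_eqI image_subsetI subsetI subset_antisym)
  have TB: "?T -` B = ?T ` B" for B using TT by (metis (no_types, lifting) image_eqI image_subsetI subsetI subset_antisym vimageE vimageI)
  have mT: "?T \<in> borel_measurable borel"
  proof -
    have "continuous_on UNIV l" using l(1) by (intro linear_continuous_on) (simp add: linear_conv_bounded_linear)
    then show ?thesis by (intro borel_measurable_continuous_onI continuous_intros)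
  qed
  have "ennreal (volume_factor ?A) = 1"
  proof -
    have e: "emeasure lborel K = ennreal (vol K)" using convex_bodyD[OF K] by (intro emeasure_bounded_borel)
    have "ennreal (vol K) = ennreal (volume_factor ?A) * ennreal (vol K)" using Tvol[OF convex_bodyD(7)[OF K]] by (simp add: TK e)
    then have "vol K = volume_factor ?A * vol K" using volume_factor_pos[OF lin bij] by (simp add: ennreal_mult[symmetric])
    then show ?thesis using vol_convex_body_pos[OF K] by simp
  qed
  then have "distr lborel borel ?T = lborel"
    by (intro measure_eqI) (auto simp: emeasure_distr mT TB Tvol)
  then have "(LINT x|lborel. indicator K x *\<^sub>R \<phi> x) = (LINT x|distr lborel borel ?T. indicator K x *\<^sub>R \<phi> x)" by simp
  also have "\<dots> = (LINT x|lborel. indicator K (?T x) *\<^sub>R \<phi> (?T x))"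
  proof -
    have "(\<lambda>x. indicator K x *\<^sub>R \<phi> x) \<in> borel_measurable borel" using \<phi> convex_bodyD(7)[OF K] by measurable
    then show ?thesis using mT by (intro integral_distr) simp_all
  qed
  also have "\<dots> = (LINT x|lborel. indicator K x *\<^sub>R \<phi> (?T x))"
  proof -
    have "?T x \<in> K \<longleftrightarrow> x \<in> K" for x using T TT by metis
    then show ?thesis by (simp add: indicator_def)
  qed
  finally show ?thesis by simp
qed

text \<open>In the position of maximal determinant the unit ball of the form contains the unit vectors and lies in the cube. Thus \<open>(x $ i)\<^sup>2 \<le> P x x\<close> with
  equality for the unit vectors, and testing this with \<open>axis i 1 + s *\<^sub>R axis j 1\<close> shows that the unit vectors are orthonormal.\<close>

lemma ellipsoid_of_form:
  fixes K :: "(real^'n) set" and Q :: "real^'n \<Rightarrow> real^'n \<Rightarrow> real"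
  assumes K: "convex_body K" and Q: "\<And>y. linear (\<lambda>x. Q x y)" "\<And>x y. Q x y = Q y x" "\<And>x. x \<noteq> 0 \<Longrightarrow> Q x x > 0"
    and \<rho>: "\<rho> > 0" and KQ: "\<And>x. x \<in> K \<longleftrightarrow> Q x x \<le> \<rho>"
  obtains f :: "real^'n \<Rightarrow> real^'n" where "linear f" "bij f" "K = f ` cball 0 1"
proof -
  obtain f :: "real^'n \<Rightarrow> real^'n" where f: "linear f" "bij f" "\<And>i. f (axis i 1) \<in> K" "\<And>y i. f y \<in> K \<Longrightarrow> \<bar>y $ i\<bar> \<le> 1"
    using maximal_determinant_position[OF convex_bodyD(1,3)[OF K]] by blast
  define P where "P x y = Q (f x) (f y) / \<rho>" for x y
  have Pl: "linear (\<lambda>x. P x y)" for y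
  proof -
    have "linear ((\<lambda>x. Q x (f y)) \<circ> f)" by (intro linear_compose f Q)
    from linear_compose_scale_right[OF this, of "1 / \<rho>"] show ?thesis by (simp add: P_def o_def)
  qed
  have Ps: "P x y = P y x" for x y by (simp add: P_def Q(2)[of "f x"])
  have Padd: "P (x + y) z = P x z + P y z" and Pscale: "P (a *\<^sub>R x) z = a * P x z" for x y z a
    using linear_add[OF Pl] linear_scale[OF Pl] by auto
  have Padd2: "P z (x + y) = P z x + P z y" and Pscale2: "P z (a *\<^sub>R x) = a * P z x" for x y z a
    using Padd Pscale Ps by metis+
  have Kf: "f y \<in> K \<longleftrightarrow> P y y \<le> 1" for y using \<rho> by (simp add: KQ P_def)
  have Ppos: "P x x > 0" if "x \<noteq> 0" for x
  proof -
    have "f x \<noteq> 0" using f that by (metis bij_is_inj linear_injective_0)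
    then show ?thesis using Q(3) \<rho> by (simp add: P_def)
  qed
  have low: "(x $ i)\<^sup>2 \<le> P x x" for x i
  proof (cases "x = 0")
    case False
    let ?s = "1 / sqrt (P x x)"
    have s: "?s > 0" "?s * ?s * P x x = 1" using Ppos[OF False] by simp_all
    have "P (?s *\<^sub>R x) (?s *\<^sub>R x) = 1" using s by (simp add: Pscale Pscale2)
    then have "\<bar>(?s *\<^sub>R x) $ i\<bar> \<le> 1" using f(4)[of "?s *\<^sub>R x" i] Kf by simp
    then have "((?s *\<^sub>R x) $ i)\<^sup>2 \<le> 1" by (simp add: abs_square_le_1)
    then have "(x $ i)\<^sup>2 / P x x \<le> 1" using Ppos[OF False] by (simp add: power_mult_distrib power_divide)
    then show ?thesis using Ppos[OF False] by (simp add: divide_le_eq)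
  qed (use Pscale[of 0 0] in simp)
  have P1: "P (axis i 1) (axis i 1) = 1" for i
    using low[of "axis i 1" i] f(3)[of i] Kf by (simp add: axis_def)
  have P0: "P (axis i 1) (axis j 1) = 0" if "i \<noteq> j" for i j
  proof -
    let ?p = "P (axis i 1) (axis j 1)"
    let ?x = "axis i 1 + (- ?p) *\<^sub>R axis j 1 :: real^'n"
    have xi: "?x $ i = 1" using that by (simp add: axis_def)
    have "(?x $ i)\<^sup>2 \<le> P ?x ?x" by (rule low)
    then have "1 \<le> P ?x ?x" by (simp only: xi power_one)
    also have "P ?x ?x = 1 - ?p * ?p"
      using Ps[of "axis j 1" "axis i 1"] by (simp only: Padd Padd2 Pscale Pscale2 P1) (simp add: algebra_simps)
    finally have "?p * ?p \<le> 0" by simp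
    then show ?thesis by (metis mult_eq_0_iff order_antisym zero_le_square)
  qed
  have exp: "x = (\<Sum>j\<in>UNIV. x $ j *\<^sub>R axis j 1)" for x :: "real^'n"
    by (simp add: vec_eq_iff axis_def if_distrib cong: if_cong)
  have Psum: "P (\<Sum>j\<in>UNIV. g j *\<^sub>R axis j 1) z = (\<Sum>j\<in>UNIV. g j * P (axis j 1) z)" for g z
    by (simp only: linear_sum[OF Pl] Pscale)
  have Pax: "P x (axis i 1) = x $ i" for x i
  proof -
    have "P x (axis i 1) = (\<Sum>j\<in>UNIV. x $ j * P (axis j 1) (axis i 1))" using Psum[of "\<lambda>j. x $ j"] exp[of x] by simp
    also have "\<dots> = (\<Sum>j\<in>UNIV. if j = i then x $ j else 0)" using P0 P1 by (intro sum.cong) auto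
    finally show ?thesis by simp
  qed
  have Pxx: "P x x = x \<bullet> x" for x
  proof -
    have "P x x = (\<Sum>j\<in>UNIV. x $ j * P (axis j 1) x)" using Psum[of "\<lambda>j. x $ j" x] exp[of x] by simp
    also have "\<dots> = (\<Sum>j\<in>UNIV. x $ j * x $ j)" using Pax Ps by simp
    finally show ?thesis by (simp add: inner_vec_def)
  qed
  have "K = f ` cball 0 1"
  proof (intro set_eqI iffI)
    fix z assume z: "z \<in> K"
    have "f (inv f z) = z" by (rule linear_bij_inv(3)[OF f(1,2)])
    then have "inv f z \<bullet> inv f z \<le> 1" using z Kf[of "inv f z"] Pxx by simp
    then have "norm (inv f z) \<le> 1" by (simp add: norm_eq_sqrt_inner)
    then show "z \<in> f ` cball 0 1" using \<open>f (inv f z) = z\<close> by (metis image_eqI mem_cball_0)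
  next
    fix z assume "z \<in> f ` cball 0 1"
    then obtain y where y: "z = f y" "norm y \<le> 1" by auto
    then have "(norm y)\<^sup>2 \<le> 1" by (simp add: power_le_one)
    then show "z \<in> K" using y Kf[of y] Pxx[of y] by (simp add: dot_square_norm)
  qed
  with f(1,2) show ?thesis by (rule that)
qed

lemma integrable_indicator_continuous:
  fixes f :: "'a::euclidean_space \<Rightarrow> 'b::{banach, second_countable_topology}"
  assumes "compact K" "continuous_on UNIV f"
  shows "integrable lborel (\<lambda>x. indicator K x *\<^sub>R f x)"
  using borel_integrable_compact[OF assms(1) continuous_on_subset[OF assms(2)]] by simp

lemma inertia_form:
  fixes K :: "(real^'n) set"
  assumes K: "convex_body K"
  obtains m :: "real^'n \<Rightarrow> real^'n \<Rightarrow> real" where "\<And>x y. m x y = (LINT w|lborel. indicator K w *\<^sub>R ((x \<bullet> w) * (y \<bullet> w)))"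
    "\<And>y. linear (\<lambda>x. m x y)" "\<And>x y. m x y = m y x" "\<And>x. x \<noteq> 0 \<Longrightarrow> m x x > 0"
proof -
  define m where "m x y = (LINT w|lborel. indicator K w *\<^sub>R ((x \<bullet> w) * (y \<bullet> w)))" for x y :: "real^'n"
  have int: "integrable lborel (\<lambda>w. indicator K w *\<^sub>R ((x \<bullet> w) * (y \<bullet> w)))" for x y :: "real^'n"
    by (intro integrable_indicator_continuous convex_bodyD(1)[OF K] continuous_intros)
  have "linear (\<lambda>x. m x y)" for y
  proof (rule linearI)
    fix a b :: "real^'n" and s :: real
    have "m (a + b) y = (LINT w|lborel. indicator K w *\<^sub>R ((a \<bullet> w) * (y \<bullet> w)) + indicator K w *\<^sub>R ((b \<bullet> w) * (y \<bullet> w)))"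
      unfolding m_def by (intro Bochner_Integration.integral_cong) (simp_all add: inner_add_left distrib_right distrib_left)
    then show "m (a + b) y = m a y + m b y" using int by (simp add: m_def)
    have "m (s *\<^sub>R a) y = (LINT w|lborel. s *\<^sub>R (indicator K w *\<^sub>R ((a \<bullet> w) * (y \<bullet> w))))"
      unfolding m_def by (intro Bochner_Integration.integral_cong) (simp_all add: mult_ac)
    then show "m (s *\<^sub>R a) y = s *\<^sub>R m a y" by (simp add: m_def)
  qed
  moreover have "m x y = m y x" for x y unfolding m_def by (intro Bochner_Integration.integral_cong) (simp_all add: mult.commute)
  moreover have "m x x > 0" if x: "x \<noteq> 0" for x
  proof -
    let ?f = "\<lambda>w. indicator K w *\<^sub>R ((x \<bullet> w) * (x \<bullet> w))"
    have nn: "?f w \<ge> 0" for w by (simp add: indicator_def)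
    have "m x x \<noteq> 0"
    proof
      assume "m x x = 0"
      then have ae: "AE w in lborel. ?f w = 0"
        using integral_nonneg_eq_0_iff_AE[OF int[of x x]] nn unfolding m_def by simp
      let ?U = "interior K \<inter> {w. x \<bullet> w \<noteq> 0}"
      have oU: "open ?U" by (intro open_Int open_interior open_Collect_neq continuous_intros)
      obtain w where w: "w \<in> interior K" using convex_bodyD(3)[OF K] by blast
      obtain r where r: "r > 0" "cball w r \<subseteq> interior K" using w open_contains_cball[of "interior K"] by auto
      let ?w = "w + (r / norm x) *\<^sub>R x"
      have "?w \<in> interior K" using r x by (auto simp: subset_iff dist_norm)
      moreover have "x \<bullet> w \<noteq> 0 \<or> x \<bullet> ?w \<noteq> 0" using x r(1) by (auto simp: inner_add_right)
      ultimately have neU: "?U \<noteq> {}" using w by blast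
      obtain v where "v \<in> ?U" "?f v = 0" using AE_lborel_dense[OF ae oU neU] .
      then show False using interior_subset[of K] by (auto simp: indicator_def)
    qed
    moreover have "m x x \<ge> 0" unfolding m_def using nn by (intro Bochner_Integration.integral_nonneg) simp
    ultimately show ?thesis by simp
  qed
  ultimately show ?thesis using that m_def by blast
qed

text \<open>All the reflections fix the centroid, which may be moved to the origin. They preserve the
  inertia form \<open>m\<close>, and therefore they are the orthogonal reflections of the dual form \<open>Q\<close>. The reflection along \<open>z - z'\<close> exchanges two points
  with \<open>Q z z = Q z' z'\<close>, so the body is a ball of \<open>Q\<close>.\<close>

lemma ellipsoid_of_affine_reflections:
  fixes K :: "(real^'n) set"
  assumes K: "convex_body K"
    and R: "\<And>u. norm u = 1 \<Longrightarrow> \<exists>l k. linear l \<and> l u = (-2::real) \<and> (\<forall>x\<in>K. x + (l x + k) *\<^sub>R u \<in> K)"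
  shows "ellipsoid K"
proof -
  define g where "g = (1 / vol K) *\<^sub>R (LINT x|lborel. indicator K x *\<^sub>R x)"
  let ?L = "(\<lambda>x. x - g) ` K"
  have idl: "linear (\<lambda>x::real^'n. x)" "bij (\<lambda>x::real^'n. x)" by (auto intro: linearI bij_id[unfolded id_def])
  have L: "convex_body ?L" using convex_body_affine_image[OF K idl, of "- g"] by simp
  have fixg: "l g + k = 0" if l: "linear l" "l u = -2" "\<And>x. x \<in> K \<Longrightarrow> x + (l x + k) *\<^sub>R u \<in> K" for l k u
  proof -
    have bl: "bounded_linear l" using l(1) by (simp add: linear_conv_bounded_linear)
    have cl: "continuous_on UNIV l" using bl by (rule linear_continuous_on)
    have i1: "integrable lborel (\<lambda>x. indicator K x *\<^sub>R l x)"
      by (intro integrable_indicator_continuous convex_bodyD(1)[OF K] cl)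
    have i2: "integrable lborel (\<lambda>x. indicator K x *\<^sub>R k)"
      by (intro integrable_indicator_continuous convex_bodyD(1)[OF K] continuous_intros)
    let ?\<phi> = "\<lambda>x. l x + k"
    have m: "?\<phi> \<in> borel_measurable borel" using cl by (intro borel_measurable_continuous_onI continuous_intros)
    have "(LINT x|lborel. indicator K x *\<^sub>R ?\<phi> x) = (LINT x|lborel. indicator K x *\<^sub>R ?\<phi> (x + (l x + k) *\<^sub>R u))"
      by (rule involution_preserves_integral[OF K l m, symmetric])
    also have "\<dots> = (LINT x|lborel. - (indicator K x *\<^sub>R ?\<phi> x))"
      using l(1,2) by (intro Bochner_Integration.integral_cong) (simp_all add: linear_add linear_scale algebra_simps)
    finally have "(LINT x|lborel. indicator K x *\<^sub>R ?\<phi> x) = 0" by simp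
    moreover have "(LINT x|lborel. indicator K x *\<^sub>R ?\<phi> x) = (LINT x|lborel. indicator K x *\<^sub>R l x) + (LINT x|lborel. indicator K x *\<^sub>R k)"
      using i1 i2 by (simp only: scaleR_add_right Bochner_Integration.integral_add)
    moreover have "measure lborel K = vol K" using convex_bodyD(7)[OF K] by simp
    then have "(LINT x|lborel. indicator K x *\<^sub>R k) = vol K * k" by simp
    moreover have "(LINT x|lborel. indicator K x *\<^sub>R l x) = vol K * l g"
    proof -
      have "integrable lborel (\<lambda>x. indicator K x *\<^sub>R x)"
        by (intro integrable_indicator_continuous convex_bodyD(1)[OF K] continuous_intros)
      then have "l (LINT x|lborel. indicator K x *\<^sub>R x) = (LINT x|lborel. l (indicator K x *\<^sub>R x))"
        by (rule integral_bounded_linear[OF bl, symmetric])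
      then have "(LINT x|lborel. indicator K x *\<^sub>R l x) = l (LINT x|lborel. indicator K x *\<^sub>R x)"
        using l(1) by (simp add: linear_scale)
      then show ?thesis using l(1) vol_convex_body_pos[OF K] by (simp add: g_def linear_scale)
    qed
    ultimately have "vol K * (l g + k) = 0" by (simp only: distrib_left)
    then show ?thesis using vol_convex_body_pos[OF K] by simp
  qed
  have RL: "\<exists>l. linear l \<and> l u = (-2::real) \<and> (\<forall>x\<in>?L. x + l x *\<^sub>R u \<in> ?L)" if u: "norm u = 1" for u
  proof -
    obtain l k where l: "linear l" "l u = (-2::real)" "\<And>x. x \<in> K \<Longrightarrow> x + (l x + k) *\<^sub>R u \<in> K" using R[OF u] by blast
    have gk: "l g + k = 0" by (rule fixg[OF l])
    have "(x - g) + l (x - g) *\<^sub>R u \<in> ?L" if x: "x \<in> K" for x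
    proof -
      have "l (x - g) = l x + k" using gk l(1) by (simp add: linear_diff)
      then have "(x - g) + l (x - g) *\<^sub>R u = (x + (l x + k) *\<^sub>R u) - g" by simp
      then show ?thesis using l(3)[OF x] by blast
    qed
    then show ?thesis using l(1,2) by blast
  qed
  obtain m :: "real^'n \<Rightarrow> real^'n \<Rightarrow> real" where m: "\<And>x y. m x y = (LINT w|lborel. indicator ?L w *\<^sub>R ((x \<bullet> w) * (y \<bullet> w)))"
    "\<And>y. linear (\<lambda>x. m x y)" "\<And>x y. m x y = m y x" "\<And>x. x \<noteq> 0 \<Longrightarrow> m x x > 0"
    by (rule inertia_form[OF L], rule that)
  have madd: "m (x + y) z = m x z + m y z" and mscale: "m (a *\<^sub>R x) z = a * m x z" for x y z a
    using linear_add[OF m(2)] linear_scale[OF m(2)] by auto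
  have madd2: "m z (x + y) = m z x + m z y" and mscale2: "m z (a *\<^sub>R x) = a * m z x" for x y z a
    using madd mscale m(3) by metis+
  define M where "M y = (\<Sum>b\<in>Basis. m b y *\<^sub>R b)" for y :: "real^'n"
  have linM: "linear M" unfolding M_def
    by (intro linearI) (simp_all add: madd2 mscale2 scaleR_add_left sum.distrib scaleR_sum_right)
  have xM: "x \<bullet> M y = m x y" for x y
  proof -
    have "m x y = m (\<Sum>b\<in>Basis. (x \<bullet> b) *\<^sub>R b) y" by (simp add: euclidean_representation)
    also have "\<dots> = (\<Sum>b\<in>Basis. (x \<bullet> b) * m b y)" by (simp add: linear_sum[OF m(2)] mscale)
    finally show ?thesis by (simp add: M_def inner_sum_right mult.commute)
  qed
  have "inj M"
  proof (rule linear_injective_0[THEN iffD2, OF linM], intro allI impI)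
    fix y assume "M y = 0"
    then have "m y y = 0" using xM[of y y] by simp
    then show "y = 0" using m(4)[of y] by auto
  qed
  then have bijM: "bij M" using linM by (simp add: bij_def linear_injective_imp_surjective)
  note N = linear_bij_inv[OF linM bijM]
  define Q where "Q x y = m (inv M x) (inv M y)" for x y
  have Q: "Q x y = x \<bullet> inv M y" for x y
    using xM[of "inv M y" "inv M x"] by (simp add: Q_def N m(3) inner_commute)
  have Q1: "linear (\<lambda>x. Q x y)" for y unfolding Q by (intro linearI) (simp_all add: inner_add_left)
  have Q2: "Q x y = Q y x" for x y unfolding Q_def by (rule m(3))
  have Q3: "Q x x > 0" if "x \<noteq> 0" for x
  proof -
    have "inv M x \<noteq> 0" using that N(1,3) by (metis linM linear_0)
    then show ?thesis unfolding Q_def by (rule m(4))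
  qed
  have refl: "x - (2 * Q u x / Q u u) *\<^sub>R u \<in> ?L" if u: "norm u = 1" and x: "x \<in> ?L" for u x
  proof -
    obtain l where l: "linear l" "l u = (-2::real)" "\<And>x. x \<in> ?L \<Longrightarrow> x + l x *\<^sub>R u \<in> ?L" using RL[OF u] by blast
    define cov where "cov = adjoint l (1::real)"
    have lcov: "l w = cov \<bullet> w" for w using adjoint_works[OF l(1), of w 1] by (simp add: cov_def inner_commute)
    have inv: "m (x + (x \<bullet> u) *\<^sub>R cov) (y + (y \<bullet> u) *\<^sub>R cov) = m x y" for x y
    proof -
      have "(\<lambda>w. (x \<bullet> w) * (y \<bullet> w)) \<in> borel_measurable borel" by measurable
      from involution_preserves_integral[OF L l(1,2), of 0, OF _ this] l(3)
      have "(LINT w|lborel. indicator ?L w *\<^sub>R ((x \<bullet> (w + l w *\<^sub>R u)) * (y \<bullet> (w + l w *\<^sub>R u)))) = m x y" by (simp add: m(1))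
      moreover have "z \<bullet> (w + l w *\<^sub>R u) = (z + (z \<bullet> u) *\<^sub>R cov) \<bullet> w" for z w by (simp add: inner_add_left inner_add_right lcov)
      ultimately show ?thesis by (simp add: m(1))
    qed
    have covu: "cov \<bullet> u = -2" using l(2) lcov by simp
    have cov0: "cov \<noteq> 0" using covu by auto
    let ?c = "m cov cov"
    have c: "?c > 0" by (rule m(4)[OF cov0])
    have "M cov = (- ?c / 2) *\<^sub>R u"
    proof (rule vector_eq_rdot[THEN iffD1], intro allI)
      fix \<eta>
      have e: "cov + (cov \<bullet> u) *\<^sub>R cov = (-1) *\<^sub>R cov" by (simp add: covu scaleR_2)
      have "m ((-1) *\<^sub>R cov) (\<eta> + (\<eta> \<bullet> u) *\<^sub>R cov) = m cov \<eta>" using inv[of cov \<eta>] unfolding e .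
      then have "- m cov \<eta> - (\<eta> \<bullet> u) * ?c = m cov \<eta>" by (simp only: mscale madd2 mscale2)
      then have "m cov \<eta> = - ?c / 2 * (\<eta> \<bullet> u)" by (simp add: field_simps)
      moreover have "M cov \<bullet> \<eta> = m cov \<eta>" using xM[of \<eta> cov] m(3)[of \<eta> cov] by (simp only: inner_commute)
      moreover have "((- ?c / 2) *\<^sub>R u) \<bullet> \<eta> = - ?c / 2 * (\<eta> \<bullet> u)" by (simp only: inner_scaleR_left inner_commute[of u])
      ultimately show "M cov \<bullet> \<eta> = ((- ?c / 2) *\<^sub>R u) \<bullet> \<eta>" by (simp only:)
    qed
    then have "inv M (M cov) = inv M ((- ?c / 2) *\<^sub>R u)" by simp
    then have covN: "cov = (- ?c / 2) *\<^sub>R inv M u" by (simp only: N(4) linear_scale[OF N(1)])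
    have lx: "l w = - ?c / 2 * Q u w" for w
    proof -
      have "cov \<bullet> w = ((- ?c / 2) *\<^sub>R inv M u) \<bullet> w" using covN by (rule arg_cong)
      also have "\<dots> = - ?c / 2 * (w \<bullet> inv M u)" by (simp only: inner_scaleR_left inner_commute[of "inv M u"])
      finally show ?thesis unfolding lcov Q[of w u, symmetric] Q2[of w u] .
    qed
    have cQ: "?c * Q u u = 4" using lx[of u] l(2) by simp
    then have "Q u u \<noteq> 0" by auto
    with cQ have "- ?c / 2 * Q u x = - (2 * Q u x / Q u u)" by (simp add: field_simps)
    then have "l x = - (2 * Q u x / Q u u)" by (simp only: lx)
    then show ?thesis using l(3)[OF x] by simp
  qed
  have Qadd: "Q (x - y) z = Q x z - Q y z" and Qscale: "Q (a *\<^sub>R x) z = a * Q x z" for x y z a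
    using linear_diff[OF Q1] linear_scale[OF Q1] by auto
  have Qadd2: "Q z (x - y) = Q z x - Q z y" and Qscale2: "Q z (a *\<^sub>R x) = a * Q z x" for x y z a
    using Qadd Qscale Q2 by metis+
  have sphere: "z' \<in> ?L" if z: "z \<in> ?L" and zz: "Q z z = Q z' z'" for z z'
  proof (cases "z = z'")
    case False
    let ?d = "z - z'"
    let ?n = "norm ?d"
    have n: "?n > 0" using False by simp
    have Qd: "Q ?d z = Q z z - Q z' z" "Q ?d ?d = 2 * (Q z z - Q z' z)"
      by (simp_all only: Qadd Qadd2 zz Q2[of z z']) simp
    have scaled: "(2 * Q (d /\<^sub>R r) z / Q (d /\<^sub>R r) (d /\<^sub>R r)) *\<^sub>R (d /\<^sub>R r) = (2 * Q d z / Q d d) *\<^sub>R d"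
      if "r \<noteq> 0" "Q d d \<noteq> 0" for d and r :: real
    proof -
      have "2 * (inverse r * a) / (inverse r * (inverse r * b)) * inverse r = 2 * a / b" if "b \<noteq> 0" for a b
        using that \<open>r \<noteq> 0\<close> by (simp add: field_simps)
      then show ?thesis using that by (simp only: Qscale Qscale2 scaleR_scaleR not_False_eq_True)
    qed
    have Qdd: "Q ?d ?d > 0" using Q3[of ?d] False by simp
    have "z - (2 * Q (?d /\<^sub>R ?n) z / Q (?d /\<^sub>R ?n) (?d /\<^sub>R ?n)) *\<^sub>R (?d /\<^sub>R ?n) \<in> ?L"
      by (rule refl[OF _ z]) (use n in simp)
    also have "(2 * Q (?d /\<^sub>R ?n) z / Q (?d /\<^sub>R ?n) (?d /\<^sub>R ?n)) *\<^sub>R (?d /\<^sub>R ?n) = (2 * Q ?d z / Q ?d ?d) *\<^sub>R ?d"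
      using n Qdd by (intro scaled) auto
    also have "2 * Q ?d z / Q ?d ?d = 1" using Qdd Qd by simp
    finally show ?thesis by simp
  qed (use z in simp)
  have contQ: "continuous_on UNIV (\<lambda>x. Q x x)"
    unfolding Q using N(1) by (intro continuous_intros linear_continuous_on) (simp add: linear_conv_bounded_linear)
  obtain z where z: "z \<in> ?L" "\<And>x. x \<in> ?L \<Longrightarrow> Q x x \<le> Q z z"
    using continuous_attains_sup[OF convex_bodyD(1)[OF L] convex_bodyD(6)[OF L] continuous_on_subset[OF contQ]] by auto
  have \<rho>: "Q z z > 0"
  proof (rule ccontr)
    assume "\<not> Q z z > 0"
    then have "x = 0" if "x \<in> ?L" for x using z(2)[OF that] Q3[of x] by force
    then have "?L \<subseteq> {0}" by blast
    then have "interior ?L \<subseteq> interior {0}" by (rule interior_mono)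
    then show False using convex_bodyD(3)[OF L] by simp
  qed
  have memL: "x \<in> ?L \<longleftrightarrow> Q x x \<le> Q z z" for x
  proof
    assume x: "Q x x \<le> Q z z"
    have "\<exists>s y. 0 \<le> s \<and> s \<le> 1 \<and> x = s *\<^sub>R y \<and> Q y y = Q z z"
    proof (cases "x = 0")
      case True
      then show ?thesis by (intro exI[of _ 0] exI[of _ z]) simp
    next
      case False
      let ?s = "sqrt (Q x x / Q z z)"
      have qx: "Q x x > 0" by (rule Q3[OF False])
      have s: "0 < ?s" "?s \<le> 1" "?s * ?s = Q x x / Q z z" using qx \<rho> x by simp_all
      have "Q ((1 / ?s) *\<^sub>R x) ((1 / ?s) *\<^sub>R x) = Q x x / (?s * ?s)" by (simp add: Qscale Qscale2)
      also have "\<dots> = Q z z" unfolding s(3) using qx by simp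
      finally have "Q ((1 / ?s) *\<^sub>R x) ((1 / ?s) *\<^sub>R x) = Q z z" .
      moreover have "x = ?s *\<^sub>R ((1 / ?s) *\<^sub>R x)" using qx \<rho> by simp
      ultimately show ?thesis using s(1,2) by (intro exI[of _ ?s] exI[of _ "(1 / ?s) *\<^sub>R x"]) (simp only: less_imp_le simp_thms)
    qed
    then obtain s y where sy: "0 \<le> s" "s \<le> 1" "x = s *\<^sub>R y" "Q y y = Q z z" by blast
    have "y \<in> ?L" using sphere[OF z(1)] sy(4) by simp
    moreover have "Q ((-1) *\<^sub>R y) ((-1) *\<^sub>R y) = Q z z" using sy(4) unfolding Qscale Qscale2 by simp
    then have "(-1) *\<^sub>R y \<in> ?L" using sphere[OF z(1)] by simp
    ultimately have "((1 + s) / 2) *\<^sub>R y + ((1 - s) / 2) *\<^sub>R ((-1) *\<^sub>R y) \<in> ?L"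
      using sy(1,2) by (intro convexD[OF convex_bodyD(2)[OF L]]) (auto simp: field_simps)
    moreover have "((1 + s) / 2) *\<^sub>R y + ((1 - s) / 2) *\<^sub>R ((-1) *\<^sub>R y) = ((1 + s) / 2 - (1 - s) / 2) *\<^sub>R y"
      by (simp only: scaleR_diff_left) simp
    moreover have "(1 + s) / 2 - (1 - s) / 2 = s" by (simp add: field_simps)
    ultimately show "x \<in> ?L" by (simp only: sy(3))
  qed (rule z(2))
  obtain f :: "real^'n \<Rightarrow> real^'n" where f: "linear f" "bij f" "?L = f ` cball 0 1" by (rule ellipsoid_of_form[OF L Q1 Q2 Q3 \<rho> memL]) blast+
  have "K = (\<lambda>x. x + g) ` ?L" by (simp add: image_image)
  then have "K = (\<lambda>z. f z + g) ` cball 0 1" by (simp add: f(3) image_image)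
  then show ?thesis unfolding ellipsoid_def GL_def using f(1,2) by blast
qed

lemma petty_max_ellipsoid: "petty_max K \<Longrightarrow> ellipsoid K"
proof -
  assume K: "petty_max K"
  show "ellipsoid K"
  proof (rule ellipsoid_of_affine_reflections)
    show "convex_body K" using K by (simp add: petty_max_def)
    fix u :: "real^'a" assume u: "norm u = 1"
    show "\<exists>l k. linear l \<and> l u = (-2::real) \<and> (\<forall>x\<in>K. x + (l x + k) *\<^sub>R u \<in> K)"
      using petty_max_affine_reflection[OF K u] by metis
  qed
qed

section \<open>A uniform gap in the Petty inequality\<close>

lemma affine_sandwich_d_BM:
  fixes K :: "(real^'n) set" and f \<Phi> :: "real^'n \<Rightarrow> real^'n"
  assumes f: "linear f" "bij f" and \<Phi>: "linear \<Phi>" "bij \<Phi>" and L: "L = (\<lambda>z. \<Phi> z + c') ` cball 0 1" and s: "s \<ge> 1"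
    and KL: "(\<lambda>z. f z + c) ` K \<subseteq> (*\<^sub>R) s ` L" and LK: "L \<subseteq> (*\<^sub>R) s ` (\<lambda>z. f z + c) ` K"
  shows "2 * ln s \<in> {l. l \<ge> 0 \<and> (\<exists>\<Phi>\<in>GL. \<exists>x y.
      (\<lambda>z. z - x) ` K \<subseteq> \<Phi> ` (\<lambda>z. z - y) ` cball 0 1 \<and>
      \<Phi> ` (\<lambda>z. z - y) ` cball 0 1 \<subseteq> (\<lambda>z. exp l *\<^sub>R z) ` (\<lambda>z. z - x) ` K)}"
proof (rule CollectI, intro conjI)
  show "0 \<le> 2 * ln s" using s by simp
  note fi = linear_bij_inv[OF f] and \<Phi>i = linear_bij_inv[OF \<Phi>]
  let ?\<Psi> = "\<lambda>z. inv f (s *\<^sub>R \<Phi> z)" and ?x = "- inv f c" and ?y = "- inv \<Phi> c'"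
  have "linear ?\<Psi>"
    by (intro linearI) (simp_all add: linear_add[OF \<Phi>(1)] linear_scale[OF \<Phi>(1)] linear_add[OF fi(1)] linear_scale[OF fi(1)] scaleR_add_right)
  moreover have "bij ?\<Psi>"
  proof -
    have "bij (inv f \<circ> (*\<^sub>R) s \<circ> \<Phi>)" using linear_scaleR_bij[of s] s \<Phi>(2) fi(2) by (intro bij_comp) auto
    then show ?thesis by (simp add: o_def)
  qed
  ultimately have GL: "?\<Psi> \<in> GL" by (simp add: GL_def)
  have x: "z - ?x = inv f (f z + c)" for z by (simp add: linear_add[OF fi(1)] fi(4))
  have y: "?\<Psi> (b - ?y) = inv f (s *\<^sub>R (\<Phi> b + c'))" for b by (simp add: linear_add[OF \<Phi>(1)] \<Phi>i(3))
  have 1: "(\<lambda>z. z - ?x) ` K \<subseteq> ?\<Psi> ` (\<lambda>z. z - ?y) ` cball 0 1"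
  proof
    fix w assume "w \<in> (\<lambda>z. z - ?x) ` K"
    then obtain z where z: "z \<in> K" "w = inv f (f z + c)" using x by auto
    then have "f z + c \<in> (*\<^sub>R) s ` L" using KL by blast
    then obtain b where b: "b \<in> cball 0 1" "f z + c = s *\<^sub>R (\<Phi> b + c')" unfolding L by auto
    have "w = ?\<Psi> (b - ?y)" unfolding z(2) y b(2) ..
    then show "w \<in> ?\<Psi> ` (\<lambda>z. z - ?y) ` cball 0 1" using b(1) by blast
  qed
  have exp: "exp (2 * ln s) = s * s" using s exp_add[of "ln s" "ln s"] by (simp only: mult_2) simp
  have 2: "?\<Psi> ` (\<lambda>z. z - ?y) ` cball 0 1 \<subseteq> (\<lambda>z. exp (2 * ln s) *\<^sub>R z) ` (\<lambda>z. z - ?x) ` K"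
  proof
    fix w assume "w \<in> ?\<Psi> ` (\<lambda>z. z - ?y) ` cball 0 1"
    then obtain b where b: "b \<in> cball 0 1" "w = ?\<Psi> (b - ?y)" by auto
    have "\<Phi> b + c' \<in> L" using b(1) unfolding L by blast
    then obtain z where z: "z \<in> K" "\<Phi> b + c' = s *\<^sub>R (f z + c)" using LK by blast
    have "w = inv f (s *\<^sub>R s *\<^sub>R (f z + c))" unfolding b(2) y z(2) ..
    also have "\<dots> = exp (2 * ln s) *\<^sub>R (z - ?x)" unfolding x exp by (simp only: linear_scale[OF fi(1)] scaleR_scaleR)
    finally show "w \<in> (\<lambda>z. exp (2 * ln s) *\<^sub>R z) ` (\<lambda>z. z - ?x) ` K" using z(1) by blast
  qed
  show "\<exists>\<Phi>\<in>GL. \<exists>x y. (\<lambda>z. z - x) ` K \<subseteq> \<Phi> ` (\<lambda>z. z - y) ` cball 0 1 \<and>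
      \<Phi> ` (\<lambda>z. z - y) ` cball 0 1 \<subseteq> (\<lambda>z. exp (2 * ln s) *\<^sub>R z) ` (\<lambda>z. z - x) ` K"
    using GL 1 2 by blast
qed

lemma ellipsoidE:
  fixes L :: "(real^'n) set"
  assumes "ellipsoid L"
  obtains \<Phi> :: "real^'n \<Rightarrow> real^'n" and c where "linear \<Phi>" "bij \<Phi>" "L = (\<lambda>z. \<Phi> z + c) ` cball 0 1"
  using assms unfolding ellipsoid_def GL_def by blast

lemma cball_eq_dilation:
  fixes r :: real
  assumes "r > 0"
  shows "cball (0::'a::euclidean_space) r = (\<lambda>z. r *\<^sub>R z + 0) ` cball 0 1"
  using cball_scale[of r "0::'a" 1] assms by simp

lemma d_BM_le:
  fixes K :: "(real^'n) set" and f :: "real^'n \<Rightarrow> real^'n"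
  assumes f: "linear f" "bij f" and L: "ellipsoid L" and s: "s \<ge> 1"
    and KL: "(\<lambda>z. f z + c) ` K \<subseteq> (*\<^sub>R) s ` L" and LK: "L \<subseteq> (*\<^sub>R) s ` (\<lambda>z. f z + c) ` K"
  shows "d_BM K (cball 0 1) \<le> 2 * ln s"
proof -
  obtain \<Phi> :: "real^'n \<Rightarrow> real^'n" and c' where \<Phi>: "linear \<Phi>" "bij \<Phi>" "L = (\<lambda>z. \<Phi> z + c') ` cball 0 1"
    using ellipsoidE[OF L] .
  show ?thesis unfolding d_BM_def
    by (rule cInf_lower[OF affine_sandwich_d_BM[OF f \<Phi> s KL LK]]) (auto intro!: bdd_belowI[of _ 0])
qed

lemma d_BM_nonneg:
  fixes K :: "(real^'n) set"
  assumes K: "convex_body K"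
  shows "d_BM K (cball 0 1) \<ge> 0"
proof -
  let ?r = "1 / (2 * real CARD('n))" and ?R = "real CARD('n) + 1"
  have "1 \<le> real CARD('n)" using zero_less_card_finite[where 'a = 'n] by linarith
  then have "1 \<le> 2 * real CARD('n)" by linarith
  then have "?r \<le> 1" by (subst divide_le_eq_1_pos) (simp_all only: zero_less_mult_iff of_nat_0_less_iff zero_less_card_finite zero_less_numeral simp_thms)
  then have rR: "0 < ?r" "?r \<le> 1" "1 \<le> ?R" by simp_all
  obtain f :: "real^'n \<Rightarrow> real^'n" and c where f: "linear f" "bij f"
    "cball 0 ?r \<subseteq> (\<lambda>z. f z + c) ` K" "(\<lambda>z. f z + c) ` K \<subseteq> cball 0 ?R"
    by (rule convex_body_position[OF K], rule that)
  define s where "s = ?R / ?r"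
  have "?r \<le> ?R" using rR by linarith
  then have s: "s \<ge> 1" using rR(1) unfolding s_def by (simp only: le_divide_eq_1_pos)
  then have s0: "s > 0" by simp
  have "inverse (a / b) * a = b" if "a \<noteq> 0" for a b :: real using that by simp
  then have sR: "inverse s * ?R = ?r" unfolding s_def using rR by (metis not_one_le_zero)
  have si: "x = s *\<^sub>R (inverse s *\<^sub>R x)" for x :: "real^'n" using s0 by simp
  have lb: "linear ((*\<^sub>R) ?R :: real^'n \<Rightarrow> real^'n)" "bij ((*\<^sub>R) ?R :: real^'n \<Rightarrow> real^'n)" using linear_scaleR_bij[of ?R] by auto
  have L: "cball 0 ?R = (\<lambda>z. ?R *\<^sub>R z + 0) ` cball (0::real^'n) 1"
    by (rule cball_eq_dilation) simp
  have small: "norm (inverse s *\<^sub>R x) \<le> ?r" if "x \<in> cball 0 ?R" for x :: "real^'n"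
  proof -
    have "norm (inverse s *\<^sub>R x) = inverse s * norm x" using s0 by simp
    also have "\<dots> \<le> inverse s * ?R" using that s0 by (intro mult_left_mono) auto
    finally show ?thesis by (simp only: sR)
  qed
  have "cball (0::real^'n) ?R \<subseteq> (*\<^sub>R) s ` cball 0 ?R"
  proof
    fix x :: "real^'n" assume "x \<in> cball 0 ?R"
    then have "norm (inverse s *\<^sub>R x) \<le> ?R" using small \<open>?r \<le> ?R\<close> by (meson order_trans)
    then have "inverse s *\<^sub>R x \<in> cball 0 ?R" by (simp only: mem_cball_0)
    then show "x \<in> (*\<^sub>R) s ` cball 0 ?R" using si[of x] by (rule rev_image_eqI)
  qed
  then have 1: "(\<lambda>z. f z + c) ` K \<subseteq> (*\<^sub>R) s ` cball 0 ?R" using f(4) by blast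
  have 2: "cball 0 ?R \<subseteq> (*\<^sub>R) s ` (\<lambda>z. f z + c) ` K"
  proof
    fix x :: "real^'n" assume "x \<in> cball 0 ?R"
    then have "inverse s *\<^sub>R x \<in> cball 0 ?r" using small by (simp only: mem_cball_0)
    then have "inverse s *\<^sub>R x \<in> (\<lambda>z. f z + c) ` K" using f(3) by blast
    then show "x \<in> (*\<^sub>R) s ` (\<lambda>z. f z + c) ` K" using si[of x] by (rule rev_image_eqI)
  qed
  note mem = affine_sandwich_d_BM[OF f(1,2) lb L s 1 2]
  show ?thesis unfolding d_BM_def by (rule cInf_greatest) (use mem in blast, blast)
qed

lemma petty_ellipsoid:
  fixes L :: "(real^'n) set"
  assumes "ellipsoid L"
  shows "petty L = petty (cball 0 1 :: (real^'n) set)"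
proof -
  obtain \<Phi> :: "real^'n \<Rightarrow> real^'n" and c where "linear \<Phi>" "bij \<Phi>" "L = (\<lambda>z. \<Phi> z + c) ` cball 0 1"
    using ellipsoidE[OF assms] .
  then show ?thesis using petty_affine_image[of "cball 0 1" \<Phi> c] by (simp add: convex_body_def)
qed

lemma petty_ball_max: "petty_max (cball 0 1 :: (real^'n) set)"
proof -
  obtain L :: "(real^'n) set" where L: "convex_body L" "\<And>K :: (real^'n) set. convex_body K \<Longrightarrow> petty K \<le> petty L"
    by (rule petty_attains_max, rule that)
  then have "petty_max L" by (simp add: petty_max_def)
  from petty_ellipsoid[OF petty_max_ellipsoid[OF this]] L show ?thesis by (simp add: petty_max_def convex_body_def)
qed

text \<open>Otherwise there is a sequence of bodies at distance at least \<open>t\<close> along which \<open>petty\<close> tends to its maximum. Its limit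
  is a maximizer, thus an ellipsoid, and bodies close to an ellipsoid have small distance to the ball.\<close>

lemma petty_gap:
  assumes t: "t > 0"
  obtains \<eta> where "0 < \<eta>" "\<eta> < 1"
    "\<And>K :: (real^'n) set. convex_body K \<Longrightarrow> t \<le> d_BM K (cball 0 1) \<Longrightarrow> petty K \<le> (1 - \<eta>) * petty (cball 0 1 :: (real^'n) set)"
proof (rule ccontr)
  let ?B = "cball 0 1 :: (real^'n) set"
  have B: "petty ?B > 0" by (rule petty_pos) (simp add: convex_body_def)
  assume none: "\<not> thesis"
  have "\<exists>K :: (real^'n) set. convex_body K \<and> t \<le> d_BM K (cball 0 1) \<and> (1 - 1 / real (Suc (Suc i))) * petty ?B < petty K" for i
  proof (rule ccontr)
    assume "\<not> (\<exists>K :: (real^'n) set. convex_body K \<and> t \<le> d_BM K (cball 0 1) \<and> (1 - 1 / real (Suc (Suc i))) * petty ?B < petty K)"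
    then have "petty K \<le> (1 - 1 / real (Suc (Suc i))) * petty ?B" if "convex_body K" "t \<le> d_BM K (cball 0 1)" for K :: "(real^'n) set"
      using that by (meson not_le)
    then show False using none that[of "1 / real (Suc (Suc i))"] by simp
  qed
  then obtain K :: "nat \<Rightarrow> (real^'n) set" where K: "\<And>i. convex_body (K i)" "\<And>i. t \<le> d_BM (K i) (cball 0 1)"
    "\<And>i. (1 - 1 / real (Suc (Suc i))) * petty ?B < petty (K i)" by metis
  obtain L :: "(real^'n) set" and r where L: "convex_body L" "strict_mono (r :: nat \<Rightarrow> nat)"
    "\<And>e. e > 0 \<Longrightarrow> \<exists>N. \<forall>j\<ge>N. petty (K (r j)) \<le> (1 + e) * petty L"
    "\<And>e. e > 0 \<Longrightarrow> \<exists>N. \<forall>j\<ge>N. \<exists>(f :: real^'n \<Rightarrow> real^'n) c. linear f \<and> bij f \<and> (\<lambda>z. f z + c) ` K (r j) \<subseteq> (*\<^sub>R) (1 + e) ` L \<and>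
       L \<subseteq> (*\<^sub>R) (1 + e) ` (\<lambda>z. f z + c) ` K (r j)"
    by (rule affine_compactness[of K, OF K(1)], rule that)
  have "petty ?B \<le> (1 + e) * petty L" if e: "e > 0" for e
  proof -
    obtain N where N: "\<forall>j\<ge>N. petty (K (r j)) \<le> (1 + e) * petty L" using L(3)[OF e] by blast
    have lim: "(\<lambda>j. (1 - 1 / real (Suc (Suc j))) * petty ?B) \<longlonglongrightarrow> (1 - 0) * petty ?B"
    proof (intro tendsto_intros)
      show "(\<lambda>j. 1 / real (Suc (Suc j))) \<longlonglongrightarrow> 0"
        using LIMSEQ_Suc[OF LIMSEQ_inverse_real_of_nat] by (simp add: inverse_eq_divide)
    qed
    have "(1 - 1 / real (Suc (Suc j))) * petty ?B \<le> (1 + e) * petty L" if "j \<ge> N" for j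
    proof -
      have "1 / real (Suc (Suc (r j))) \<le> 1 / real (Suc (Suc j))"
        using seq_suble[OF L(2), of j] by (intro divide_left_mono) auto
      then have "(1 - 1 / real (Suc (Suc j))) * petty ?B \<le> (1 - 1 / real (Suc (Suc (r j)))) * petty ?B"
        using B by (intro mult_right_mono) auto
      also have "\<dots> \<le> petty (K (r j))" using K(3) by (rule less_imp_le)
      finally show ?thesis using N that by force
    qed
    then have "(1 - 0) * petty ?B \<le> (1 + e) * petty L" by (intro LIMSEQ_le_const2[OF lim]) blast
    then show ?thesis by simp
  qed
  then have "petty ?B \<le> petty L"
  proof -
    assume all: "\<And>e. e > 0 \<Longrightarrow> petty ?B \<le> (1 + e) * petty L"
    show ?thesis
    proof (rule field_le_epsilon)
      fix e :: real assume "e > 0"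
      then have "petty ?B \<le> (1 + e / petty L) * petty L" using petty_pos[OF L(1)] by (intro all) simp
      also have "\<dots> = petty L + e" using petty_pos[OF L(1)] by (simp add: field_simps)
      finally show "petty ?B \<le> petty L + e" .
    qed
  qed
  then have "petty_max L" using petty_ball_max[where 'n = 'n] L(1) unfolding petty_max_def by (meson order_trans)
  then have E: "ellipsoid L" by (rule petty_max_ellipsoid)
  \<comment> \<open>With this value \<open>2 * ln (1 + e)\<close> is \<open>t / 2\<close>.\<close>
  define e where "e = exp (t / 4) - 1"
  have e: "e > 0" using t by (simp add: e_def)
  obtain N where N: "\<forall>j\<ge>N. \<exists>(f :: real^'n \<Rightarrow> real^'n) c. linear f \<and> bij f \<and> (\<lambda>z. f z + c) ` K (r j) \<subseteq> (*\<^sub>R) (1 + e) ` L \<and>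
       L \<subseteq> (*\<^sub>R) (1 + e) ` (\<lambda>z. f z + c) ` K (r j)" using L(4)[OF e] by (rule exE)
  then obtain f :: "real^'n \<Rightarrow> real^'n" and c where f: "linear f" "bij f" "(\<lambda>z. f z + c) ` K (r N) \<subseteq> (*\<^sub>R) (1 + e) ` L"
       "L \<subseteq> (*\<^sub>R) (1 + e) ` (\<lambda>z. f z + c) ` K (r N)" by blast
  have "d_BM (K (r N)) (cball 0 1) \<le> 2 * ln (1 + e)" using e by (intro d_BM_le[OF f(1,2) E _ f(3,4)]) simp
  also have "\<dots> = t / 2" by (simp add: e_def)
  finally show False using K(2)[of "r N"] t by simp
qed

section \<open>Convolution bodies of bodies far from ellipsoids\<close>

lemma vol_ball_properties:
  fixes K :: "(real^'n) set"
  assumes K: "convex_body K"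
  shows "convex_body (vol_ball K)" "vol (vol_ball K) = vol K" "petty (vol_ball K) = petty (cball 0 1 :: (real^'n) set)"
proof -
  let ?\<omega> = "vol (cball (0::real^'n) 1)"
  have \<omega>: "?\<omega> > 0" using content_cball_pos[of 1 "0::real^'n"] by simp
  have vb: "vol (cball (0::real^'n) r) = r ^ CARD('n) * ?\<omega>" if "r \<ge> 0" for r
  proof (cases "r = 0")
    case False
    then have "cball (0::real^'n) r = (*\<^sub>R) r ` cball 0 1" using cball_eq_dilation[of r, where 'a = "real^'n"] that by simp
    then show ?thesis using vol_scaleR[of r "cball (0::real^'n) 1"] that False by simp
  qed simp
  let ?r = "root CARD('n) (vol K / ?\<omega>)"
  have r: "?r > 0" using vol_convex_body_pos[OF K] \<omega> by simp
  have rn: "?r ^ CARD('n) = vol K / ?\<omega>" using vol_convex_body_pos[OF K] \<omega> by (intro real_root_pow_pos) auto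
  have "(THE r. r \<ge> 0 \<and> vol (cball (0 :: real ^ 'n) r) = vol K) = ?r"
  proof (rule the_equality)
    show "0 \<le> ?r \<and> vol (cball (0 :: real ^ 'n) ?r) = vol K" using r vb[of ?r] rn \<omega> by simp
    fix s assume s: "0 \<le> s \<and> vol (cball (0 :: real ^ 'n) s) = vol K"
    then have "s ^ CARD('n) * ?\<omega> = vol K" using vb[of s] by simp
    then have "s ^ CARD('n) = ?r ^ CARD('n)" using rn \<omega> by (simp add: field_simps)
    then show "s = ?r" using s r by (intro power_eq_imp_eq_base[of s "CARD('n)" ?r]) auto
  qed
  then have b: "vol_ball K = cball 0 ?r" by (simp add: vol_ball_def)
  show "convex_body (vol_ball K)" using r by (simp add: b convex_body_def)
  show "vol (vol_ball K) = vol K" using r vb[of ?r] rn \<omega> by (simp add: b)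
  have "vol_ball K = (\<lambda>z. ?r *\<^sub>R z + 0) ` cball 0 1" unfolding b by (rule cball_eq_dilation[OF r])
  moreover have "linear ((*\<^sub>R) ?r :: real^'n \<Rightarrow> real^'n) \<and> bij ((*\<^sub>R) ?r :: real^'n \<Rightarrow> real^'n)" by (rule linear_scaleR_bij[OF less_imp_neq[OF r, symmetric]])
  ultimately show "petty (vol_ball K) = petty (cball 0 1 :: (real^'n) set)"
    using petty_affine_image[of "cball 0 1" "(*\<^sub>R) ?r" "0::real^'n"] by (simp add: convex_body_def)
qed

text \<open>The factor lost in comparing \<open>C_body \<delta> K\<close> with the polar projection body tends to 1, so it is eventually absorbed by the gap.\<close>

lemma C_body_inequality_uniform:
  assumes t: "t > 0"
  obtains w where "0 < w" "w \<le> 1 / 2"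
    "\<And>(K :: (real^'n) set) \<delta>. convex_body K \<Longrightarrow> t \<le> d_BM K (cball 0 1) \<Longrightarrow> 1 - w < \<delta> \<Longrightarrow> \<delta> < 1 \<Longrightarrow>
       vol (C_body \<delta> K) \<le> vol (C_body \<delta> (vol_ball K))"
proof -
  let ?n = "CARD('n)"
  obtain \<eta> where \<eta>: "0 < \<eta>" "\<eta> < 1"
    "\<And>K :: (real^'n) set. convex_body K \<Longrightarrow> t \<le> d_BM K (cball 0 1) \<Longrightarrow> petty K \<le> (1 - \<eta>) * petty (cball 0 1 :: (real^'n) set)"
    by (rule petty_gap[OF t], rule that)
  have "(\<lambda>N. ((1 - 1 / real N) ^ (?n - 1)) ^ ?n) \<longlonglongrightarrow> ((1 - 0) ^ (?n - 1)) ^ ?n"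
    by (intro tendsto_intros lim_1_over_n)
  then have "\<forall>\<^sub>F N in sequentially. 1 - \<eta> < ((1 - 1 / real N) ^ (?n - 1)) ^ ?n"
    using \<eta>(1) by (intro order_tendstoD) auto
  then obtain N0 where N0: "\<And>N. N \<ge> N0 \<Longrightarrow> 1 - \<eta> < ((1 - 1 / real N) ^ (?n - 1)) ^ ?n" by (auto simp: eventually_sequentially)
  define N where "N = max N0 2"
  have N: "N \<ge> 2" "1 - \<eta> < ((1 - 1 / real N) ^ (?n - 1)) ^ ?n" using N0[of N] by (auto simp: N_def)
  let ?q = "((1 - 1 / real N) ^ (?n - 1)) ^ ?n"
  have q: "?q > 0" using N by simp
  have "vol (C_body \<delta> K) \<le> vol (C_body \<delta> (vol_ball K))"
    if K: "convex_body K" and dt: "t \<le> d_BM K (cball 0 1)" and \<delta>: "1 - 1 / real N < \<delta>" "\<delta> < 1" for K :: "(real^'n) set" and \<delta>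
  proof -
    have Nd: "real N * (1 - \<delta>) < 1" using \<delta>(1) N(1) by (simp add: field_simps)
    let ?X = "(1 - \<delta>) ^ ?n * vol K" and ?b = "petty (cball 0 1 :: (real^'n) set)"
    have X: "?X > 0" using \<delta> vol_convex_body_pos[OF K] by simp
    have b: "?b > 0" by (rule petty_pos) (simp add: convex_body_def)
    note V = vol_ball_properties[OF K]
    have "vol (C_body \<delta> K) \<le> ?X * petty K / ?q" by (rule vol_C_body_le(1)[OF K \<delta>(2) N(1) Nd])
    also have "\<dots> \<le> ?X * (?q * ?b) / ?q"
    proof -
      have "petty K \<le> (1 - \<eta>) * ?b" by (rule \<eta>(3)[OF K dt])
      also have "\<dots> \<le> ?q * ?b" using N(2) b by (intro mult_right_mono) auto
      finally show ?thesis using X q by (intro divide_right_mono mult_left_mono) auto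
    qed
    also have "\<dots> = ?X * ?b"
    proof -
      have "a * (c * d) / c = a * d" if "c > 0" for a c d :: real using that by simp
      then show ?thesis using q .
    qed
    also have "\<dots> \<le> vol (C_body \<delta> (vol_ball K))" using vol_C_body_ge[OF V(1) \<delta>(2) N(1) Nd] by (simp only: V(2,3))
    finally show ?thesis .
  qed
  moreover have "0 < 1 / real N" "1 / real N \<le> 1 / 2" using N(1) by (auto simp: field_simps)
  ultimately show ?thesis using that by blast
qed

text \<open>The infimal convolution of \<open>g\<close> with the absolute value is 1-Lipschitz.\<close>

lemma lipschitz_minorant:
  fixes g :: "real \<Rightarrow> real"
  assumes g0: "g 0 = 0" and g: "\<And>t. t > 0 \<Longrightarrow> 0 < g t" and mono: "\<And>s t. 0 < s \<Longrightarrow> s \<le> t \<Longrightarrow> g s \<le> g t"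
  obtains \<omega> where "continuous_on {0..} \<omega>" "\<omega> 0 = 0" "\<And>t. t > 0 \<Longrightarrow> 0 < \<omega> t" "\<And>t. t \<ge> 0 \<Longrightarrow> \<omega> t \<le> g t"
proof -
  let ?S = "\<lambda>t. (\<lambda>s. g s + \<bar>t - s\<bar>) ` {0..}"
  define \<omega> where "\<omega> t = Inf (?S t)" for t
  have gn: "g s \<ge> 0" if "s \<ge> 0" for s using g[of s] g0 that by (cases "s = 0") auto
  have bdd: "bdd_below (?S t)" for t
  proof (rule bdd_belowI[of _ 0])
    fix x assume "x \<in> ?S t"
    then obtain s where "s \<ge> 0" "x = g s + \<bar>t - s\<bar>" by auto
    then show "0 \<le> x" using gn[of s] by simp
  qed
  have low: "\<omega> t \<le> g s + \<bar>t - s\<bar>" if "s \<ge> 0" for s t 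
    unfolding \<omega>_def by (rule cInf_lower[OF imageI bdd]) (simp add: that)
  have great: "b \<le> \<omega> t" if "\<And>s. s \<ge> 0 \<Longrightarrow> b \<le> g s + \<bar>t - s\<bar>" for b t
    unfolding \<omega>_def using that by (intro cInf_greatest) auto
  have lip: "\<omega> t \<le> \<omega> t' + \<bar>t - t'\<bar>" for t t'
  proof -
    have "\<omega> t - \<bar>t - t'\<bar> \<le> \<omega> t'"
    proof (rule great)
      fix s :: real assume "s \<ge> 0"
      from low[OF this, of t] show "\<omega> t - \<bar>t - t'\<bar> \<le> g s + \<bar>t' - s\<bar>" by linarith
    qed
    then show ?thesis by simp
  qed
  have "continuous_on {0..} \<omega>"
  proof (rule continuous_onI)
    fix x e :: real assume e: "e > 0"
    have "dist (\<omega> x') (\<omega> x) \<le> e" if "dist x' x < e" for x'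
      using lip[of x' x] lip[of x x'] that by (simp add: dist_real_def abs_le_iff)
    then show "\<exists>d>0. \<forall>x'\<in>{0..}. dist x' x < d \<longrightarrow> dist (\<omega> x') (\<omega> x) \<le> e" using e by blast
  qed
  moreover have "\<omega> 0 = 0" using low[of 0 0] great[of 0 0] g0 gn by force
  moreover have "0 < \<omega> t" if t: "t > 0" for t
  proof -
    have "min (g (t / 2)) (t / 2) \<le> \<omega> t"
    proof (rule great)
      fix s :: real assume s: "s \<ge> 0"
      show "min (g (t / 2)) (t / 2) \<le> g s + \<bar>t - s\<bar>"
      proof (cases "t / 2 \<le> s")
        case True
        then have "g (t / 2) \<le> g s" using t by (intro mono) auto
        then show ?thesis by linarith
      next
        case False
        then have "t / 2 \<le> \<bar>t - s\<bar>" by linarith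
        then show ?thesis using gn[OF s] by linarith
      qed
    qed
    moreover have "min (g (t / 2)) (t / 2) > 0" using g[of "t / 2"] t by simp
    ultimately show ?thesis by linarith
  qed
  moreover have "\<omega> t \<le> g t" if "t \<ge> 0" for t using low[OF that, of t] by simp
  ultimately show ?thesis by (rule that)
qed

theorem proposition1p4:
  "\<exists>\<phi> :: real \<Rightarrow> real.
     continuous_on {0..} \<phi> \<and>
     \<phi> ` {0..} \<subseteq> {0<..1} \<and>
     (\<forall>t\<ge>0. \<phi> t = 1 \<longleftrightarrow> t = 0) \<and>
     (\<forall>K :: (real ^ 'n) set. convex_body K \<and> \<not> ellipsoid K \<longrightarrow>
        (\<forall>\<delta>\<in>{0<..<1}. \<delta> > \<phi> (d_BM K (cball 0 1)) \<longrightarrow>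
           vol (C_body \<delta> K) \<le> vol (C_body \<delta> (vol_ball K))))"
proof -
  define good where "good t w \<longleftrightarrow> (\<forall>(K :: (real^'n) set) \<delta>. convex_body K \<longrightarrow> t \<le> d_BM K (cball 0 1) \<longrightarrow> 1 - w < \<delta> \<longrightarrow> \<delta> < 1 \<longrightarrow>
       vol (C_body \<delta> K) \<le> vol (C_body \<delta> (vol_ball K)))" for t w :: real
  \<comment> \<open>The bound \<open>1 / 2\<close> keeps \<open>\<phi>\<close> positive; the value of \<open>g\<close> at 0 is chosen such that \<open>\<phi> 0 = 1\<close>.\<close>
  let ?W = "\<lambda>t. {w. 0 \<le> w \<and> w \<le> 1 / 2 \<and> good t w}"
  define g where "g t = (if t = 0 then 0 else Sup (?W t))" for t
  have bdd: "bdd_above (?W t)" for t by (rule bdd_aboveI[of _ "1 / 2"]) auto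
  have zero: "0 \<in> ?W t" for t by (auto simp: good_def)
  have gpos: "0 < g t" if t: "t > 0" for t
  proof -
    obtain w where "0 < w" "w \<le> 1 / 2"
      "\<And>(K :: (real^'n) set) \<delta>. convex_body K \<Longrightarrow> t \<le> d_BM K (cball 0 1) \<Longrightarrow> 1 - w < \<delta> \<Longrightarrow> \<delta> < 1 \<Longrightarrow>
       vol (C_body \<delta> K) \<le> vol (C_body \<delta> (vol_ball K))" by (rule C_body_inequality_uniform[OF t], rule that)
    then have "w \<in> ?W t" "0 < w" by (auto simp: good_def)
    then show ?thesis using cSup_upper[OF _ bdd, of w t] t by (simp add: g_def)
  qed
  have gmono: "g s \<le> g t" if "0 < s" "s \<le> t" for s t
  proof -
    have "?W s \<subseteq> ?W t" using that by (auto simp: good_def)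
    then have "Sup (?W s) \<le> Sup (?W t)" using zero by (intro cSup_subset_mono bdd) blast+
    then show ?thesis using that by (simp add: g_def)
  qed
  have ghalf: "g t \<le> 1 / 2" for t
  proof (cases "t = 0")
    case False
    have ne: "?W t \<noteq> {}" using zero[of t] by blast
    have "Sup (?W t) \<le> 1 / 2" by (rule cSup_least[OF ne]) simp
    then show ?thesis using False by (simp add: g_def)
  qed (simp add: g_def)
  have g00: "g 0 = 0" by (simp add: g_def)
  obtain \<omega> where \<omega>: "continuous_on {0..} \<omega>" "\<omega> 0 = 0" "\<And>t. t > 0 \<Longrightarrow> 0 < \<omega> t" "\<And>t. t \<ge> 0 \<Longrightarrow> \<omega> t \<le> g t"
    by (rule lipschitz_minorant[of g, OF g00 gpos gmono], assumption+, rule that)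
  have \<omega>nn: "0 \<le> \<omega> t" if "t \<ge> 0" for t using \<omega>(2) \<omega>(3)[of t] that by (cases "t = 0") auto
  show ?thesis
  proof (intro exI[of _ "\<lambda>t. 1 - \<omega> t"] conjI allI impI ballI)
    show "continuous_on {0..} (\<lambda>t. 1 - \<omega> t)" by (intro continuous_intros \<omega>(1))
    show "(\<lambda>t. 1 - \<omega> t) ` {0..} \<subseteq> {0<..1}"
    proof
      fix y assume "y \<in> (\<lambda>t. 1 - \<omega> t) ` {0..}"
      then obtain t where t: "t \<ge> 0" "y = 1 - \<omega> t" by auto
      have "\<omega> t \<le> 1 / 2" using \<omega>(4)[OF t(1)] ghalf[of t] by simp
      then show "y \<in> {0<..1}" using t \<omega>nn[OF t(1)] by simp
    qed
    show "1 - \<omega> t = 1 \<longleftrightarrow> t = 0" if "0 \<le> t" for t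
      using \<omega>(2) \<omega>(3)[of t] that by (cases "t = 0") auto
    fix K :: "(real^'n) set" and \<delta> assume K: "convex_body K \<and> \<not> ellipsoid K" and \<delta>: "\<delta> \<in> {0<..<1}"
      and large: "1 - \<omega> (d_BM K (cball 0 1)) < \<delta>"
    let ?d = "d_BM K (cball 0 1)"
    have d0: "?d \<ge> 0" using K by (intro d_BM_nonneg) simp
    have dpos: "?d > 0" using d0 large \<delta> \<omega>(2) by (cases "?d = 0") auto
    have "1 - \<delta> < Sup (?W ?d)" using \<omega>(4)[OF d0] large dpos by (simp add: g_def)
    then obtain w where w: "w \<in> ?W ?d" "1 - \<delta> < w" using less_cSupD[of "?W ?d" "1 - \<delta>"] zero by blast
    then show "vol (C_body \<delta> K) \<le> vol (C_body \<delta> (vol_ball K))"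
      using K \<delta> by (auto simp: good_def)
  qed
qed

end
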